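(* Let $k$ be a field of any characteristic, let $q \in k^* = k \setminus \{0\}$, let $n \in \mathbb{Z}$, and let $\mathcal{A}$ be the universal quantum $ax+b$ group over $k$. Let $\mathcal{I}_{q,n}$ be the two-sided ideal of $\mathcal{A}$ generated by $a^n b - q\, b a^n$. Then $\mathcal{I}_{q,n}$ is a Hopf ideal of $\mathcal{A}$. Consequently the quotient $\mathcal{A}_{q,n} = \mathcal{A}/\mathcal{I}_{q,n}$ is a quantum subgroup of $\mathcal{A}$; and, for every integer $m \neq 0$, $\mathcal{A}_{q,n}$ is a quantum subgroup of $\mathcal{A}_{q^m, mn}$ (via the map sending the classes of $a, b$ to the classes of $a, b$). In particular, $\mathcal{A}_q := \mathcal{A}_{q,1}$ is a quantum subgroup of $\mathcal{A}_{q^m, m}$ for every integer $m \ne 0$.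
   Context: The universal quantum $ax+b$ group $\mathcal{A}$ over $k$ is the Hopf algebra which, as a unital $k$-algebra, is generated by $a, a^{-1}, b$ subject only to $a a^{-1} = 1 = a^{-1} a$, with $\Delta(a) = a \otimes a$, $\Delta(b) = b \otimes a + 1 \otimes b$, $\epsilon(a) = 1$, $\epsilon(b) = 0$, $S(a) = a^{-1}$, $S(b) = -b a^{-1}$. A Hopf ideal of a Hopf algebra $H$ is a two-sided ideal $I$ with $\Delta(I) \subseteq I \otimes H + H \otimes I$, $\epsilon(I) = 0$, and $S(I) \subseteq I$. Quantum groups are Hopf algebras (viewed as algebras of functions), and a quantum group $H'$ is a quantum subgroup of a quantum group $H$ if there is a surjective Hopf algebra morphism $H \to H'$. *)

theory Defs
  imports "HOL-Algebra.QuotRing" "HOL-Algebra.Module"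
begin

section \<open>Algebras over a field\<close>

text \<open>The locale \<^locale>\<open>algebra\<close> of the library is about commutative algebras only.\<close>

locale unital_algebra = K?: field K + A?: ring A + module K A
  for K (structure) and A (structure) +
  assumes smult_mult_left:
      "\<lbrakk>c \<in> carrier K; x \<in> carrier A; y \<in> carrier A\<rbrakk>
        \<Longrightarrow> (c \<odot>\<^bsub>A\<^esub> x) \<otimes>\<^bsub>A\<^esub> y = c \<odot>\<^bsub>A\<^esub> (x \<otimes>\<^bsub>A\<^esub> y)"
    and smult_mult_right:
      "\<lbrakk>c \<in> carrier K; x \<in> carrier A; y \<in> carrier A\<rbrakk>
        \<Longrightarrow> x \<otimes>\<^bsub>A\<^esub> (c \<odot>\<^bsub>A\<^esub> y) = c \<odot>\<^bsub>A\<^esub> (x \<otimes>\<^bsub>A\<^esub> y)"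

definition linear_hom ::
  "('k, 'n) ring_scheme \<Rightarrow> ('k, 'v, 'p) module_scheme \<Rightarrow> ('k, 'w, 'r) module_scheme \<Rightarrow> ('v \<Rightarrow> 'w) set"
  where "linear_hom K V W = {f \<in> carrier V \<rightarrow> carrier W.
    (\<forall>x \<in> carrier V. \<forall>y \<in> carrier V. f (x \<oplus>\<^bsub>V\<^esub> y) = f x \<oplus>\<^bsub>W\<^esub> f y) \<and>
    (\<forall>c \<in> carrier K. \<forall>x \<in> carrier V. f (c \<odot>\<^bsub>V\<^esub> x) = c \<odot>\<^bsub>W\<^esub> f x)}"

definition algebra_hom ::
  "('k, 'n) ring_scheme \<Rightarrow> ('k, 'a, 'p) module_scheme \<Rightarrow> ('k, 'b, 'r) module_scheme \<Rightarrow> ('a \<Rightarrow> 'b) set"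
  where "algebra_hom K A B = ring_hom A B \<inter> linear_hom K A B"

definition base_algebra :: "('k, 'n) ring_scheme \<Rightarrow> ('k, 'k) module"
  where "base_algebra K = ring.extend (ring.truncate K) (module.fields (mult K))"

definition opposite_algebra :: "('k, 'a, 'p) module_scheme \<Rightarrow> ('k, 'a, 'p) module_scheme"
  where "opposite_algebra A = A\<lparr>mult := \<lambda>x y. y \<otimes>\<^bsub>A\<^esub> x\<rparr>"

definition submodule_span ::
  "('k, 'n) ring_scheme \<Rightarrow> ('k, 'v, 'p) module_scheme \<Rightarrow> 'v set \<Rightarrow> 'v set"
  where "submodule_span K V S = \<Inter>{N. submodule N K V \<and> S \<subseteq> N}"

definition quotient_algebra :: "('k, 'a, 'p) module_scheme \<Rightarrow> 'a set \<Rightarrow> ('k, 'a set) module"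
  where "quotient_algebra A I =
    ring.extend (A Quot I) (module.fields (\<lambda>c X. \<Union>x\<in>X. I +>\<^bsub>A\<^esub> (c \<odot>\<^bsub>A\<^esub> x)))"


section \<open>Monoid algebras and free algebras\<close>

definition supp :: "('k, 'n) ring_scheme \<Rightarrow> ('g \<Rightarrow> 'k) \<Rightarrow> 'g set"
  where "supp K f = {x. f x \<noteq> \<zero>\<^bsub>K\<^esub>}"

definition basis_elem :: "('k, 'n) ring_scheme \<Rightarrow> 'g \<Rightarrow> 'g \<Rightarrow> 'k"
  where "basis_elem K g = (\<lambda>x. if x = g then \<one>\<^bsub>K\<^esub> else \<zero>\<^bsub>K\<^esub>)"

text \<open>As a module, this is the free module on the carrier of the monoid.\<close>

definition monoid_algebra ::
  "('k, 'n) ring_scheme \<Rightarrow> ('g, 'p) monoid_scheme \<Rightarrow> ('k, 'g \<Rightarrow> 'k) module"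
  where "monoid_algebra K G =
    \<lparr>carrier = {f. range f \<subseteq> carrier K \<and> finite (supp K f) \<and> supp K f \<subseteq> carrier G},
     mult = (\<lambda>f g z. \<Oplus>\<^bsub>K\<^esub>p \<in> {(x, y). x \<in> supp K f \<and> y \<in> supp K g \<and> x \<otimes>\<^bsub>G\<^esub> y = z}.
       f (fst p) \<otimes>\<^bsub>K\<^esub> g (snd p)),
     one = basis_elem K \<one>\<^bsub>G\<^esub>,
     zero = (\<lambda>x. \<zero>\<^bsub>K\<^esub>),
     add = (\<lambda>f g x. f x \<oplus>\<^bsub>K\<^esub> g x),
     smult = (\<lambda>c f x. c \<otimes>\<^bsub>K\<^esub> f x)\<rparr>"

definition linear_extension ::
  "('k, 'n) ring_scheme \<Rightarrow> ('k, 'v, 'p) module_scheme \<Rightarrow> ('g \<Rightarrow> 'v) \<Rightarrow> ('g \<Rightarrow> 'k) \<Rightarrow> 'v"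
  where "linear_extension K V h f = (\<Oplus>\<^bsub>V\<^esub>x \<in> supp K f. f x \<odot>\<^bsub>V\<^esub> h x)"

definition free_monoid :: "'x list monoid"
  where "free_monoid = \<lparr>carrier = UNIV, mult = (@), one = []\<rparr>"

definition free_algebra :: "('k, 'n) ring_scheme \<Rightarrow> ('k, 'x list \<Rightarrow> 'k) module"
  where "free_algebra K = monoid_algebra K free_monoid"

definition free_lift ::
  "('k, 'n) ring_scheme \<Rightarrow> ('k, 'b, 'p) module_scheme \<Rightarrow> ('x \<Rightarrow> 'b) \<Rightarrow> ('x list \<Rightarrow> 'k) \<Rightarrow> 'b"
  where "free_lift K B g = linear_extension K B (\<lambda>w. foldr (\<lambda>x y. g x \<otimes>\<^bsub>B\<^esub> y) w \<one>\<^bsub>B\<^esub>)"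


section \<open>Tensor products\<close>

text \<open>
  The tensor product is the free module on pairs modulo the submodule generated by the
  bilinearity relations. The free module on pairs is taken with the multiplication of
  the monoid algebra of the product of the multiplicative monoids, so that the quotient carries
  the usual product, under which (v \<otimes> w)(v' \<otimes> w') = vv' \<otimes> ww'.
\<close>

definition tensor_free ::
  "('k, 'n) ring_scheme \<Rightarrow> ('k, 'v, 'p) module_scheme \<Rightarrow> ('k, 'w, 'r) module_scheme
    \<Rightarrow> ('k, 'v \<times> 'w \<Rightarrow> 'k) module"
  where "tensor_free K V W = monoid_algebra K (V \<times>\<times> W)"

definition tensor_relations ::
  "('k, 'n) ring_scheme \<Rightarrow> ('k, 'v, 'p) module_scheme \<Rightarrow> ('k, 'w, 'r) module_scheme
    \<Rightarrow> ('v \<times> 'w \<Rightarrow> 'k) set"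
  where "tensor_relations K V W =
    (let F = tensor_free K V W; e = basis_elem K in
      {e (v \<oplus>\<^bsub>V\<^esub> v', w) \<ominus>\<^bsub>F\<^esub> (e (v, w) \<oplus>\<^bsub>F\<^esub> e (v', w)) | v v' w.
        v \<in> carrier V \<and> v' \<in> carrier V \<and> w \<in> carrier W} \<union>
      {e (v, w \<oplus>\<^bsub>W\<^esub> w') \<ominus>\<^bsub>F\<^esub> (e (v, w) \<oplus>\<^bsub>F\<^esub> e (v, w')) | v w w'.
        v \<in> carrier V \<and> w \<in> carrier W \<and> w' \<in> carrier W} \<union>
      {e (c \<odot>\<^bsub>V\<^esub> v, w) \<ominus>\<^bsub>F\<^esub> c \<odot>\<^bsub>F\<^esub> e (v, w) | c v w.
        c \<in> carrier K \<and> v \<in> carrier V \<and> w \<in> carrier W} \<union>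
      {e (v, c \<odot>\<^bsub>W\<^esub> w) \<ominus>\<^bsub>F\<^esub> c \<odot>\<^bsub>F\<^esub> e (v, w) | c v w.
        c \<in> carrier K \<and> v \<in> carrier V \<and> w \<in> carrier W})"

definition tensor_kernel ::
  "('k, 'n) ring_scheme \<Rightarrow> ('k, 'v, 'p) module_scheme \<Rightarrow> ('k, 'w, 'r) module_scheme
    \<Rightarrow> ('v \<times> 'w \<Rightarrow> 'k) set"
  where "tensor_kernel K V W = submodule_span K (tensor_free K V W) (tensor_relations K V W)"

definition tensor ::
  "('k, 'n) ring_scheme \<Rightarrow> ('k, 'v, 'p) module_scheme \<Rightarrow> ('k, 'w, 'r) module_scheme
    \<Rightarrow> ('k, ('v \<times> 'w \<Rightarrow> 'k) set) module"
  where "tensor K V W = quotient_algebra (tensor_free K V W) (tensor_kernel K V W)"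

definition pure_tensor ::
  "('k, 'n) ring_scheme \<Rightarrow> ('k, 'v, 'p) module_scheme \<Rightarrow> ('k, 'w, 'r) module_scheme
    \<Rightarrow> 'v \<Rightarrow> 'w \<Rightarrow> ('v \<times> 'w \<Rightarrow> 'k) set"
  where "pure_tensor K V W v w =
    tensor_kernel K V W +>\<^bsub>tensor_free K V W\<^esub> basis_elem K (v, w)"

text \<open>
  The linear map on the tensor product induced by a bilinear map; it is evaluated on the
  representatives of a coset, which have a common image (compare \<open>FactRing\<close> and
  \<^const>\<open>the_elem\<close> in the homomorphism theorem for rings).
\<close>

definition tensor_lift ::
  "('k, 'n) ring_scheme \<Rightarrow> ('k, 'u, 's) module_scheme \<Rightarrow> ('v \<Rightarrow> 'w \<Rightarrow> 'u)
    \<Rightarrow> ('v \<times> 'w \<Rightarrow> 'k) set \<Rightarrow> 'u"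
  where "tensor_lift K U \<beta> X = the_elem (linear_extension K U (\<lambda>(v, w). \<beta> v w) ` X)"

definition tensor_map ::
  "('k, 'n) ring_scheme \<Rightarrow> ('k, 'v, 'p) module_scheme \<Rightarrow> ('k, 'w, 'r) module_scheme
    \<Rightarrow> ('x \<Rightarrow> 'v) \<Rightarrow> ('y \<Rightarrow> 'w) \<Rightarrow> ('x \<times> 'y \<Rightarrow> 'k) set \<Rightarrow> ('v \<times> 'w \<Rightarrow> 'k) set"
  where "tensor_map K V W f g =
    tensor_lift K (tensor K V W) (\<lambda>x y. pure_tensor K V W (f x) (g y))"

definition tensor_assoc ::
  "('k, 'n) ring_scheme \<Rightarrow> ('k, 'u, 'p) module_scheme \<Rightarrow> ('k, 'v, 'r) module_scheme
    \<Rightarrow> ('k, 'w, 's) module_scheme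
    \<Rightarrow> (('u \<times> 'v \<Rightarrow> 'k) set \<times> 'w \<Rightarrow> 'k) set \<Rightarrow> ('u \<times> ('v \<times> 'w \<Rightarrow> 'k) set \<Rightarrow> 'k) set"
  where "tensor_assoc K U V W =
    (let T = tensor K U (tensor K V W) in
      tensor_lift K T (\<lambda>t z. tensor_lift K T
        (\<lambda>x y. pure_tensor K U (tensor K V W) x (pure_tensor K V W y z)) t))"

text \<open>The image of \<open>I \<otimes> J\<close> in \<open>V \<otimes> W\<close>, for subspaces \<open>I\<close> of \<open>V\<close> and \<open>J\<close> of \<open>W\<close>.\<close>

definition tensor_subspace ::
  "('k, 'n) ring_scheme \<Rightarrow> ('k, 'v, 'p) module_scheme \<Rightarrow> ('k, 'w, 'r) module_scheme
    \<Rightarrow> 'v set \<Rightarrow> 'w set \<Rightarrow> ('v \<times> 'w \<Rightarrow> 'k) set set"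
  where "tensor_subspace K V W I J =
    submodule_span K (tensor K V W) {pure_tensor K V W v w | v w. v \<in> I \<and> w \<in> J}"


section \<open>Hopf algebras\<close>

record ('k, 'a) hopf = "('k, 'a) module" +
  comult :: "'a \<Rightarrow> ('a \<times> 'a \<Rightarrow> 'k) set"
  counit :: "'a \<Rightarrow> 'k"
  antipode :: "'a \<Rightarrow> 'a"

locale hopf_algebra = unital_algebra K H
  for K :: "('k, 'n) ring_scheme" (structure) and H :: "('k, 'a, 'h) hopf_scheme" (structure) +
  assumes comult_hom: "comult H \<in> algebra_hom K H (tensor K H H)"
    and counit_hom: "counit H \<in> algebra_hom K H (base_algebra K)"
    and antipode_linear: "antipode H \<in> linear_hom K H H"
    and coassoc: "h \<in> carrier H \<Longrightarrow>
      tensor_assoc K H H H (tensor_map K (tensor K H H) H (comult H) (\<lambda>x. x) (comult H h)) =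
      tensor_map K H (tensor K H H) (\<lambda>x. x) (comult H) (comult H h)"
    and counit_left: "h \<in> carrier H \<Longrightarrow>
      tensor_lift K H (\<lambda>x y. counit H x \<odot>\<^bsub>H\<^esub> y) (comult H h) = h"
    and counit_right: "h \<in> carrier H \<Longrightarrow>
      tensor_lift K H (\<lambda>x y. counit H y \<odot>\<^bsub>H\<^esub> x) (comult H h) = h"
    and antipode_left: "h \<in> carrier H \<Longrightarrow>
      tensor_lift K H (\<lambda>x y. antipode H x \<otimes>\<^bsub>H\<^esub> y) (comult H h) = counit H h \<odot>\<^bsub>H\<^esub> \<one>\<^bsub>H\<^esub>"
    and antipode_right: "h \<in> carrier H \<Longrightarrow>
      tensor_lift K H (\<lambda>x y. x \<otimes>\<^bsub>H\<^esub> antipode H y) (comult H h) = counit H h \<odot>\<^bsub>H\<^esub> \<one>\<^bsub>H\<^esub>"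

definition hopf_hom ::
  "('k, 'n) ring_scheme \<Rightarrow> ('k, 'a, 'p) hopf_scheme \<Rightarrow> ('k, 'b, 'r) hopf_scheme \<Rightarrow> ('a \<Rightarrow> 'b) set"
  where "hopf_hom K H H' = {f \<in> algebra_hom K H H'. \<forall>x \<in> carrier H.
    comult H' (f x) = tensor_map K H' H' f f (comult H x) \<and>
    counit H' (f x) = counit H x \<and>
    antipode H' (f x) = f (antipode H x)}"

definition surj_hopf_hom ::
  "('k, 'n) ring_scheme \<Rightarrow> ('k, 'a, 'p) hopf_scheme \<Rightarrow> ('k, 'b, 'r) hopf_scheme \<Rightarrow> ('a \<Rightarrow> 'b) set"
  where "surj_hopf_hom K H H' = {f \<in> hopf_hom K H H'. f ` carrier H = carrier H'}"

definition quantum_subgroup ::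
  "('k, 'n) ring_scheme \<Rightarrow> ('k, 'b, 'r) hopf_scheme \<Rightarrow> ('k, 'a, 'p) hopf_scheme \<Rightarrow> bool"
  where "quantum_subgroup K H' H \<longleftrightarrow>
    hopf_algebra K H' \<and> hopf_algebra K H \<and> surj_hopf_hom K H H' \<noteq> {}"

text \<open>In the library an \<open>ideal\<close> is two-sided.\<close>

definition hopf_ideal :: "('k, 'n) ring_scheme \<Rightarrow> ('k, 'a, 'p) hopf_scheme \<Rightarrow> 'a set \<Rightarrow> bool"
  where "hopf_ideal K H I \<longleftrightarrow> hopf_algebra K H \<and> ideal I H \<and>
    comult H ` I \<subseteq>
      tensor_subspace K H H I (carrier H) <+>\<^bsub>tensor K H H\<^esub> tensor_subspace K H H (carrier H) I \<and>
    (\<forall>x \<in> I. counit H x = \<zero>\<^bsub>K\<^esub>) \<and>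
    antipode H ` I \<subseteq> I"

definition quotient_hopf ::
  "('k, 'n) ring_scheme \<Rightarrow> ('k, 'a, 'p) hopf_scheme \<Rightarrow> 'a set \<Rightarrow> ('k, 'a set) hopf"
  where "quotient_hopf K H I =
    (let Q = quotient_algebra H I; \<pi> = (\<lambda>x. I +>\<^bsub>H\<^esub> x) in
      module.extend Q (hopf.fields
        (\<lambda>X. the_elem ((\<lambda>x. tensor_map K Q Q \<pi> \<pi> (comult H x)) ` X))
        (\<lambda>X. the_elem (counit H ` X))
        (\<lambda>X. the_elem ((\<lambda>x. \<pi> (antipode H x)) ` X))))"


section \<open>The universal quantum \<open>ax + b\<close> group and its quotients\<close>

datatype axb_letter = Letter_a | Letter_a_inv | Letter_b

definition axb_relations :: "('k, 'n) ring_scheme \<Rightarrow> (axb_letter list \<Rightarrow> 'k) set"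
  where "axb_relations K =
    (let F = free_algebra K; e = basis_elem K in
      {e [Letter_a, Letter_a_inv] \<ominus>\<^bsub>F\<^esub> \<one>\<^bsub>F\<^esub>, e [Letter_a_inv, Letter_a] \<ominus>\<^bsub>F\<^esub> \<one>\<^bsub>F\<^esub>})"

definition axb_kernel :: "('k, 'n) ring_scheme \<Rightarrow> (axb_letter list \<Rightarrow> 'k) set"
  where "axb_kernel K = Idl\<^bsub>free_algebra K\<^esub> (axb_relations K)"

definition axb_algebra :: "('k, 'n) ring_scheme \<Rightarrow> ('k, (axb_letter list \<Rightarrow> 'k) set) module"
  where "axb_algebra K = quotient_algebra (free_algebra K) (axb_kernel K)"

definition axb_gen :: "('k, 'n) ring_scheme \<Rightarrow> axb_letter \<Rightarrow> (axb_letter list \<Rightarrow> 'k) set"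
  where "axb_gen K l = axb_kernel K +>\<^bsub>free_algebra K\<^esub> basis_elem K [l]"

abbreviation axb_a :: "('k, 'n) ring_scheme \<Rightarrow> (axb_letter list \<Rightarrow> 'k) set"
  where "axb_a K \<equiv> axb_gen K Letter_a"

abbreviation axb_a_inv :: "('k, 'n) ring_scheme \<Rightarrow> (axb_letter list \<Rightarrow> 'k) set"
  where "axb_a_inv K \<equiv> axb_gen K Letter_a_inv"

abbreviation axb_b :: "('k, 'n) ring_scheme \<Rightarrow> (axb_letter list \<Rightarrow> 'k) set"
  where "axb_b K \<equiv> axb_gen K Letter_b"

text \<open>The algebra homomorphism with prescribed values on the generators.\<close>

definition axb_lift ::
  "('k, 'n) ring_scheme \<Rightarrow> ('k, 'b, 'p) module_scheme \<Rightarrow> (axb_letter \<Rightarrow> 'b)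
    \<Rightarrow> (axb_letter list \<Rightarrow> 'k) set \<Rightarrow> 'b"
  where "axb_lift K B g X = the_elem (free_lift K B g ` X)"

text \<open>
  The values on the inverse of \<open>a\<close> are forced by those on \<open>a\<close>. The antipode is the
  antihomomorphism with the prescribed values, that is, a homomorphism to the opposite algebra.
\<close>

definition axb_comult_gen ::
  "('k, 'n) ring_scheme \<Rightarrow> axb_letter
    \<Rightarrow> ((axb_letter list \<Rightarrow> 'k) set \<times> (axb_letter list \<Rightarrow> 'k) set \<Rightarrow> 'k) set"
  where "axb_comult_gen K l =
    (let A = axb_algebra K; T = tensor K A A; t = pure_tensor K A A in
      case l of
        Letter_a \<Rightarrow> t (axb_a K) (axb_a K)
      | Letter_a_inv \<Rightarrow> t (axb_a_inv K) (axb_a_inv K)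
      | Letter_b \<Rightarrow> t (axb_b K) (axb_a K) \<oplus>\<^bsub>T\<^esub> t \<one>\<^bsub>A\<^esub> (axb_b K))"

definition axb_counit_gen :: "('k, 'n) ring_scheme \<Rightarrow> axb_letter \<Rightarrow> 'k"
  where "axb_counit_gen K l =
    (case l of Letter_a \<Rightarrow> \<one>\<^bsub>K\<^esub> | Letter_a_inv \<Rightarrow> \<one>\<^bsub>K\<^esub> | Letter_b \<Rightarrow> \<zero>\<^bsub>K\<^esub>)"

definition axb_antipode_gen ::
  "('k, 'n) ring_scheme \<Rightarrow> axb_letter \<Rightarrow> (axb_letter list \<Rightarrow> 'k) set"
  where "axb_antipode_gen K l =
    (let A = axb_algebra K in
      case l of
        Letter_a \<Rightarrow> axb_a_inv K
      | Letter_a_inv \<Rightarrow> axb_a K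
      | Letter_b \<Rightarrow> \<ominus>\<^bsub>A\<^esub> (axb_b K \<otimes>\<^bsub>A\<^esub> axb_a_inv K))"

definition axb :: "('k, 'n) ring_scheme \<Rightarrow> ('k, (axb_letter list \<Rightarrow> 'k) set) hopf"
  where "axb K =
    (let A = axb_algebra K in
      module.extend A (hopf.fields
        (axb_lift K (tensor K A A) (axb_comult_gen K))
        (axb_lift K (base_algebra K) (axb_counit_gen K))
        (axb_lift K (opposite_algebra A) (axb_antipode_gen K))))"

definition axb_ideal :: "('k, 'n) ring_scheme \<Rightarrow> 'k \<Rightarrow> int \<Rightarrow> (axb_letter list \<Rightarrow> 'k) set set"
  where "axb_ideal K q n =
    (let A = axb K; a = axb_a K; b = axb_b K in
      Idl\<^bsub>A\<^esub> {(a [^]\<^bsub>A\<^esub> n) \<otimes>\<^bsub>A\<^esub> b \<ominus>\<^bsub>A\<^esub> q \<odot>\<^bsub>A\<^esub> (b \<otimes>\<^bsub>A\<^esub> (a [^]\<^bsub>A\<^esub> n))})"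

definition axb_quot :: "('k, 'n) ring_scheme \<Rightarrow> 'k \<Rightarrow> int \<Rightarrow> ('k, (axb_letter list \<Rightarrow> 'k) set set) hopf"
  where "axb_quot K q n = quotient_hopf K (axb K) (axb_ideal K q n)"

definition axb_class ::
  "('k, 'n) ring_scheme \<Rightarrow> 'k \<Rightarrow> int \<Rightarrow> (axb_letter list \<Rightarrow> 'k) set \<Rightarrow> (axb_letter list \<Rightarrow> 'k) set set"
  where "axb_class K q n x = axb_ideal K q n +>\<^bsub>axb K\<^esub> x"

end

(* A Hopf algebra generated by an invertible a and an element b, whose comultiplication and counit
   are algebra homomorphisms and whose antipode is an antihomomorphism, is determined by the values of
   these maps on a and b: the counit and coassociativity axioms compare algebra homomorphisms, so they
   need checking on generators only, and the antipode axioms hold on a subalgebra. This one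
   criterion covers the universal quantum ax + b group and all its quotients, and likewise an
   algebra homomorphism between two of them that matches the generators respects all structure.

   With c = a^n and r = c b - q b c,
     Delta(r) = r (x) a c + c (x) r,   epsilon(r) = 0,   S(r) = - c^-1 r a^-1 c^-1,
   so r generates a Hopf ideal. In the quotient c b = q b c, hence c^m b = q^m b c^m for every
   integer m, so the quotient map kills the relator for q^m and m n. *)

theory Submission
  imports Defs
begin

section \<open>Linear maps, spans and generated subalgebras\<close>

text \<open>The structure maps are concrete functions on cosets: a tensor product is a quotient of a
  free module on pairs, and a lift returns the only element in the image of a coset. Such a function
  has known values only once the underlying linear map is shown to kill the subspace or ideal, so
  each construction comes with a vanishing statement.

  The conditions on a Hopf ideal \<open>I\<close> concern all of its elements, while only the
  relator can be computed. They are therefore restated as the vanishing of algebra homomorphisms: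
  \<Delta> followed by the quotient of H \<otimes> H by I \<otimes> H + H \<otimes> I, the counit,
  and S followed by the projection to H/I with the opposite product. Kernels are ideals, so the
  value at the relator decides.

  The antipode axioms escape the comparison of homomorphisms, because the map x \<otimes> y
  \<mapsto> S(x) y is in general not multiplicative. What survives is a one-sided absorption rule,
  strong enough for an induction over expressions in the generators.\<close>

lemma unital_algebraI:
  fixes K (structure) and A (structure)
  assumes "field K"
    and "\<And>x y. \<lbrakk>x \<in> carrier A; y \<in> carrier A\<rbrakk> \<Longrightarrow> x \<oplus>\<^bsub>A\<^esub> y \<in> carrier A"
    and "\<zero>\<^bsub>A\<^esub> \<in> carrier A"
    and "\<And>x y z. \<lbrakk>x \<in> carrier A; y \<in> carrier A; z \<in> carrier A\<rbrakk>
      \<Longrightarrow> (x \<oplus>\<^bsub>A\<^esub> y) \<oplus>\<^bsub>A\<^esub> z = x \<oplus>\<^bsub>A\<^esub> (y \<oplus>\<^bsub>A\<^esub> z)"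
    and "\<And>x y. \<lbrakk>x \<in> carrier A; y \<in> carrier A\<rbrakk> \<Longrightarrow> x \<oplus>\<^bsub>A\<^esub> y = y \<oplus>\<^bsub>A\<^esub> x"
    and "\<And>x. x \<in> carrier A \<Longrightarrow> \<zero>\<^bsub>A\<^esub> \<oplus>\<^bsub>A\<^esub> x = x"
    and "\<And>x. x \<in> carrier A \<Longrightarrow> \<exists>y \<in> carrier A. y \<oplus>\<^bsub>A\<^esub> x = \<zero>\<^bsub>A\<^esub>"
    and "\<And>x y. \<lbrakk>x \<in> carrier A; y \<in> carrier A\<rbrakk> \<Longrightarrow> x \<otimes>\<^bsub>A\<^esub> y \<in> carrier A"
    and "\<one>\<^bsub>A\<^esub> \<in> carrier A"
    and "\<And>x y z. \<lbrakk>x \<in> carrier A; y \<in> carrier A; z \<in> carrier A\<rbrakk>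
      \<Longrightarrow> (x \<otimes>\<^bsub>A\<^esub> y) \<otimes>\<^bsub>A\<^esub> z = x \<otimes>\<^bsub>A\<^esub> (y \<otimes>\<^bsub>A\<^esub> z)"
    and "\<And>x. x \<in> carrier A \<Longrightarrow> \<one>\<^bsub>A\<^esub> \<otimes>\<^bsub>A\<^esub> x = x"
    and "\<And>x. x \<in> carrier A \<Longrightarrow> x \<otimes>\<^bsub>A\<^esub> \<one>\<^bsub>A\<^esub> = x"
    and "\<And>x y z. \<lbrakk>x \<in> carrier A; y \<in> carrier A; z \<in> carrier A\<rbrakk>
      \<Longrightarrow> (x \<oplus>\<^bsub>A\<^esub> y) \<otimes>\<^bsub>A\<^esub> z = x \<otimes>\<^bsub>A\<^esub> z \<oplus>\<^bsub>A\<^esub> y \<otimes>\<^bsub>A\<^esub> z"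
    and "\<And>x y z. \<lbrakk>x \<in> carrier A; y \<in> carrier A; z \<in> carrier A\<rbrakk>
      \<Longrightarrow> z \<otimes>\<^bsub>A\<^esub> (x \<oplus>\<^bsub>A\<^esub> y) = z \<otimes>\<^bsub>A\<^esub> x \<oplus>\<^bsub>A\<^esub> z \<otimes>\<^bsub>A\<^esub> y"
    and "\<And>c x. \<lbrakk>c \<in> carrier K; x \<in> carrier A\<rbrakk> \<Longrightarrow> c \<odot>\<^bsub>A\<^esub> x \<in> carrier A"
    and "\<And>c d x. \<lbrakk>c \<in> carrier K; d \<in> carrier K; x \<in> carrier A\<rbrakk>
      \<Longrightarrow> (c \<oplus> d) \<odot>\<^bsub>A\<^esub> x = c \<odot>\<^bsub>A\<^esub> x \<oplus>\<^bsub>A\<^esub> d \<odot>\<^bsub>A\<^esub> x"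
    and "\<And>c x y. \<lbrakk>c \<in> carrier K; x \<in> carrier A; y \<in> carrier A\<rbrakk>
      \<Longrightarrow> c \<odot>\<^bsub>A\<^esub> (x \<oplus>\<^bsub>A\<^esub> y) = c \<odot>\<^bsub>A\<^esub> x \<oplus>\<^bsub>A\<^esub> c \<odot>\<^bsub>A\<^esub> y"
    and "\<And>c d x. \<lbrakk>c \<in> carrier K; d \<in> carrier K; x \<in> carrier A\<rbrakk>
      \<Longrightarrow> (c \<otimes> d) \<odot>\<^bsub>A\<^esub> x = c \<odot>\<^bsub>A\<^esub> (d \<odot>\<^bsub>A\<^esub> x)"
    and "\<And>x. x \<in> carrier A \<Longrightarrow> \<one> \<odot>\<^bsub>A\<^esub> x = x"
    and "\<And>c x y. \<lbrakk>c \<in> carrier K; x \<in> carrier A; y \<in> carrier A\<rbrakk>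
      \<Longrightarrow> (c \<odot>\<^bsub>A\<^esub> x) \<otimes>\<^bsub>A\<^esub> y = c \<odot>\<^bsub>A\<^esub> (x \<otimes>\<^bsub>A\<^esub> y)"
    and "\<And>c x y. \<lbrakk>c \<in> carrier K; x \<in> carrier A; y \<in> carrier A\<rbrakk>
      \<Longrightarrow> x \<otimes>\<^bsub>A\<^esub> (c \<odot>\<^bsub>A\<^esub> y) = c \<odot>\<^bsub>A\<^esub> (x \<otimes>\<^bsub>A\<^esub> y)"
  shows "unital_algebra K A"
proof -
  interpret K: field K by fact
  have ag: "abelian_group A" by (rule abelian_groupI) (fact assms)+
  have mo: "monoid A" by (rule monoidI) (fact assms)+
  have ri: "ring A" by (rule ringI) (fact ag mo assms)+
  have md: "module K A" by (rule moduleI) (fact K.is_cring ag assms)+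
  show ?thesis
    by (intro unital_algebra.intro unital_algebra_axioms.intro) (fact ri md assms)+
qed

section \<open>Linear maps, algebra homomorphisms and their kernels\<close>

lemma linear_homI:
  assumes "\<And>x. x \<in> carrier V \<Longrightarrow> f x \<in> carrier W"
    and "\<And>x y. \<lbrakk>x \<in> carrier V; y \<in> carrier V\<rbrakk> \<Longrightarrow> f (x \<oplus>\<^bsub>V\<^esub> y) = f x \<oplus>\<^bsub>W\<^esub> f y"
    and "\<And>c x. \<lbrakk>c \<in> carrier K; x \<in> carrier V\<rbrakk> \<Longrightarrow> f (c \<odot>\<^bsub>V\<^esub> x) = c \<odot>\<^bsub>W\<^esub> f x"
  shows "f \<in> linear_hom K V W"
  using assms by (auto simp: linear_hom_def)

lemma linear_homD:
  assumes "f \<in> linear_hom K V W"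
  shows "x \<in> carrier V \<Longrightarrow> f x \<in> carrier W"
    and "\<lbrakk>x \<in> carrier V; y \<in> carrier V\<rbrakk> \<Longrightarrow> f (x \<oplus>\<^bsub>V\<^esub> y) = f x \<oplus>\<^bsub>W\<^esub> f y"
    and "\<lbrakk>c \<in> carrier K; x \<in> carrier V\<rbrakk> \<Longrightarrow> f (c \<odot>\<^bsub>V\<^esub> x) = c \<odot>\<^bsub>W\<^esub> f x"
  using assms by (auto simp: linear_hom_def)

lemma algebra_homI:
  assumes "f \<in> linear_hom K A B"
    and "\<And>x y. \<lbrakk>x \<in> carrier A; y \<in> carrier A\<rbrakk> \<Longrightarrow> f (x \<otimes>\<^bsub>A\<^esub> y) = f x \<otimes>\<^bsub>B\<^esub> f y"
    and "f \<one>\<^bsub>A\<^esub> = \<one>\<^bsub>B\<^esub>"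
  shows "f \<in> algebra_hom K A B"
  using assms by (auto simp: algebra_hom_def ring_hom_def linear_hom_def)

lemma algebra_homD:
  assumes "f \<in> algebra_hom K A B"
  shows "f \<in> linear_hom K A B"
    and "f \<in> ring_hom A B"
    and "x \<in> carrier A \<Longrightarrow> f x \<in> carrier B"
    and "\<lbrakk>x \<in> carrier A; y \<in> carrier A\<rbrakk> \<Longrightarrow> f (x \<oplus>\<^bsub>A\<^esub> y) = f x \<oplus>\<^bsub>B\<^esub> f y"
    and "\<lbrakk>c \<in> carrier K; x \<in> carrier A\<rbrakk> \<Longrightarrow> f (c \<odot>\<^bsub>A\<^esub> x) = c \<odot>\<^bsub>B\<^esub> f x"
    and "\<lbrakk>x \<in> carrier A; y \<in> carrier A\<rbrakk> \<Longrightarrow> f (x \<otimes>\<^bsub>A\<^esub> y) = f x \<otimes>\<^bsub>B\<^esub> f y"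
    and "f \<one>\<^bsub>A\<^esub> = \<one>\<^bsub>B\<^esub>"
  using assms by (auto simp: algebra_hom_def ring_hom_def linear_hom_def)

lemma linear_hom_comp:
  assumes "f \<in> linear_hom K U V" and "g \<in> linear_hom K V W"
  shows "(\<lambda>x. g (f x)) \<in> linear_hom K U W"
  by (rule linear_homI) (simp_all add: linear_homD[OF assms(1)] linear_homD[OF assms(2)])

lemma algebra_hom_comp:
  assumes "f \<in> algebra_hom K A B" and "g \<in> algebra_hom K B C"
  shows "(\<lambda>x. g (f x)) \<in> algebra_hom K A C"
  by (rule algebra_homI)
    (simp_all add: algebra_homD[OF assms(1)] algebra_homD[OF assms(2)]
      linear_hom_comp[OF algebra_homD(1)[OF assms(1)] algebra_homD(1)[OF assms(2)]])

lemma algebra_hom_id: "(\<lambda>x. x) \<in> algebra_hom K A A"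
  by (intro algebra_homI linear_homI) auto

lemma linear_hom_zero:
  assumes "module K V" and "module K W" and "f \<in> linear_hom K V W"
  shows "f \<zero>\<^bsub>V\<^esub> = \<zero>\<^bsub>W\<^esub>"
proof -
  interpret V: module K V by fact
  interpret W: module K W by fact
  have "f (\<zero>\<^bsub>K\<^esub> \<odot>\<^bsub>V\<^esub> \<zero>\<^bsub>V\<^esub>) = \<zero>\<^bsub>K\<^esub> \<odot>\<^bsub>W\<^esub> f \<zero>\<^bsub>V\<^esub>"
    by (rule linear_homD[OF assms(3)]) auto
  then show ?thesis using linear_homD(1)[OF assms(3)] by auto
qed

lemma linear_hom_neg:
  assumes "module K V" and "module K W" and f: "f \<in> linear_hom K V W" and x: "x \<in> carrier V"
  shows "f (\<ominus>\<^bsub>V\<^esub> x) = \<ominus>\<^bsub>W\<^esub> f x"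
proof -
  interpret V: module K V by fact
  interpret W: module K W by fact
  have "f (\<ominus>\<^bsub>V\<^esub> x) \<oplus>\<^bsub>W\<^esub> f x = f (\<ominus>\<^bsub>V\<^esub> x \<oplus>\<^bsub>V\<^esub> x)"
    using linear_homD(2)[OF f] x by simp
  also have "\<dots> = \<zero>\<^bsub>W\<^esub>"
    using x linear_hom_zero[OF assms(1-3)] by (simp add: V.M.l_neg)
  finally show ?thesis
    using x linear_homD(1)[OF f] by (simp add: W.M.minus_equality)
qed

lemma linear_hom_minus:
  assumes V: "module K V" and W: "module K W" and f: "f \<in> linear_hom K V W"
    and x: "x \<in> carrier V" and y: "y \<in> carrier V"
  shows "f (x \<ominus>\<^bsub>V\<^esub> y) = f x \<ominus>\<^bsub>W\<^esub> f y"
proof -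
  interpret V: module K V by (rule V)
  show ?thesis
    by (simp add: a_minus_def linear_hom_neg[OF V W f] x y linear_homD(2)[OF f])
qed

lemma unital_algebra_module: "unital_algebra K A \<Longrightarrow> module K A"
  by (rule unital_algebra.axioms(3))

lemma algebra_hom_kernel_ideal:
  assumes "unital_algebra K A" and "unital_algebra K B" and "f \<in> algebra_hom K A B"
  shows "ideal {x \<in> carrier A. f x = \<zero>\<^bsub>B\<^esub>} A"
proof -
  interpret A: unital_algebra K A by fact
  interpret B: unital_algebra K B by fact
  interpret h: ring_hom_ring A B f
    by (rule ring_hom_ringI2[OF A.A.ring_axioms B.A.ring_axioms algebra_homD(2)[OF assms(3)]])
  show ?thesis using h.kernel_is_ideal unfolding a_kernel_def' .
qed

text \<open>The kernel is an ideal, so it contains \<open>Idl S\<close> as soon as it contains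
  \<open>S\<close>. Relations of the presented algebra, Hopf ideal conditions and maps between
  quotients are all checked on generators of ideals through this fact.\<close>

lemma algebra_hom_idl_zero:
  assumes "unital_algebra K A" and "unital_algebra K B" and "f \<in> algebra_hom K A B"
    and "S \<subseteq> carrier A" and "\<And>s. s \<in> S \<Longrightarrow> f s = \<zero>\<^bsub>B\<^esub>" and "x \<in> Idl\<^bsub>A\<^esub> S"
  shows "f x = \<zero>\<^bsub>B\<^esub>"
proof -
  interpret A: unital_algebra K A by fact
  have "Idl\<^bsub>A\<^esub> S \<subseteq> {x \<in> carrier A. f x = \<zero>\<^bsub>B\<^esub>}"
    using assms(4,5) by (intro A.A.genideal_minimal algebra_hom_kernel_ideal[OF assms(1-3)]) auto
  then show ?thesis using assms(6) by auto
qed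

text \<open>Because c x = (c 1) x, an ideal of the ring is automatically a subspace; this is what
  makes the quotient ring an algebra.\<close>

lemma ideal_smult_closed:
  assumes "unital_algebra K A" and "ideal I A" and "c \<in> carrier K" and "x \<in> I"
  shows "c \<odot>\<^bsub>A\<^esub> x \<in> I"
proof -
  interpret A: unital_algebra K A by fact
  interpret I: ideal I A by fact
  have "c \<odot>\<^bsub>A\<^esub> x = (c \<odot>\<^bsub>A\<^esub> \<one>\<^bsub>A\<^esub>) \<otimes>\<^bsub>A\<^esub> x"
    using assms by (simp add: A.smult_mult_left)
  then show ?thesis using assms by (simp add: I.I_l_closed)
qed

section \<open>Linear spans\<close>

lemma submodule_spanI: "s \<in> S \<Longrightarrow> s \<in> submodule_span K V S"
  by (auto simp: submodule_span_def)

lemma submodule_span_minimal: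
  "submodule N K V \<Longrightarrow> S \<subseteq> N \<Longrightarrow> submodule_span K V S \<subseteq> N"
  by (auto simp: submodule_span_def)

lemma submodule_span_submodule:
  assumes "module K V" and "S \<subseteq> carrier V"
  shows "submodule (submodule_span K V S) K V"
proof -
  interpret V: module K V by fact
  have ne: "submodule (carrier V) K V \<and> S \<subseteq> carrier V"
    using assms(2) V.carrier_is_submodule by auto
  have z: "\<zero>\<^bsub>V\<^esub> \<in> N" if N: "submodule N K V" for N
  proof -
    obtain x where "x \<in> N" using V.submoduleE(2)[OF N] by auto
    then have "\<zero>\<^bsub>K\<^esub> \<odot>\<^bsub>V\<^esub> x \<in> N" "x \<in> carrier V"
      using V.submoduleE(1,4)[OF N] by auto
    then show ?thesis by simp
  qed
  show ?thesis
    unfolding submodule_span_def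
  proof (rule V.submoduleI)
    show "\<Inter>{N. submodule N K V \<and> S \<subseteq> N} \<subseteq> carrier V" using ne by blast
    show "\<zero>\<^bsub>V\<^esub> \<in> \<Inter>{N. submodule N K V \<and> S \<subseteq> N}" using z by blast
  qed (simp_all add: V.submoduleE)
qed

lemma submodule_span_induct [consumes 3, case_names gen zero add smult]:
  assumes "module K V" and "S \<subseteq> carrier V" and "x \<in> submodule_span K V S"
    and "\<And>s. s \<in> S \<Longrightarrow> P s"
    and "P \<zero>\<^bsub>V\<^esub>"
    and "\<And>x y. \<lbrakk>x \<in> carrier V; y \<in> carrier V; P x; P y\<rbrakk> \<Longrightarrow> P (x \<oplus>\<^bsub>V\<^esub> y)"
    and "\<And>c x. \<lbrakk>c \<in> carrier K; x \<in> carrier V; P x\<rbrakk> \<Longrightarrow> P (c \<odot>\<^bsub>V\<^esub> x)"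
  shows "P x"
proof -
  interpret V: module K V by fact
  \<comment> \<open>Closure under negation is demanded by \<open>submoduleI\<close>; it is scaling
    by -1.\<close>
  have neg: "P (\<ominus>\<^bsub>V\<^esub> x)" if "x \<in> carrier V" "P x" for x
    using assms(7)[of "\<ominus>\<^bsub>K\<^esub> \<one>\<^bsub>K\<^esub>" x] that V.smult_l_minus[of "\<one>\<^bsub>K\<^esub>" x] by simp
  have "submodule {x \<in> carrier V. P x} K V"
    by (rule V.submoduleI) (use assms(4-7) neg in auto)
  then have "submodule_span K V S \<subseteq> {x \<in> carrier V. P x}"
    by (rule submodule_span_minimal) (use assms in auto)
  then show ?thesis using assms(3) by auto
qed

section \<open>The opposite algebra and the ground field as an algebra\<close>

lemma unital_algebra_opposite:
  assumes "unital_algebra K A"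
  shows "unital_algebra K (opposite_algebra A)"
proof -
  interpret A: unital_algebra K A by fact
  show ?thesis
    by (rule unital_algebraI)
      (simp_all add: opposite_algebra_def A.K.field_axioms A.A.a_ac A.A.m_assoc A.A.l_distr A.A.r_distr
        A.smult_l_distr A.smult_r_distr A.smult_assoc1 A.smult_mult_left A.smult_mult_right A.A.add.l_inv_ex)
qed

lemma base_algebra_simps [simp]:
  "carrier (base_algebra K) = carrier K" "mult (base_algebra K) = mult K"
  "one (base_algebra K) = one K" "zero (base_algebra K) = zero K"
  "add (base_algebra K) = add K" "smult (base_algebra K) = mult K"
  by (simp_all add: base_algebra_def ring.defs module.defs)

lemma opposite_algebra_simps [simp]:
  "carrier (opposite_algebra A) = carrier A" "mult (opposite_algebra A) x y = mult A y x"
  "one (opposite_algebra A) = one A" "zero (opposite_algebra A) = zero A"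
  "add (opposite_algebra A) = add A" "smult (opposite_algebra A) = smult A"
  by (simp_all add: opposite_algebra_def)

text \<open>Reversing both products keeps the equations. It allows an antihomomorphism, coded as a
  map into the opposite algebra, to be followed by an ordinary homomorphism; the antipode is carried
  to quotients in this way.\<close>

lemma algebra_hom_opposite:
  "f \<in> algebra_hom K A B \<Longrightarrow> f \<in> algebra_hom K (opposite_algebra A) (opposite_algebra B)"
  by (auto simp: algebra_hom_def ring_hom_def linear_hom_def)

lemma unital_algebra_base:
  assumes "field K"
  shows "unital_algebra K (base_algebra K)"
proof -
  interpret K: field K by fact
  show ?thesis
    by (rule unital_algebraI)
      (simp_all add: assms K.a_ac K.m_ac K.l_distr K.r_distr K.add.l_inv_ex)
qed

section \<open>Subalgebras generated by a set\<close>

text \<open>The inductive form supplies induction over expressions in the generators. Zero and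
  negatives arise from the scalar clause with the coefficients 0 and -1.\<close>

inductive_set generated_subalgebra ::
    "('k, 'n) ring_scheme \<Rightarrow> ('k, 'a, 'p) module_scheme \<Rightarrow> 'a set \<Rightarrow> 'a set"
  for K and A and S where
    gen: "s \<in> S \<Longrightarrow> s \<in> generated_subalgebra K A S"
  | one: "\<one>\<^bsub>A\<^esub> \<in> generated_subalgebra K A S"
  | add: "\<lbrakk>x \<in> generated_subalgebra K A S; y \<in> generated_subalgebra K A S\<rbrakk>
      \<Longrightarrow> x \<oplus>\<^bsub>A\<^esub> y \<in> generated_subalgebra K A S"
  | mult: "\<lbrakk>x \<in> generated_subalgebra K A S; y \<in> generated_subalgebra K A S\<rbrakk>
      \<Longrightarrow> x \<otimes>\<^bsub>A\<^esub> y \<in> generated_subalgebra K A S"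
  | smult: "\<lbrakk>c \<in> carrier K; x \<in> generated_subalgebra K A S\<rbrakk>
      \<Longrightarrow> c \<odot>\<^bsub>A\<^esub> x \<in> generated_subalgebra K A S"

lemma generated_subalgebra_closed:
  assumes "unital_algebra K A" and "S \<subseteq> carrier A" and "x \<in> generated_subalgebra K A S"
  shows "x \<in> carrier A"
proof -
  interpret A: unital_algebra K A by fact
  show ?thesis using assms(3) by induction (use assms(2) in auto)
qed

text \<open>The elements where two homomorphisms agree are closed under every clause of
  \<open>generated_subalgebra\<close>. This turns an identity between composites of structure maps
  into a check on generators.\<close>

lemma algebra_hom_eq_on_generators:
  assumes "unital_algebra K A" and "S \<subseteq> carrier A"
    and "carrier A \<subseteq> generated_subalgebra K A S"
    and f: "f \<in> algebra_hom K A B" and g: "g \<in> algebra_hom K A B"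
    and "\<And>s. s \<in> S \<Longrightarrow> f s = g s" and "x \<in> carrier A"
  shows "f x = g x"
proof -
  have "x \<in> generated_subalgebra K A S" using assms(3,7) by auto
  then show ?thesis
    by induction (use assms(6) algebra_homD[OF f] algebra_homD[OF g]
        generated_subalgebra_closed[OF assms(1,2)] in simp_all)
qed

text \<open>Transports generation from the free algebra to the presented algebra, and from a Hopf
  algebra to its quotient.\<close>

lemma generated_subalgebra_image:
  assumes "unital_algebra K A" and "S \<subseteq> carrier A" and f: "f \<in> algebra_hom K A B"
    and "x \<in> generated_subalgebra K A S"
  shows "f x \<in> generated_subalgebra K B (f ` S)"
  using assms(4)
  by induction (use algebra_homD[OF f] generated_subalgebra_closed[OF assms(1,2)]
      in \<open>auto intro: generated_subalgebra.intros\<close>)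

section \<open>Monoid algebras\<close>

text \<open>Serves two instances: words, giving the free algebra, and pairs of elements of two
  algebras, giving the free module under the tensor product together with its product.\<close>

locale monoid_over_field = K: field K + G: monoid G
  for K :: "('k, 'n) ring_scheme" (structure) and G :: "('g, 'p) monoid_scheme"
begin

abbreviation F where "F \<equiv> monoid_algebra K G"
abbreviation e where "e \<equiv> basis_elem K"

lemma monoid_algebra_carrier_iff:
  "f \<in> carrier F \<longleftrightarrow> (\<forall>x. f x \<in> carrier K) \<and> finite (supp K f) \<and> supp K f \<subseteq> carrier G"
  by (auto simp: monoid_algebra_def)

lemma monoid_algebra_carrierD:
  assumes "f \<in> carrier F"
  shows "f x \<in> carrier K" and "finite (supp K f)" and "supp K f \<subseteq> carrier G"
  using assms by (auto simp: monoid_algebra_carrier_iff)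

lemma monoid_algebra_ops:
  "\<zero>\<^bsub>F\<^esub> = (\<lambda>x. \<zero>)" "\<one>\<^bsub>F\<^esub> = e \<one>\<^bsub>G\<^esub>"
  "f \<oplus>\<^bsub>F\<^esub> g = (\<lambda>x. f x \<oplus> g x)" "c \<odot>\<^bsub>F\<^esub> f = (\<lambda>x. c \<otimes> f x)"
  by (simp_all add: monoid_algebra_def)

lemma basis_elem_closed: "g \<in> carrier G \<Longrightarrow> e g \<in> carrier F"
  by (auto simp: monoid_algebra_carrier_iff basis_elem_def supp_def)

lemma monoid_algebra_carrierI:
  assumes "\<And>x. f x \<in> carrier K" and "finite S" and "S \<subseteq> carrier G"
    and "\<And>x. x \<notin> S \<Longrightarrow> f x = \<zero>"
  shows "f \<in> carrier F"
proof -
  have "supp K f \<subseteq> S" using assms(4) by (auto simp: supp_def)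
  then show ?thesis
    using assms(1-3) by (auto simp: monoid_algebra_carrier_iff intro: finite_subset)
qed

lemma supp_eq_zero: "x \<notin> supp K f \<Longrightarrow> f x = \<zero>"
  by (simp add: supp_def)

lemma monoid_algebra_zero_closed: "\<zero>\<^bsub>F\<^esub> \<in> carrier F"
  by (rule monoid_algebra_carrierI[of _ "{}"]) (simp_all add: monoid_algebra_ops)

lemma monoid_algebra_add_closed:
  assumes f: "f \<in> carrier F" and g: "g \<in> carrier F"
  shows "f \<oplus>\<^bsub>F\<^esub> g \<in> carrier F"
  by (rule monoid_algebra_carrierI[of _ "supp K f \<union> supp K g"])
    (simp_all add: monoid_algebra_ops supp_eq_zero monoid_algebra_carrierD[OF f] monoid_algebra_carrierD[OF g])

lemma monoid_algebra_smult_closed: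
  assumes c: "c \<in> carrier K" and f: "f \<in> carrier F"
  shows "c \<odot>\<^bsub>F\<^esub> f \<in> carrier F"
  by (rule monoid_algebra_carrierI[of _ "supp K f"])
    (simp_all add: monoid_algebra_ops supp_eq_zero monoid_algebra_carrierD[OF f] c)

lemmas monoid_algebra_closed =
  monoid_algebra_zero_closed monoid_algebra_add_closed monoid_algebra_smult_closed

text \<open>Terms outside the supports vanish, so the convolution may run over any finite sets
  containing them. This is needed because the support of a sum or a multiple can be smaller than
  expected: different products can now be expanded over a common index set.\<close>

lemma monoid_algebra_mult_eq:
  assumes f: "f \<in> carrier F" and g: "g \<in> carrier F"
    and "finite S" and "finite T" and "supp K f \<subseteq> S" and "supp K g \<subseteq> T"
  shows "(f \<otimes>\<^bsub>F\<^esub> g) z =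
    (\<Oplus>p \<in> {(x, y). x \<in> S \<and> y \<in> T \<and> x \<otimes>\<^bsub>G\<^esub> y = z}. f (fst p) \<otimes> g (snd p))"
proof -
  note [simp] = monoid_algebra_carrierD[OF f] monoid_algebra_carrierD[OF g]
  let ?A = "{(x, y). x \<in> supp K f \<and> y \<in> supp K g \<and> x \<otimes>\<^bsub>G\<^esub> y = z}"
  let ?B = "{(x, y). x \<in> S \<and> y \<in> T \<and> x \<otimes>\<^bsub>G\<^esub> y = z}"
  have fin: "finite ?B"
    by (rule finite_subset[of _ "S \<times> T"]) (use assms in auto)
  have "(\<Oplus>p \<in> ?A. f (fst p) \<otimes> g (snd p)) = (\<Oplus>p \<in> ?B. f (fst p) \<otimes> g (snd p))"
  proof (rule K.add.finprod_mono_neutral_cong_left[OF fin])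
    show "?A \<subseteq> ?B" using assms(5,6) by auto
    show "f (fst p) \<otimes> g (snd p) = \<zero>" if "p \<in> ?B - ?A" for p
    proof -
      have "f (fst p) = \<zero> \<or> g (snd p) = \<zero>" using that by (auto simp: supp_def)
      then show ?thesis by auto
    qed
  qed auto
  then show ?thesis by (simp add: monoid_algebra_def)
qed

lemma monoid_algebra_mult_closed:
  assumes f: "f \<in> carrier F" and g: "g \<in> carrier F"
  shows "f \<otimes>\<^bsub>F\<^esub> g \<in> carrier F"
proof (rule monoid_algebra_carrierI)
  note [simp] = monoid_algebra_carrierD(1,2)[OF f] monoid_algebra_carrierD(1,2)[OF g]
  let ?S = "(\<lambda>(x, y). x \<otimes>\<^bsub>G\<^esub> y) ` (supp K f \<times> supp K g)"
  show "(f \<otimes>\<^bsub>F\<^esub> g) z \<in> carrier K" for z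
    by (simp add: monoid_algebra_mult_eq[OF f g _ _ subset_refl subset_refl] K.finsum_closed)
  show "finite ?S" by simp
  show "?S \<subseteq> carrier G"
    using monoid_algebra_carrierD(3)[OF f] monoid_algebra_carrierD(3)[OF g]
    by (auto intro!: G.m_closed)
  show "(f \<otimes>\<^bsub>F\<^esub> g) z = \<zero>" if "z \<notin> ?S" for z
  proof -
    have "{(x, y). x \<in> supp K f \<and> y \<in> supp K g \<and> x \<otimes>\<^bsub>G\<^esub> y = z} = {}"
      using that by auto
    then have "(\<Oplus>p \<in> {(x, y). x \<in> supp K f \<and> y \<in> supp K g \<and> x \<otimes>\<^bsub>G\<^esub> y = z}.
        f (fst p) \<otimes> g (snd p)) = \<zero>"
      by (simp only: K.finsum_empty)
    then show ?thesis
      by (simp only: monoid_algebra_mult_eq[OF f g monoid_algebra_carrierD(2)[OF f]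
            monoid_algebra_carrierD(2)[OF g] subset_refl subset_refl])
  qed
qed

lemma supp_add_subset: "supp K (f \<oplus>\<^bsub>F\<^esub> g) \<subseteq> supp K f \<union> supp K g"
  by (auto simp: supp_def monoid_algebra_ops)

lemma supp_smult_subset: "c \<in> carrier K \<Longrightarrow> supp K (c \<odot>\<^bsub>F\<^esub> f) \<subseteq> supp K f"
  by (auto simp: supp_def monoid_algebra_ops)

lemma monoid_algebra_distr:
  assumes f: "f \<in> carrier F" and g: "g \<in> carrier F" and h: "h \<in> carrier F"
  shows "(f \<oplus>\<^bsub>F\<^esub> g) \<otimes>\<^bsub>F\<^esub> h = f \<otimes>\<^bsub>F\<^esub> h \<oplus>\<^bsub>F\<^esub> g \<otimes>\<^bsub>F\<^esub> h"
    and "h \<otimes>\<^bsub>F\<^esub> (f \<oplus>\<^bsub>F\<^esub> g) = h \<otimes>\<^bsub>F\<^esub> f \<oplus>\<^bsub>F\<^esub> h \<otimes>\<^bsub>F\<^esub> g"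
proof -
  note [simp] = monoid_algebra_carrierD[OF f] monoid_algebra_carrierD[OF g] monoid_algebra_carrierD[OF h]
  have fg: "f \<oplus>\<^bsub>F\<^esub> g \<in> carrier F" using f g by (rule monoid_algebra_add_closed)
  let ?S = "supp K f \<union> supp K g" and ?T = "supp K h"
  have Sf: "supp K f \<subseteq> ?S" and Sg: "supp K g \<subseteq> ?S" and fin: "finite ?S" "finite ?T" by auto
  show "(f \<oplus>\<^bsub>F\<^esub> g) \<otimes>\<^bsub>F\<^esub> h = f \<otimes>\<^bsub>F\<^esub> h \<oplus>\<^bsub>F\<^esub> g \<otimes>\<^bsub>F\<^esub> h"
  proof
    fix z
    have "((f \<oplus>\<^bsub>F\<^esub> g) \<otimes>\<^bsub>F\<^esub> h) z = (\<Oplus>p \<in> {(x, y). x \<in> ?S \<and> y \<in> ?T \<and> x \<otimes>\<^bsub>G\<^esub> y = z}.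
        f (fst p) \<otimes> h (snd p) \<oplus> g (fst p) \<otimes> h (snd p))"
      unfolding monoid_algebra_mult_eq[OF fg h fin supp_add_subset subset_refl]
      by (rule K.finsum_cong') (auto simp: monoid_algebra_ops K.l_distr)
    also have "\<dots> = (f \<otimes>\<^bsub>F\<^esub> h) z \<oplus> (g \<otimes>\<^bsub>F\<^esub> h) z"
      unfolding monoid_algebra_mult_eq[OF f h fin Sf subset_refl] monoid_algebra_mult_eq[OF g h fin Sg subset_refl]
      by (rule K.finsum_addf) auto
    finally show "((f \<oplus>\<^bsub>F\<^esub> g) \<otimes>\<^bsub>F\<^esub> h) z = (f \<otimes>\<^bsub>F\<^esub> h \<oplus>\<^bsub>F\<^esub> g \<otimes>\<^bsub>F\<^esub> h) z"
      by (simp add: monoid_algebra_ops)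
  qed
  show "h \<otimes>\<^bsub>F\<^esub> (f \<oplus>\<^bsub>F\<^esub> g) = h \<otimes>\<^bsub>F\<^esub> f \<oplus>\<^bsub>F\<^esub> h \<otimes>\<^bsub>F\<^esub> g"
  proof
    fix z
    have "(h \<otimes>\<^bsub>F\<^esub> (f \<oplus>\<^bsub>F\<^esub> g)) z = (\<Oplus>p \<in> {(x, y). x \<in> ?T \<and> y \<in> ?S \<and> x \<otimes>\<^bsub>G\<^esub> y = z}.
        h (fst p) \<otimes> f (snd p) \<oplus> h (fst p) \<otimes> g (snd p))"
      unfolding monoid_algebra_mult_eq[OF h fg fin(2,1) subset_refl supp_add_subset]
      by (rule K.finsum_cong') (auto simp: monoid_algebra_ops K.r_distr)
    also have "\<dots> = (h \<otimes>\<^bsub>F\<^esub> f) z \<oplus> (h \<otimes>\<^bsub>F\<^esub> g) z"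
      unfolding monoid_algebra_mult_eq[OF h f fin(2,1) subset_refl Sf] monoid_algebra_mult_eq[OF h g fin(2,1) subset_refl Sg]
      by (rule K.finsum_addf) auto
    finally show "(h \<otimes>\<^bsub>F\<^esub> (f \<oplus>\<^bsub>F\<^esub> g)) z = (h \<otimes>\<^bsub>F\<^esub> f \<oplus>\<^bsub>F\<^esub> h \<otimes>\<^bsub>F\<^esub> g) z"
      by (simp add: monoid_algebra_ops)
  qed
qed

lemma monoid_algebra_smult_mult:
  assumes f: "f \<in> carrier F" and g: "g \<in> carrier F" and c: "c \<in> carrier K"
  shows "(c \<odot>\<^bsub>F\<^esub> f) \<otimes>\<^bsub>F\<^esub> g = c \<odot>\<^bsub>F\<^esub> (f \<otimes>\<^bsub>F\<^esub> g)"
    and "f \<otimes>\<^bsub>F\<^esub> (c \<odot>\<^bsub>F\<^esub> g) = c \<odot>\<^bsub>F\<^esub> (f \<otimes>\<^bsub>F\<^esub> g)"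
proof -
  note [simp] = monoid_algebra_carrierD[OF f] monoid_algebra_carrierD[OF g] c
  have cf: "c \<odot>\<^bsub>F\<^esub> f \<in> carrier F" and cg: "c \<odot>\<^bsub>F\<^esub> g \<in> carrier F"
    using f g by (simp_all add: monoid_algebra_closed)
  have fin: "finite (supp K f)" "finite (supp K g)" by auto
  have *: "finite {(x, y). x \<in> supp K f \<and> y \<in> supp K g \<and> x \<otimes>\<^bsub>G\<^esub> y = z}" for z
    by (rule finite_subset[of _ "supp K f \<times> supp K g"]) auto
  have c_mult: "(c \<odot>\<^bsub>F\<^esub> (f \<otimes>\<^bsub>F\<^esub> g)) z =
      (\<Oplus>p \<in> {(x, y). x \<in> supp K f \<and> y \<in> supp K g \<and> x \<otimes>\<^bsub>G\<^esub> y = z}. c \<otimes> (f (fst p) \<otimes> g (snd p)))" for z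
    unfolding monoid_algebra_ops monoid_algebra_mult_eq[OF f g fin subset_refl subset_refl]
    by (rule K.finsum_rdistr[OF *]) auto
  show "(c \<odot>\<^bsub>F\<^esub> f) \<otimes>\<^bsub>F\<^esub> g = c \<odot>\<^bsub>F\<^esub> (f \<otimes>\<^bsub>F\<^esub> g)"
  proof
    fix z
    show "((c \<odot>\<^bsub>F\<^esub> f) \<otimes>\<^bsub>F\<^esub> g) z = (c \<odot>\<^bsub>F\<^esub> (f \<otimes>\<^bsub>F\<^esub> g)) z"
      unfolding c_mult monoid_algebra_mult_eq[OF cf g fin supp_smult_subset[OF c] subset_refl]
      by (rule K.finsum_cong') (auto simp: monoid_algebra_ops K.m_assoc)
  qed
  show "f \<otimes>\<^bsub>F\<^esub> (c \<odot>\<^bsub>F\<^esub> g) = c \<odot>\<^bsub>F\<^esub> (f \<otimes>\<^bsub>F\<^esub> g)"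
  proof
    fix z
    show "(f \<otimes>\<^bsub>F\<^esub> (c \<odot>\<^bsub>F\<^esub> g)) z = (c \<odot>\<^bsub>F\<^esub> (f \<otimes>\<^bsub>F\<^esub> g)) z"
      unfolding c_mult monoid_algebra_mult_eq[OF f cg fin subset_refl supp_smult_subset[OF c]]
      by (rule K.finsum_cong') (auto simp: monoid_algebra_ops K.m_lcomm)
  qed
qed

lemma basis_elem_mult:
  assumes "x \<in> carrier G" and "y \<in> carrier G"
  shows "e x \<otimes>\<^bsub>F\<^esub> e y = e (x \<otimes>\<^bsub>G\<^esub> y)"
proof
  fix z
  have "(e x \<otimes>\<^bsub>F\<^esub> e y) z =
      (\<Oplus>p \<in> {(x', y'). x' \<in> {x} \<and> y' \<in> {y} \<and> x' \<otimes>\<^bsub>G\<^esub> y' = z}. e x (fst p) \<otimes> e y (snd p))"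
    by (rule monoid_algebra_mult_eq) 
      (use assms in \<open>simp_all add: basis_elem_closed\<close>, auto simp: basis_elem_def supp_def)
  also have "{(x', y'). x' \<in> {x} \<and> y' \<in> {y} \<and> x' \<otimes>\<^bsub>G\<^esub> y' = z} = (if x \<otimes>\<^bsub>G\<^esub> y = z then {(x, y)} else {})"
    by auto
  finally show "(e x \<otimes>\<^bsub>F\<^esub> e y) z = e (x \<otimes>\<^bsub>G\<^esub> y) z"
    by (auto simp: basis_elem_def K.finsum_insert)
qed

text \<open>Every element is a finite combination of basis elements; the induction is on a finite
  set containing the support. Identities that are linear in each argument thereby reduce to the
  monoid.\<close>

lemma monoid_algebra_induct [consumes 1, case_names basis add smult]:
  assumes "f \<in> carrier F"
    and basis: "\<And>g. g \<in> carrier G \<Longrightarrow> P (e g)"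
    and add: "\<And>f g. \<lbrakk>f \<in> carrier F; g \<in> carrier F; P f; P g\<rbrakk> \<Longrightarrow> P (f \<oplus>\<^bsub>F\<^esub> g)"
    and smult: "\<And>c f. \<lbrakk>c \<in> carrier K; f \<in> carrier F; P f\<rbrakk> \<Longrightarrow> P (c \<odot>\<^bsub>F\<^esub> f)"
  shows "P f"
proof -
  have "finite S \<Longrightarrow> supp K f \<subseteq> S \<Longrightarrow> f \<in> carrier F \<Longrightarrow> P f" for S f
  proof (induction S arbitrary: f rule: finite_induct)
    case empty
    \<comment> \<open>The zero function is 0 times a basis element, so the rule gets by without a
      case for zero.\<close>
    have "P (\<zero> \<odot>\<^bsub>F\<^esub> e \<one>\<^bsub>G\<^esub>)"
      by (intro smult basis basis_elem_closed) auto
    also have "\<zero> \<odot>\<^bsub>F\<^esub> e \<one>\<^bsub>G\<^esub> = f"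
      using empty by (auto simp: monoid_algebra_ops basis_elem_def supp_def)
    finally show ?case .
  next
    case (insert x S)
    note f = monoid_algebra_carrierD[OF insert.prems(2)]
    \<comment> \<open>The coefficient at \<open>x\<close> is split off. The finite set may contain
      points outside the monoid, where the coefficient is zero already.\<close>
    let ?g = "f(x := \<zero>)"
    have sg: "supp K ?g \<subseteq> S" using insert.prems by (auto simp: supp_def)
    have g: "?g \<in> carrier F"
      by (rule monoid_algebra_carrierI[of _ "supp K f"]) (use f in \<open>auto simp: supp_def\<close>)
    have Pg: "P ?g" by (rule insert.IH[OF sg g])
    show ?case
    proof (cases "x \<in> carrier G")
      case True
      have "P (f x \<odot>\<^bsub>F\<^esub> e x \<oplus>\<^bsub>F\<^esub> ?g)"
        by (intro add smult basis monoid_algebra_closed basis_elem_closed) (use True f g Pg in auto)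
      also have "f x \<odot>\<^bsub>F\<^esub> e x \<oplus>\<^bsub>F\<^esub> ?g = f"
        using f by (auto simp: monoid_algebra_ops basis_elem_def)
      finally show ?thesis .
    next
      case False
      then have "f x = \<zero>" using f(3) by (auto simp: supp_def)
      then have "?g = f" by auto
      then show ?thesis using Pg by simp
    qed
  qed
  then show ?thesis using assms(1) monoid_algebra_carrierD(2)[OF assms(1)] by blast
qed

text \<open>Trilinearity reduces all three arguments to basis elements, where the claim is
  associativity of \<open>G\<close>; no triple convolution sum has to be reindexed.\<close>

lemma monoid_algebra_assoc:
  assumes f: "f \<in> carrier F" and g: "g \<in> carrier F" and h: "h \<in> carrier F"
  shows "(f \<otimes>\<^bsub>F\<^esub> g) \<otimes>\<^bsub>F\<^esub> h = f \<otimes>\<^bsub>F\<^esub> (g \<otimes>\<^bsub>F\<^esub> h)"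
  using f
proof (induction f rule: monoid_algebra_induct)
  case (basis x)
  show ?case using g
  proof (induction g rule: monoid_algebra_induct)
    case (basis y)
    show ?case using h
    proof (induction h rule: monoid_algebra_induct)
      case (basis z)
      then show ?case
        using \<open>x \<in> carrier G\<close> \<open>y \<in> carrier G\<close> by (simp add: basis_elem_mult G.m_assoc)
    qed (use \<open>x \<in> carrier G\<close> \<open>y \<in> carrier G\<close> in \<open>simp_all add: basis_elem_closed
      monoid_algebra_mult_closed monoid_algebra_distr monoid_algebra_smult_mult\<close>)
  qed (use \<open>x \<in> carrier G\<close> h in \<open>simp_all add: basis_elem_closed
      monoid_algebra_mult_closed monoid_algebra_distr monoid_algebra_smult_mult\<close>)
qed (use g h in \<open>simp_all add:
      monoid_algebra_mult_closed monoid_algebra_distr monoid_algebra_smult_mult\<close>)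

lemma monoid_algebra_one:
  assumes "f \<in> carrier F"
  shows "\<one>\<^bsub>F\<^esub> \<otimes>\<^bsub>F\<^esub> f = f" and "f \<otimes>\<^bsub>F\<^esub> \<one>\<^bsub>F\<^esub> = f"
proof -
  have one: "e \<one>\<^bsub>G\<^esub> \<in> carrier F" by (rule basis_elem_closed) simp
  show "\<one>\<^bsub>F\<^esub> \<otimes>\<^bsub>F\<^esub> f = f" unfolding monoid_algebra_ops using assms
    by (induction f rule: monoid_algebra_induct)
      (simp_all add: basis_elem_mult one monoid_algebra_distr monoid_algebra_smult_mult)
  show "f \<otimes>\<^bsub>F\<^esub> \<one>\<^bsub>F\<^esub> = f" unfolding monoid_algebra_ops using assms
    by (induction f rule: monoid_algebra_induct)
      (simp_all add: basis_elem_mult one monoid_algebra_distr monoid_algebra_smult_mult)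
qed

lemma unital_algebra_monoid_algebra: "unital_algebra K F"
proof (rule unital_algebraI)
  show "\<exists>g \<in> carrier F. g \<oplus>\<^bsub>F\<^esub> f = \<zero>\<^bsub>F\<^esub>" if f: "f \<in> carrier F" for f
  proof
    show "(\<ominus> \<one>) \<odot>\<^bsub>F\<^esub> f \<in> carrier F" using f by (simp add: monoid_algebra_closed)
    show "(\<ominus> \<one>) \<odot>\<^bsub>F\<^esub> f \<oplus>\<^bsub>F\<^esub> f = \<zero>\<^bsub>F\<^esub>"
      using monoid_algebra_carrierD[OF f] by (auto simp: monoid_algebra_ops K.l_minus K.l_neg)
  qed
  show "\<one>\<^bsub>F\<^esub> \<in> carrier F" by (simp add: monoid_algebra_ops basis_elem_closed)
qed (simp_all add: K.field_axioms monoid_algebra_closed monoid_algebra_mult_closed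
    monoid_algebra_distr monoid_algebra_smult_mult monoid_algebra_assoc monoid_algebra_one,
    auto simp: monoid_algebra_ops fun_eq_iff monoid_algebra_carrierD K.a_ac K.m_ac K.l_distr K.r_distr)

lemma monoid_algebra_module: "module K F"
  by (rule unital_algebra_module[OF unital_algebra_monoid_algebra])

section \<open>Extending maps from basis elements\<close>

text \<open>Extra summands have coefficient zero. \<open>S\<close> stays inside the monoid so that
  \<open>h\<close> has values in \<open>V\<close> on all of it.\<close>

lemma linear_extension_eq:
  assumes V: "module K V" and h: "h \<in> carrier G \<rightarrow> carrier V"
    and f: "f \<in> carrier F" and "finite S" and "supp K f \<subseteq> S" and "S \<subseteq> carrier G"
  shows "linear_extension K V h f = (\<Oplus>\<^bsub>V\<^esub>x \<in> S. f x \<odot>\<^bsub>V\<^esub> h x)"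
proof -
  interpret V: module K V by fact
  show ?thesis
    unfolding linear_extension_def
  proof (rule V.M.add.finprod_mono_neutral_cong_left)
    show "f x \<odot>\<^bsub>V\<^esub> h x = \<zero>\<^bsub>V\<^esub>" if "x \<in> S - supp K f" for x
      using that subsetD[OF assms(6)] funcset_mem[OF h] by (auto simp: supp_def)
  qed (use assms(4-6) monoid_algebra_carrierD(1)[OF f] funcset_mem[OF h] in auto)
qed

lemma linear_extension_linear:
  assumes V: "module K V" and h: "h \<in> carrier G \<rightarrow> carrier V"
  shows "linear_extension K V h \<in> linear_hom K F V"
proof (rule linear_homI)
  interpret V: module K V by fact
  let ?L = "linear_extension K V h"
  have cl: "(\<lambda>x. f x \<odot>\<^bsub>V\<^esub> h x) \<in> S \<rightarrow> carrier V" if "f \<in> carrier F" "S \<subseteq> carrier G" for f S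
    using that(2) monoid_algebra_carrierD(1)[OF that(1)] funcset_mem[OF h] by auto
  show "?L f \<in> carrier V" if f: "f \<in> carrier F" for f
    unfolding linear_extension_def
    using cl[OF f monoid_algebra_carrierD(3)[OF f]] by (rule V.M.finsum_closed)
  show "?L (f \<oplus>\<^bsub>F\<^esub> g) = ?L f \<oplus>\<^bsub>V\<^esub> ?L g" if f: "f \<in> carrier F" and g: "g \<in> carrier F" for f g
  proof -
    let ?S = "supp K f \<union> supp K g"
    have fg: "f \<oplus>\<^bsub>F\<^esub> g \<in> carrier F" using f g by (rule monoid_algebra_add_closed)
    have S: "finite ?S" "?S \<subseteq> carrier G"
      using monoid_algebra_carrierD[OF f] monoid_algebra_carrierD[OF g] by auto
    have Sf: "supp K f \<subseteq> ?S" and Sg: "supp K g \<subseteq> ?S" by auto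
    have "?L (f \<oplus>\<^bsub>F\<^esub> g) = (\<Oplus>\<^bsub>V\<^esub>x \<in> ?S. f x \<odot>\<^bsub>V\<^esub> h x \<oplus>\<^bsub>V\<^esub> g x \<odot>\<^bsub>V\<^esub> h x)"
      unfolding linear_extension_eq[where S = ?S, OF V h fg S(1) supp_add_subset S(2)]
    proof (rule V.M.finsum_cong')
      show "(f \<oplus>\<^bsub>F\<^esub> g) x \<odot>\<^bsub>V\<^esub> h x = f x \<odot>\<^bsub>V\<^esub> h x \<oplus>\<^bsub>V\<^esub> g x \<odot>\<^bsub>V\<^esub> h x" if "x \<in> ?S" for x
        using funcset_mem[OF h subsetD[OF S(2) that]]
        by (simp add: monoid_algebra_ops V.smult_l_distr monoid_algebra_carrierD(1)[OF f]
            monoid_algebra_carrierD(1)[OF g])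
    qed (use cl[OF f S(2)] cl[OF g S(2)] in auto)
    also have "\<dots> = ?L f \<oplus>\<^bsub>V\<^esub> ?L g"
      unfolding linear_extension_eq[where S = ?S, OF V h f S(1) Sf S(2)]
        linear_extension_eq[where S = ?S, OF V h g S(1) Sg S(2)]
      by (rule V.M.finsum_addf) (use cl[OF f S(2)] cl[OF g S(2)] in auto)
    finally show ?thesis .
  qed
  show "?L (c \<odot>\<^bsub>F\<^esub> f) = c \<odot>\<^bsub>V\<^esub> ?L f" if c: "c \<in> carrier K" and f: "f \<in> carrier F" for c f
  proof -
    have cf: "c \<odot>\<^bsub>F\<^esub> f \<in> carrier F" using c f by (simp add: monoid_algebra_closed)
    note S = monoid_algebra_carrierD(2,3)[OF f]
    have "?L (c \<odot>\<^bsub>F\<^esub> f) = (\<Oplus>\<^bsub>V\<^esub>x \<in> supp K f. c \<odot>\<^bsub>V\<^esub> (f x \<odot>\<^bsub>V\<^esub> h x))"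
      unfolding linear_extension_eq[where S = "supp K f", OF V h cf S(1) supp_smult_subset[OF c] S(2)]
    proof (rule V.M.finsum_cong')
      show "(c \<odot>\<^bsub>F\<^esub> f) x \<odot>\<^bsub>V\<^esub> h x = c \<odot>\<^bsub>V\<^esub> (f x \<odot>\<^bsub>V\<^esub> h x)" if "x \<in> supp K f" for x
        using funcset_mem[OF h subsetD[OF S(2) that]]
        by (simp add: monoid_algebra_ops V.smult_assoc1 monoid_algebra_carrierD(1)[OF f] c)
    qed (use c cl[OF f S(2)] in auto)
    also have "\<dots> = c \<odot>\<^bsub>V\<^esub> ?L f"
      unfolding linear_extension_def
      by (rule V.finsum_smult_ldistr[symmetric]) (use c S cl[OF f S(2)] in auto)
    finally show ?thesis .
  qed
qed

lemma linear_extension_basis: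
  assumes V: "module K V" and h: "h \<in> carrier G \<rightarrow> carrier V" and g: "g \<in> carrier G"
  shows "linear_extension K V h (e g) = h g"
proof -
  interpret V: module K V by fact
  have "linear_extension K V h (e g) = (\<Oplus>\<^bsub>V\<^esub>x \<in> {g}. e g x \<odot>\<^bsub>V\<^esub> h x)"
    by (rule linear_extension_eq[OF V h basis_elem_closed[OF g]])
      (use g in \<open>auto simp: supp_def basis_elem_def\<close>)
  then show ?thesis using g h by (simp add: basis_elem_def V.M.finsum_insert Pi_def)
qed

text \<open>Both sides of the product law are linear in each factor, so the monoid law for
  \<open>h\<close> on basis elements is enough.\<close>

lemma linear_extension_algebra_hom:
  assumes A: "unital_algebra K A" and h: "h \<in> carrier G \<rightarrow> carrier A"
    and mult: "\<And>x y. \<lbrakk>x \<in> carrier G; y \<in> carrier G\<rbrakk> \<Longrightarrow> h (x \<otimes>\<^bsub>G\<^esub> y) = h x \<otimes>\<^bsub>A\<^esub> h y"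
    and one: "h \<one>\<^bsub>G\<^esub> = \<one>\<^bsub>A\<^esub>"
  shows "linear_extension K A h \<in> algebra_hom K F A"
proof (rule algebra_homI)
  interpret A: unital_algebra K A by fact
  note V = unital_algebra_module[OF A]
  let ?L = "linear_extension K A h"
  show L: "?L \<in> linear_hom K F A" by (rule linear_extension_linear[OF V h])
    show "?L \<one>\<^bsub>F\<^esub> = \<one>\<^bsub>A\<^esub>" by (simp add: monoid_algebra_ops linear_extension_basis[OF V h] one)
  show "?L (f \<otimes>\<^bsub>F\<^esub> g) = ?L f \<otimes>\<^bsub>A\<^esub> ?L g" if f: "f \<in> carrier F" and g: "g \<in> carrier F" for f g
    using f
  proof (induction f rule: monoid_algebra_induct)
    case (basis x)
    show ?case using g
    proof (induction g rule: monoid_algebra_induct)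
      case (basis y)
      then show ?case
        using \<open>x \<in> carrier G\<close> by (simp add: basis_elem_mult linear_extension_basis[OF V h] mult)
    qed (use \<open>x \<in> carrier G\<close> in \<open>simp_all add: basis_elem_closed monoid_algebra_mult_closed
        monoid_algebra_distr monoid_algebra_smult_mult linear_homD[OF L] A.A.r_distr A.smult_mult_right\<close>)
  qed (use g in \<open>simp_all add: monoid_algebra_closed monoid_algebra_mult_closed
      monoid_algebra_distr monoid_algebra_smult_mult linear_homD[OF L] A.A.l_distr A.smult_mult_left\<close>)
qed

text \<open>Multiplication by an arbitrary element is a combination of multiplications by basis
  elements, and the span absorbs combinations. The tensor kernel is only defined as a subspace; this
  criterion makes the product on its quotient meaningful.\<close>

lemma submodule_span_ideal:
  assumes S: "S \<subseteq> carrier F"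
    and "\<And>s g. \<lbrakk>s \<in> S; g \<in> carrier G\<rbrakk> \<Longrightarrow> e g \<otimes>\<^bsub>F\<^esub> s \<in> submodule_span K F S"
    and "\<And>s g. \<lbrakk>s \<in> S; g \<in> carrier G\<rbrakk> \<Longrightarrow> s \<otimes>\<^bsub>F\<^esub> e g \<in> submodule_span K F S"
  shows "ideal (submodule_span K F S) F"
proof (rule idealI)
  interpret F: unital_algebra K F by (rule unital_algebra_monoid_algebra)
  let ?N = "submodule_span K F S"
  have N: "submodule ?N K F" by (rule submodule_span_submodule[OF monoid_algebra_module S])
  note NE = F.submoduleE[OF N]
  have N_carrier: "x \<in> carrier F" if "x \<in> ?N" for x using that NE(1) by auto
  have N0: "\<zero>\<^bsub>F\<^esub> \<in> ?N"
    using subgroup.one_closed[OF submodule.axioms(1)[OF N]] by simp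
  show "ring F" by (rule F.A.ring_axioms)
  show "subgroup ?N (add_monoid F)" by (rule submodule.axioms(1)[OF N])
  show "f \<otimes>\<^bsub>F\<^esub> x \<in> ?N" if x: "x \<in> ?N" and f: "f \<in> carrier F" for x f
    using monoid_algebra_module S x
  proof (induction x rule: submodule_span_induct)
    case (gen s)
    show ?case using f
      by (induction f rule: monoid_algebra_induct)
        (use gen S in \<open>auto simp: assms(2) monoid_algebra_distr monoid_algebra_smult_mult NE(4,5)\<close>)
  next
    case zero then show ?case using f N0 by simp
  next
    case (add x y) then show ?case using f by (simp add: monoid_algebra_distr NE)
  next
    case (smult c x) then show ?case using f by (simp add: monoid_algebra_smult_mult NE)
  qed
  show "x \<otimes>\<^bsub>F\<^esub> f \<in> ?N" if x: "x \<in> ?N" and f: "f \<in> carrier F" for x f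
    using monoid_algebra_module S x
  proof (induction x rule: submodule_span_induct)
    case (gen s)
    show ?case using f
      by (induction f rule: monoid_algebra_induct)
        (use gen S in \<open>auto simp: assms(3) monoid_algebra_distr monoid_algebra_smult_mult NE(4,5)\<close>)
  next
    case zero then show ?case using f N0 by simp
  next
    case (add x y) then show ?case using f by (simp add: monoid_algebra_distr NE)
  next
    case (smult c x) then show ?case using f by (simp add: monoid_algebra_smult_mult NE)
  qed
qed

end

section \<open>Quotient algebras\<close>

locale algebra_ideal = unital_algebra K A + ideal I A
  for K :: "('k, 'n) ring_scheme" (structure) and A :: "('k, 'a, 'p) module_scheme" (structure) and I
begin

abbreviation Q where "Q \<equiv> quotient_algebra A I"
abbreviation proj where "proj \<equiv> (\<lambda>x. I +>\<^bsub>A\<^esub> x)"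

lemma proj_eq_iff:
  "\<lbrakk>x \<in> carrier A; y \<in> carrier A\<rbrakk> \<Longrightarrow> proj x = proj y \<longleftrightarrow> x \<ominus>\<^bsub>A\<^esub> y \<in> I"
  using A.quotient_eq_iff_same_a_r_cos[OF ideal_axioms] by auto

lemma proj_eq_zero_iff:
  assumes "x \<in> carrier A"
  shows "proj x = I \<longleftrightarrow> x \<in> I"
  using assms rcos_const_imp_mem A.a_rcos_zero[OF ideal_axioms] by auto

lemma quotient_algebra_carrier: "carrier Q = proj ` carrier A"
  by (auto simp: quotient_algebra_def ring.defs module.defs FactRing_def A_RCOSETS_def')

lemma quotient_algebra_zero: "\<zero>\<^bsub>Q\<^esub> = I"
  by (simp add: quotient_algebra_def ring.defs module.defs FactRing_def)

lemma quotient_algebra_one: "\<one>\<^bsub>Q\<^esub> = proj \<one>\<^bsub>A\<^esub>"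
  by (simp add: quotient_algebra_def ring.defs module.defs FactRing_def)

lemma quotient_algebra_mult:
  "\<lbrakk>x \<in> carrier A; y \<in> carrier A\<rbrakk> \<Longrightarrow> proj x \<otimes>\<^bsub>Q\<^esub> proj y = proj (x \<otimes>\<^bsub>A\<^esub> y)"
  by (simp add: quotient_algebra_def ring.defs module.defs FactRing_def rcoset_mult_add)

lemma quotient_algebra_add:
  "\<lbrakk>x \<in> carrier A; y \<in> carrier A\<rbrakk> \<Longrightarrow> proj x \<oplus>\<^bsub>Q\<^esub> proj y = proj (x \<oplus>\<^bsub>A\<^esub> y)"
  by (simp add: quotient_algebra_def ring.defs module.defs FactRing_def a_rcos_sum)

text \<open>The scalar action on cosets is a union over representatives. If y - x lies in
  \<open>I\<close>, so does c y - c x, hence all members of the union are one and the same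
  coset.\<close>

lemma quotient_algebra_smult:
  assumes c: "c \<in> carrier K" and x: "x \<in> carrier A"
  shows "c \<odot>\<^bsub>Q\<^esub> proj x = proj (c \<odot>\<^bsub>A\<^esub> x)"
proof -
  have "proj (c \<odot>\<^bsub>A\<^esub> y) = proj (c \<odot>\<^bsub>A\<^esub> x)" if y: "y \<in> proj x" for y
  proof -
    have yc: "y \<in> carrier A" using a_elemrcos_carrier[OF x y] .
    have yx: "y \<ominus>\<^bsub>A\<^esub> x \<in> I"
      using a_rcos_module_minus[OF A.ring_axioms x yc] y by simp
    have "c \<odot>\<^bsub>A\<^esub> y \<ominus>\<^bsub>A\<^esub> c \<odot>\<^bsub>A\<^esub> x = c \<odot>\<^bsub>A\<^esub> (y \<ominus>\<^bsub>A\<^esub> x)"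
      using c x yc by (simp add: a_minus_def smult_r_distr smult_r_minus)
    also have "\<dots> \<in> I"
      by (rule ideal_smult_closed[OF unital_algebra_axioms ideal_axioms c yx])
    finally show ?thesis using c x yc by (simp add: proj_eq_iff)
  qed
  moreover have "x \<in> proj x" using a_rcos_self[OF x] .
  ultimately have "(\<Union>y\<in>proj x. proj (c \<odot>\<^bsub>A\<^esub> y)) = proj (c \<odot>\<^bsub>A\<^esub> x)" by blast
  then show ?thesis by (simp add: quotient_algebra_def ring.defs module.defs)
qed

lemma unital_algebra_quotient: "unital_algebra K Q"
proof (rule unital_algebraI)
  show "\<exists>y \<in> carrier Q. y \<oplus>\<^bsub>Q\<^esub> x = \<zero>\<^bsub>Q\<^esub>" if x: "x \<in> carrier Q" for x
  proof -
    obtain a where a: "a \<in> carrier A" "x = proj a" using x by (auto simp: quotient_algebra_carrier)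
    then have "proj (\<ominus>\<^bsub>A\<^esub> a) \<oplus>\<^bsub>Q\<^esub> x = \<zero>\<^bsub>Q\<^esub>"
      by (simp add: quotient_algebra_add A.l_neg quotient_algebra_zero proj_eq_zero_iff)
    then show ?thesis using a by (auto simp: quotient_algebra_carrier)
  qed
  have zero: "\<zero>\<^bsub>Q\<^esub> = proj \<zero>\<^bsub>A\<^esub>"
    using A.a_rcos_zero[OF ideal_axioms zero_closed] by (simp only: quotient_algebra_zero)
  show "\<zero>\<^bsub>Q\<^esub> \<in> carrier Q" by (auto simp: zero quotient_algebra_carrier)
  show "\<zero>\<^bsub>Q\<^esub> \<oplus>\<^bsub>Q\<^esub> x = x" if "x \<in> carrier Q" for x
    using that by (auto simp: zero quotient_algebra_carrier quotient_algebra_add)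
  show "field K" by (rule K.field_axioms)
qed (auto simp: quotient_algebra_carrier quotient_algebra_one
    quotient_algebra_add quotient_algebra_mult quotient_algebra_smult
    A.a_ac A.m_assoc A.l_distr A.r_distr smult_l_distr smult_r_distr smult_assoc1
    smult_mult_left smult_mult_right)

lemma proj_algebra_hom: "proj \<in> algebra_hom K A Q"
  by (intro algebra_homI linear_homI)
    (auto simp: quotient_algebra_carrier quotient_algebra_one
    quotient_algebra_add quotient_algebra_mult quotient_algebra_smult)

text \<open>A linear map that kills \<open>I\<close> is constant on each coset, so the image of a
  coset is a singleton. This is the well-definedness argument behind tensor lifts, maps out of the
  presented algebra and the structure maps of a quotient.\<close>

lemma the_elem_image_proj:
  assumes B: "module K B" and f: "f \<in> linear_hom K A B" and "\<And>i. i \<in> I \<Longrightarrow> f i = \<zero>\<^bsub>B\<^esub>"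
    and x: "x \<in> carrier A"
  shows "the_elem (f ` proj x) = f x"
proof -
  interpret B: module K B by fact
  have "f y = f x" if y: "y \<in> proj x" for y
  proof -
    from y obtain i where i: "i \<in> I" and "y = i \<oplus>\<^bsub>A\<^esub> x"
      unfolding a_r_coset_def' by blast
    then show ?thesis
      using linear_homD(2)[OF f Icarr[OF i] x] assms(3)[OF i] linear_homD(1)[OF f x] by simp
  qed
  moreover have "x \<in> proj x" using a_rcos_self[OF x] .
  ultimately have "f ` proj x = {f x}" by blast
  then show ?thesis by simp
qed

lemma quotient_linear_hom:
  assumes f: "f \<in> linear_hom K A B" and F: "\<And>x. x \<in> carrier A \<Longrightarrow> F (proj x) = f x"
  shows "F \<in> linear_hom K Q B"
  by (rule linear_homI)
    (auto simp: quotient_algebra_carrier quotient_algebra_add quotient_algebra_smult F linear_homD[OF f])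

lemma quotient_algebra_hom:
  assumes f: "f \<in> algebra_hom K A B" and F: "\<And>x. x \<in> carrier A \<Longrightarrow> F (proj x) = f x"
  shows "F \<in> algebra_hom K Q B"
  by (rule algebra_homI)
    (auto simp: quotient_linear_hom[OF algebra_homD(1)[OF f] F] quotient_algebra_carrier
      quotient_algebra_mult quotient_algebra_one F algebra_homD(6,7)[OF f])

end

section \<open>Tensor products\<close>

definition bilinear_map ::
  "('k, 'n) ring_scheme \<Rightarrow> ('k, 'v, 'p) module_scheme \<Rightarrow> ('k, 'w, 'r) module_scheme
    \<Rightarrow> ('k, 'u, 's) module_scheme \<Rightarrow> ('v \<Rightarrow> 'w \<Rightarrow> 'u) \<Rightarrow> bool"
  where "bilinear_map K V W U \<beta> \<longleftrightarrow>
    (\<forall>v \<in> carrier V. \<beta> v \<in> linear_hom K W U) \<and>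
    (\<forall>w \<in> carrier W. (\<lambda>v. \<beta> v w) \<in> linear_hom K V U)"

lemma bilinear_mapD:
  assumes "bilinear_map K V W U \<beta>"
  shows "v \<in> carrier V \<Longrightarrow> \<beta> v \<in> linear_hom K W U"
    and "w \<in> carrier W \<Longrightarrow> (\<lambda>v. \<beta> v w) \<in> linear_hom K V U"
  using assms by (auto simp: bilinear_map_def)

lemma bilinear_map_simps:
  assumes b: "bilinear_map K V W U \<beta>"
  shows "\<lbrakk>v \<in> carrier V; w \<in> carrier W\<rbrakk> \<Longrightarrow> \<beta> v w \<in> carrier U"
    and "\<lbrakk>v \<in> carrier V; v' \<in> carrier V; w \<in> carrier W\<rbrakk>
      \<Longrightarrow> \<beta> (v \<oplus>\<^bsub>V\<^esub> v') w = \<beta> v w \<oplus>\<^bsub>U\<^esub> \<beta> v' w"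
    and "\<lbrakk>v \<in> carrier V; w \<in> carrier W; w' \<in> carrier W\<rbrakk>
      \<Longrightarrow> \<beta> v (w \<oplus>\<^bsub>W\<^esub> w') = \<beta> v w \<oplus>\<^bsub>U\<^esub> \<beta> v w'"
    and "\<lbrakk>c \<in> carrier K; v \<in> carrier V; w \<in> carrier W\<rbrakk> \<Longrightarrow> \<beta> (c \<odot>\<^bsub>V\<^esub> v) w = c \<odot>\<^bsub>U\<^esub> \<beta> v w"
    and "\<lbrakk>c \<in> carrier K; v \<in> carrier V; w \<in> carrier W\<rbrakk> \<Longrightarrow> \<beta> v (c \<odot>\<^bsub>W\<^esub> w) = c \<odot>\<^bsub>U\<^esub> \<beta> v w"
  using linear_homD[OF bilinear_mapD(1)[OF b]] linear_homD[OF bilinear_mapD(2)[OF b]]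
  by simp_all

lemma bilinear_mapI:
  assumes "\<And>v w. \<lbrakk>v \<in> carrier V; w \<in> carrier W\<rbrakk> \<Longrightarrow> \<beta> v w \<in> carrier U"
    and "\<And>v v' w. \<lbrakk>v \<in> carrier V; v' \<in> carrier V; w \<in> carrier W\<rbrakk>
      \<Longrightarrow> \<beta> (v \<oplus>\<^bsub>V\<^esub> v') w = \<beta> v w \<oplus>\<^bsub>U\<^esub> \<beta> v' w"
    and "\<And>v w w'. \<lbrakk>v \<in> carrier V; w \<in> carrier W; w' \<in> carrier W\<rbrakk>
      \<Longrightarrow> \<beta> v (w \<oplus>\<^bsub>W\<^esub> w') = \<beta> v w \<oplus>\<^bsub>U\<^esub> \<beta> v w'"
    and "\<And>c v w. \<lbrakk>c \<in> carrier K; v \<in> carrier V; w \<in> carrier W\<rbrakk>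
      \<Longrightarrow> \<beta> (c \<odot>\<^bsub>V\<^esub> v) w = c \<odot>\<^bsub>U\<^esub> \<beta> v w"
    and "\<And>c v w. \<lbrakk>c \<in> carrier K; v \<in> carrier V; w \<in> carrier W\<rbrakk>
      \<Longrightarrow> \<beta> v (c \<odot>\<^bsub>W\<^esub> w) = c \<odot>\<^bsub>U\<^esub> \<beta> v w"
  shows "bilinear_map K V W U \<beta>"
  unfolding bilinear_map_def by (intro conjI ballI linear_homI) (simp_all add: assms)

section \<open>The tensor product of two algebras and its product\<close>

locale tensor_pair = V: unital_algebra K V + W: unital_algebra K W
  for K :: "('k, 'n) ring_scheme" (structure)
    and V :: "('k, 'v, 'p) module_scheme" and W :: "('k, 'w, 'r) module_scheme"

sublocale tensor_pair \<subseteq> F: monoid_over_field K "V \<times>\<times> W"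
  by (intro monoid_over_field.intro DirProd_monoid V.A.is_monoid W.A.is_monoid V.K.field_axioms)

context tensor_pair
begin

abbreviation F where "F \<equiv> tensor_free K V W"
abbreviation T where "T \<equiv> tensor K V W"
abbreviation e where "e \<equiv> basis_elem K"

lemma F_alg: "unital_algebra K F"
  using F.unital_algebra_monoid_algebra by (simp add: tensor_free_def)

sublocale FA: unital_algebra K F by (rule F_alg)

lemma e_closed: "\<lbrakk>v \<in> carrier V; w \<in> carrier W\<rbrakk> \<Longrightarrow> e (v, w) \<in> carrier F"
  using F.basis_elem_closed[of "(v, w)"] by (simp add: tensor_free_def)

lemma e_mult:
  "\<lbrakk>v \<in> carrier V; w \<in> carrier W; v' \<in> carrier V; w' \<in> carrier W\<rbrakk>
    \<Longrightarrow> e (v, w) \<otimes>\<^bsub>F\<^esub> e (v', w') = e (v \<otimes>\<^bsub>V\<^esub> v', w \<otimes>\<^bsub>W\<^esub> w')"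
  using F.basis_elem_mult[of "(v, w)" "(v', w')"] by (simp add: tensor_free_def)

lemma tensor_relations_memI:
  "\<lbrakk>v \<in> carrier V; v' \<in> carrier V; w \<in> carrier W\<rbrakk>
    \<Longrightarrow> e (v \<oplus>\<^bsub>V\<^esub> v', w) \<ominus>\<^bsub>F\<^esub> (e (v, w) \<oplus>\<^bsub>F\<^esub> e (v', w)) \<in> tensor_relations K V W"
  "\<lbrakk>v \<in> carrier V; w \<in> carrier W; w' \<in> carrier W\<rbrakk>
    \<Longrightarrow> e (v, w \<oplus>\<^bsub>W\<^esub> w') \<ominus>\<^bsub>F\<^esub> (e (v, w) \<oplus>\<^bsub>F\<^esub> e (v, w')) \<in> tensor_relations K V W"
  "\<lbrakk>c \<in> carrier K; v \<in> carrier V; w \<in> carrier W\<rbrakk>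
    \<Longrightarrow> e (c \<odot>\<^bsub>V\<^esub> v, w) \<ominus>\<^bsub>F\<^esub> c \<odot>\<^bsub>F\<^esub> e (v, w) \<in> tensor_relations K V W"
  "\<lbrakk>c \<in> carrier K; v \<in> carrier V; w \<in> carrier W\<rbrakk>
    \<Longrightarrow> e (v, c \<odot>\<^bsub>W\<^esub> w) \<ominus>\<^bsub>F\<^esub> c \<odot>\<^bsub>F\<^esub> e (v, w) \<in> tensor_relations K V W"
  unfolding tensor_relations_def Let_def by blast+

lemma tensor_relations_cases [consumes 1, case_names add_left add_right smult_left smult_right]:
  assumes "x \<in> tensor_relations K V W"
    and "\<And>v v' w. \<lbrakk>v \<in> carrier V; v' \<in> carrier V; w \<in> carrier W;
      x = e (v \<oplus>\<^bsub>V\<^esub> v', w) \<ominus>\<^bsub>F\<^esub> (e (v, w) \<oplus>\<^bsub>F\<^esub> e (v', w))\<rbrakk> \<Longrightarrow> P"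
    and "\<And>v w w'. \<lbrakk>v \<in> carrier V; w \<in> carrier W; w' \<in> carrier W;
      x = e (v, w \<oplus>\<^bsub>W\<^esub> w') \<ominus>\<^bsub>F\<^esub> (e (v, w) \<oplus>\<^bsub>F\<^esub> e (v, w'))\<rbrakk> \<Longrightarrow> P"
    and "\<And>c v w. \<lbrakk>c \<in> carrier K; v \<in> carrier V; w \<in> carrier W;
      x = e (c \<odot>\<^bsub>V\<^esub> v, w) \<ominus>\<^bsub>F\<^esub> c \<odot>\<^bsub>F\<^esub> e (v, w)\<rbrakk> \<Longrightarrow> P"
    and "\<And>c v w. \<lbrakk>c \<in> carrier K; v \<in> carrier V; w \<in> carrier W;
      x = e (v, c \<odot>\<^bsub>W\<^esub> w) \<ominus>\<^bsub>F\<^esub> c \<odot>\<^bsub>F\<^esub> e (v, w)\<rbrakk> \<Longrightarrow> P"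
  shows P
  using assms(1) unfolding tensor_relations_def Let_def
  by (elim UnE CollectE exE conjE) (erule (3) assms(2-5))+

lemma tensor_relations_closed: "tensor_relations K V W \<subseteq> carrier F"
proof
  fix x assume "x \<in> tensor_relations K V W"
  then show "x \<in> carrier F"
    by (cases rule: tensor_relations_cases) (simp_all add: e_closed)
qed

lemma mult_minus_distr:
  assumes "x \<in> carrier F" "y \<in> carrier F" "z \<in> carrier F"
  shows "x \<otimes>\<^bsub>F\<^esub> (y \<ominus>\<^bsub>F\<^esub> z) = x \<otimes>\<^bsub>F\<^esub> y \<ominus>\<^bsub>F\<^esub> x \<otimes>\<^bsub>F\<^esub> z"
    and "(y \<ominus>\<^bsub>F\<^esub> z) \<otimes>\<^bsub>F\<^esub> x = y \<otimes>\<^bsub>F\<^esub> x \<ominus>\<^bsub>F\<^esub> z \<otimes>\<^bsub>F\<^esub> x"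
  using assms by (simp_all add: a_minus_def FA.A.r_distr FA.A.l_distr FA.A.r_minus FA.A.l_minus)

text \<open>Multiplying by a basis pair acts linearly on each component, so it sends each
  bilinearity relation to a relation of the same kind. The set of relations is thus stable on both
  sides, and its span is an ideal.\<close>

lemma tensor_relations_mult:
  assumes "s \<in> tensor_relations K V W" and "v\<^sub>0 \<in> carrier V" and "w\<^sub>0 \<in> carrier W"
  shows "e (v\<^sub>0, w\<^sub>0) \<otimes>\<^bsub>F\<^esub> s \<in> tensor_relations K V W"
    and "s \<otimes>\<^bsub>F\<^esub> e (v\<^sub>0, w\<^sub>0) \<in> tensor_relations K V W"
proof -
  note simps = assms(2,3) e_closed e_mult mult_minus_distr FA.A.r_distr FA.A.l_distr
    FA.smult_mult_left FA.smult_mult_right V.A.r_distr V.A.l_distr W.A.r_distr W.A.l_distr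
    V.smult_mult_left V.smult_mult_right W.smult_mult_left W.smult_mult_right
    tensor_relations_memI
  show "e (v\<^sub>0, w\<^sub>0) \<otimes>\<^bsub>F\<^esub> s \<in> tensor_relations K V W"
    using assms(1) by (cases rule: tensor_relations_cases) (simp_all add: simps)
  show "s \<otimes>\<^bsub>F\<^esub> e (v\<^sub>0, w\<^sub>0) \<in> tensor_relations K V W"
    using assms(1) by (cases rule: tensor_relations_cases) (simp_all add: simps)
qed

lemma tensor_kernel_ideal: "ideal (tensor_kernel K V W) F"
  unfolding tensor_kernel_def tensor_free_def
  by (rule F.submodule_span_ideal)
    (use tensor_relations_closed tensor_relations_mult in
      \<open>auto simp: tensor_free_def intro!: submodule_spanI\<close>)

end

sublocale tensor_pair \<subseteq> TQ: algebra_ideal K "tensor_free K V W" "tensor_kernel K V W"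
  by (intro algebra_ideal.intro F_alg tensor_kernel_ideal)

context tensor_pair
begin

lemma tensor_eq: "T = TQ.Q" by (simp add: tensor_def)

lemma unital_algebra_tensor: "unital_algebra K T"
  by (simp add: tensor_eq TQ.unital_algebra_quotient)

sublocale T: unital_algebra K T by (rule unital_algebra_tensor)

abbreviation pure (infix \<open>\<otimes>\<^sub>t\<close> 75) where "pure \<equiv> pure_tensor K V W"

lemma pure_eq: "v \<otimes>\<^sub>t w = TQ.proj (e (v, w))" by (simp add: pure_tensor_def)

lemma pure_closed [simp, intro]: "\<lbrakk>v \<in> carrier V; w \<in> carrier W\<rbrakk> \<Longrightarrow> v \<otimes>\<^sub>t w \<in> carrier T"
  by (simp add: tensor_eq pure_eq TQ.quotient_algebra_carrier e_closed)

lemma pure_mult: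
  "\<lbrakk>v \<in> carrier V; w \<in> carrier W; v' \<in> carrier V; w' \<in> carrier W\<rbrakk>
    \<Longrightarrow> (v \<otimes>\<^sub>t w) \<otimes>\<^bsub>T\<^esub> (v' \<otimes>\<^sub>t w') = (v \<otimes>\<^bsub>V\<^esub> v') \<otimes>\<^sub>t (w \<otimes>\<^bsub>W\<^esub> w')"
  by (simp add: tensor_eq pure_eq TQ.quotient_algebra_mult e_closed e_mult)

lemma pure_one: "\<one>\<^bsub>V\<^esub> \<otimes>\<^sub>t \<one>\<^bsub>W\<^esub> = \<one>\<^bsub>T\<^esub>"
  by (simp add: tensor_eq pure_eq TQ.quotient_algebra_one)
    (simp add: tensor_free_def monoid_algebra_def)

lemma relation_proj_eq:
  assumes "x \<in> carrier F" and "y \<in> carrier F" and "x \<ominus>\<^bsub>F\<^esub> y \<in> tensor_relations K V W"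
  shows "TQ.proj x = TQ.proj y"
proof -
  have "x \<ominus>\<^bsub>F\<^esub> y \<in> tensor_kernel K V W"
    unfolding tensor_kernel_def by (rule submodule_spanI) (rule assms(3))
  then show ?thesis using assms(1,2) TQ.proj_eq_iff by blast
qed

lemma pure_bilinear: "bilinear_map K V W T pure"
proof (rule bilinear_mapI)
  note simps = tensor_eq pure_eq TQ.quotient_algebra_add TQ.quotient_algebra_smult e_closed
  show "v \<otimes>\<^sub>t w \<in> carrier T" if "v \<in> carrier V" "w \<in> carrier W" for v w using that by simp
  show "(v \<oplus>\<^bsub>V\<^esub> v') \<otimes>\<^sub>t w = v \<otimes>\<^sub>t w \<oplus>\<^bsub>T\<^esub> v' \<otimes>\<^sub>t w"
    if "v \<in> carrier V" "v' \<in> carrier V" "w \<in> carrier W" for v v' w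
    using that by (simp add: simps, intro relation_proj_eq) (simp_all add: e_closed tensor_relations_memI)
  show "v \<otimes>\<^sub>t (w \<oplus>\<^bsub>W\<^esub> w') = v \<otimes>\<^sub>t w \<oplus>\<^bsub>T\<^esub> v \<otimes>\<^sub>t w'"
    if "v \<in> carrier V" "w \<in> carrier W" "w' \<in> carrier W" for v w w'
    using that by (simp add: simps, intro relation_proj_eq) (simp_all add: e_closed tensor_relations_memI)
  show "(c \<odot>\<^bsub>V\<^esub> v) \<otimes>\<^sub>t w = c \<odot>\<^bsub>T\<^esub> (v \<otimes>\<^sub>t w)"
    if "c \<in> carrier K" "v \<in> carrier V" "w \<in> carrier W" for c v w
    using that by (simp add: simps, intro relation_proj_eq) (simp_all add: e_closed tensor_relations_memI)
  show "v \<otimes>\<^sub>t (c \<odot>\<^bsub>W\<^esub> w) = c \<odot>\<^bsub>T\<^esub> (v \<otimes>\<^sub>t w)"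
    if "c \<in> carrier K" "v \<in> carrier V" "w \<in> carrier W" for c v w
    using that by (simp add: simps, intro relation_proj_eq) (simp_all add: e_closed tensor_relations_memI)
qed

lemmas pure_simps = bilinear_map_simps[OF pure_bilinear]

text \<open>Scalars can be moved into the first factor, c (v \<otimes> w) = (c v) \<otimes> w, so
  sums of pure tensors already exhaust the tensor product and no scalar case is left.\<close>

lemma tensor_induct [consumes 1, case_names pure add]:
  assumes "x \<in> carrier T"
    and pure: "\<And>v w. \<lbrakk>v \<in> carrier V; w \<in> carrier W\<rbrakk> \<Longrightarrow> P (v \<otimes>\<^sub>t w)"
    and add: "\<And>x y. \<lbrakk>x \<in> carrier T; y \<in> carrier T; P x; P y\<rbrakk> \<Longrightarrow> P (x \<oplus>\<^bsub>T\<^esub> y)"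
  shows "P x"
proof -
  \<comment> \<open>The claim is strengthened to all multiples, so that a scalar met on the way is
    stored in \<open>c\<close> until a pure tensor absorbs it. The end result is the instance c =
    1.\<close>
  have "\<forall>c \<in> carrier K. P (c \<odot>\<^bsub>T\<^esub> TQ.proj f)" if "f \<in> carrier F.F" for f
    using that
  proof (induction f rule: F.monoid_algebra_induct)
    case (basis g)
    then obtain v w where g: "g = (v, w)" "v \<in> carrier V" "w \<in> carrier W" by auto
    show ?case
    proof
      fix c assume "c \<in> carrier K"
      then have "P ((c \<odot>\<^bsub>V\<^esub> v) \<otimes>\<^sub>t w)" using g by (intro pure) simp_all
      then have "P (c \<odot>\<^bsub>T\<^esub> (v \<otimes>\<^sub>t w))" using g \<open>c \<in> carrier K\<close> by (simp add: pure_simps)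
      then show "P (c \<odot>\<^bsub>T\<^esub> TQ.proj (F.e g))" by (simp add: pure_eq g)
    qed
  next
    case (add f g)
    then have fg: "f \<in> carrier F" "g \<in> carrier F" by (simp_all add: tensor_free_def)
    have pr: "TQ.proj f \<in> carrier T" "TQ.proj g \<in> carrier T"
      using fg by (simp_all add: tensor_eq TQ.quotient_algebra_carrier)
    have "TQ.proj (f \<oplus>\<^bsub>F.F\<^esub> g) = TQ.proj f \<oplus>\<^bsub>T\<^esub> TQ.proj g"
      using TQ.quotient_algebra_add[OF fg] by (simp add: tensor_eq tensor_free_def)
    then show ?case using add.IH assms(3) pr by (simp add: T.smult_r_distr)
  next
    case (smult d f)
    then have f: "f \<in> carrier F" by (simp add: tensor_free_def)
    have pr: "TQ.proj f \<in> carrier T" using f by (simp add: tensor_eq TQ.quotient_algebra_carrier)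
    have eq: "TQ.proj (d \<odot>\<^bsub>F.F\<^esub> f) = d \<odot>\<^bsub>T\<^esub> TQ.proj f"
      using TQ.quotient_algebra_smult[OF smult.hyps(1) f] by (simp add: tensor_eq tensor_free_def)
    show ?case
    proof
      fix c assume c: "c \<in> carrier K"
      then have "P ((c \<otimes> d) \<odot>\<^bsub>T\<^esub> TQ.proj f)" using smult by simp
      then show "P (c \<odot>\<^bsub>T\<^esub> TQ.proj (d \<odot>\<^bsub>F.F\<^esub> f))"
        using c smult.hyps(1) pr by (simp add: eq T.smult_assoc1)
    qed
  qed
  moreover obtain f where f: "f \<in> carrier F" "x = TQ.proj f"
    using assms(1) by (auto simp: tensor_eq TQ.quotient_algebra_carrier)
  ultimately have "P (\<one> \<odot>\<^bsub>T\<^esub> x)" by (simp add: tensor_free_def)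
  then show ?thesis using assms(1) by simp
qed

section \<open>The universal property for bilinear maps\<close>

context
  fixes U :: "('k, 'u, 's) module_scheme" and \<beta>
  assumes U: "module K U" and \<beta>: "bilinear_map K V W U \<beta>"
begin

interpretation U: module K U by (rule U)

abbreviation (input) ext where "ext \<equiv> linear_extension K U (\<lambda>(v, w). \<beta> v w)"

lemma \<beta>_Pi: "(\<lambda>(v, w). \<beta> v w) \<in> carrier (V \<times>\<times> W) \<rightarrow> carrier U"
  using bilinear_map_simps(1)[OF \<beta>] by auto

lemma ext_linear: "ext \<in> linear_hom K F U"
  unfolding tensor_free_def by (rule F.linear_extension_linear[OF U \<beta>_Pi])

lemma ext_basis: "\<lbrakk>v \<in> carrier V; w \<in> carrier W\<rbrakk> \<Longrightarrow> ext (e (v, w)) = \<beta> v w"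
  using F.linear_extension_basis[OF U \<beta>_Pi, of "(v, w)"] by simp

text \<open>Bilinearity of \<open>\<beta>\<close> turns each defining relation into u - u, and
  linearity extends the vanishing to the span. Hence the lift is well defined on cosets.\<close>

lemma ext_kernel:
  assumes "x \<in> tensor_kernel K V W"
  shows "ext x = \<zero>\<^bsub>U\<^esub>"
proof -
  note L = ext_linear
  have self: "u \<ominus>\<^bsub>U\<^esub> u = \<zero>\<^bsub>U\<^esub>" if "u \<in> carrier U" for u
    using that by (simp add: a_minus_def U.M.r_neg)
  have relations: "ext s = \<zero>\<^bsub>U\<^esub>" if "s \<in> tensor_relations K V W" for s
    using that
    by (cases rule: tensor_relations_cases)
      (simp_all add: linear_hom_minus[OF FA.module_axioms U L] linear_homD(2,3)[OF L] e_closed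
        ext_basis bilinear_map_simps[OF \<beta>] self)
  show ?thesis
    using FA.module_axioms tensor_relations_closed assms[unfolded tensor_kernel_def]
    by (induction x rule: submodule_span_induct)
      (simp_all add: relations linear_homD(2,3)[OF L] linear_hom_zero[OF FA.module_axioms U L])
qed

lemma tensor_lift_proj:
  "x \<in> carrier F \<Longrightarrow> tensor_lift K U \<beta> (TQ.proj x) = ext x"
  unfolding tensor_lift_def by (rule TQ.the_elem_image_proj[OF U ext_linear ext_kernel])

lemma tensor_lift_linear: "tensor_lift K U \<beta> \<in> linear_hom K T U"
  unfolding tensor_eq by (rule TQ.quotient_linear_hom[OF ext_linear tensor_lift_proj])

lemma tensor_lift_pure:
  "\<lbrakk>v \<in> carrier V; w \<in> carrier W\<rbrakk> \<Longrightarrow> tensor_lift K U \<beta> (v \<otimes>\<^sub>t w) = \<beta> v w"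
  by (simp add: pure_eq tensor_lift_proj ext_basis e_closed)

end

text \<open>Double induction on pure tensors. The hypothesis \<open>mult\<close> forces the images
  of the two factors to commute with each other; this holds for counits and for maps into tensor
  products, and excludes S(x) y in general.\<close>

lemma tensor_lift_algebra_hom:
  assumes B: "unital_algebra K B" and \<beta>: "bilinear_map K V W B \<beta>"
    and mult: "\<And>v w v' w'. \<lbrakk>v \<in> carrier V; w \<in> carrier W; v' \<in> carrier V; w' \<in> carrier W\<rbrakk>
      \<Longrightarrow> \<beta> (v \<otimes>\<^bsub>V\<^esub> v') (w \<otimes>\<^bsub>W\<^esub> w') = \<beta> v w \<otimes>\<^bsub>B\<^esub> \<beta> v' w'"
    and one: "\<beta> \<one>\<^bsub>V\<^esub> \<one>\<^bsub>W\<^esub> = \<one>\<^bsub>B\<^esub>"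
  shows "tensor_lift K B \<beta> \<in> algebra_hom K T B"
proof (rule algebra_homI)
  interpret B: unital_algebra K B by fact
  note U = unital_algebra_module[OF B]
  let ?L = "tensor_lift K B \<beta>"
  show L: "?L \<in> linear_hom K T B" by (rule tensor_lift_linear[OF U \<beta>])
  note pure = tensor_lift_pure[OF U \<beta>]
  show "?L \<one>\<^bsub>T\<^esub> = \<one>\<^bsub>B\<^esub>" by (simp add: pure_one[symmetric] pure one)
  show "?L (x \<otimes>\<^bsub>T\<^esub> y) = ?L x \<otimes>\<^bsub>B\<^esub> ?L y" if x: "x \<in> carrier T" and y: "y \<in> carrier T" for x y
    using x
  proof (induction x rule: tensor_induct)
    case vw: (pure v w)
    show ?case using y
    proof (induction y rule: tensor_induct)
      case (pure v' w')
      then show ?case using vw by (simp add: pure_mult tensor_lift_pure[OF U \<beta>] mult)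
    next
      case (add y z)
      then show ?case using vw
        by (simp add: T.A.r_distr linear_homD[OF L] B.A.r_distr)
    qed
  next
    case (add x z)
    then show ?case using y by (simp add: T.A.l_distr linear_homD[OF L] B.A.l_distr)
  qed
qed

lemma tensor_subspace_gen_closed:
  assumes "I \<subseteq> carrier V" and "J \<subseteq> carrier W"
  shows "{v \<otimes>\<^sub>t w | v w. v \<in> I \<and> w \<in> J} \<subseteq> carrier T"
  using assms by auto

text \<open>A pure tensor with legs in \<open>I\<close> and \<open>J\<close> keeps its legs there
  when multiplied by any pure tensor. Taking one of the two ideals to be the whole algebra makes
  both summands of the Hopf ideal condition ideals.\<close>

lemma tensor_subspace_ideal:
  assumes I: "ideal I V" and J: "ideal J W"
  shows "ideal (tensor_subspace K V W I J) T"
proof (rule idealI)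
  interpret I: ideal I V by (rule I)
  interpret J: ideal J W by (rule J)
  let ?S = "{v \<otimes>\<^sub>t w | v w. v \<in> I \<and> w \<in> J}"
  let ?N = "tensor_subspace K V W I J"
  have S: "?S \<subseteq> carrier T" by (rule tensor_subspace_gen_closed[OF I.a_subset J.a_subset])
  have N: "submodule ?N K T"
    unfolding tensor_subspace_def by (rule submodule_span_submodule[OF T.module_axioms S])
  note NE = T.submoduleE[OF N]
  have N0: "\<zero>\<^bsub>T\<^esub> \<in> ?N" using subgroup.one_closed[OF submodule.axioms(1)[OF N]] by simp
  have pure_N: "v \<otimes>\<^sub>t w \<in> ?N" if "v \<in> I" "w \<in> J" for v w
    unfolding tensor_subspace_def by (rule submodule_spanI) (use that in blast)
  show "ring T" by (rule T.A.ring_axioms)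
  show "subgroup ?N (add_monoid T)" by (rule submodule.axioms(1)[OF N])
  show "t \<otimes>\<^bsub>T\<^esub> x \<in> ?N" if x: "x \<in> ?N" and t: "t \<in> carrier T" for x t
    using T.module_axioms S x[unfolded tensor_subspace_def]
  proof (induction x rule: submodule_span_induct)
    case (gen s)
    then obtain v w where s: "v \<in> I" "w \<in> J" "s = v \<otimes>\<^sub>t w" by blast
    show ?case using t
      by (induction t rule: tensor_induct)
        (use s in \<open>simp_all add: pure_mult pure_N I.I_l_closed J.I_l_closed T.A.l_distr NE(5)\<close>)
  next
    case zero then show ?case using t N0 by simp
  next
    case (add x y) then show ?case using t by (simp add: T.A.r_distr NE)
  next
    case (smult c x) then show ?case using t by (simp add: T.smult_mult_right NE)
  qed
  show "x \<otimes>\<^bsub>T\<^esub> t \<in> ?N" if x: "x \<in> ?N" and t: "t \<in> carrier T" for x t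
    using T.module_axioms S x[unfolded tensor_subspace_def]
  proof (induction x rule: submodule_span_induct)
    case (gen s)
    then obtain v w where s: "v \<in> I" "w \<in> J" "s = v \<otimes>\<^sub>t w" by blast
    show ?case using t
      by (induction t rule: tensor_induct)
        (use s in \<open>simp_all add: pure_mult pure_N I.I_r_closed J.I_r_closed T.A.r_distr NE(5)\<close>)
  next
    case zero then show ?case using t N0 by simp
  next
    case (add x y) then show ?case using t by (simp add: T.A.l_distr NE)
  next
    case (smult c x) then show ?case using t by (simp add: T.smult_mult_left NE)
  qed
qed

lemma pure_zero:
  "w \<in> carrier W \<Longrightarrow> \<zero>\<^bsub>V\<^esub> \<otimes>\<^sub>t w = \<zero>\<^bsub>T\<^esub>"
  "v \<in> carrier V \<Longrightarrow> v \<otimes>\<^sub>t \<zero>\<^bsub>W\<^esub> = \<zero>\<^bsub>T\<^esub>"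
  using linear_hom_zero[OF V.module_axioms T.module_axioms bilinear_mapD(2)[OF pure_bilinear]]
    linear_hom_zero[OF W.module_axioms T.module_axioms bilinear_mapD(1)[OF pure_bilinear]]
  by simp_all

end

lemma tensor_pairI: "unital_algebra K V \<Longrightarrow> unital_algebra K W \<Longrightarrow> tensor_pair K V W"
  by (rule tensor_pair.intro)

section \<open>Tensor products of maps, and the associator\<close>

lemma pure_comp_bilinear:
  assumes "tensor_pair K V W" and f: "f \<in> linear_hom K X V" and g: "g \<in> linear_hom K Y W"
  shows "bilinear_map K X Y (tensor K V W) (\<lambda>x y. pure_tensor K V W (f x) (g y))"
proof -
  interpret tensor_pair K V W by fact
  show ?thesis
    by (rule bilinear_mapI) (simp_all add: linear_homD[OF f] linear_homD[OF g] pure_simps)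
qed

lemma tensor_map_linear:
  assumes "tensor_pair K X Y" and VW: "tensor_pair K V W"
    and f: "f \<in> linear_hom K X V" and g: "g \<in> linear_hom K Y W"
  shows "tensor_map K V W f g \<in> linear_hom K (tensor K X Y) (tensor K V W)"
    and "\<lbrakk>x \<in> carrier X; y \<in> carrier Y\<rbrakk> \<Longrightarrow>
      tensor_map K V W f g (pure_tensor K X Y x y) = pure_tensor K V W (f x) (g y)"
proof -
  interpret XY: tensor_pair K X Y by fact
  interpret VW: tensor_pair K V W by fact
  note U = VW.T.module_axioms and b = pure_comp_bilinear[OF VW f g]
  show "tensor_map K V W f g \<in> linear_hom K (tensor K X Y) (tensor K V W)"
    unfolding tensor_map_def by (rule XY.tensor_lift_linear[OF U b])
  show "tensor_map K V W f g (pure_tensor K X Y x y) = pure_tensor K V W (f x) (g y)"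
    if "x \<in> carrier X" "y \<in> carrier Y"
    unfolding tensor_map_def using that by (rule XY.tensor_lift_pure[OF U b])
qed

text \<open>A pure tensor with a zero leg is zero. The disjunction covers I \<otimes> H and H
  \<otimes> I with one statement.\<close>

lemma tensor_map_tensor_subspace:
  assumes XY: "tensor_pair K X Y" and VW: "tensor_pair K V W"
    and f: "f \<in> linear_hom K X V" and g: "g \<in> linear_hom K Y W"
    and I: "I \<subseteq> carrier X" and J: "J \<subseteq> carrier Y"
    and zero: "(\<forall>x\<in>I. f x = \<zero>\<^bsub>V\<^esub>) \<or> (\<forall>y\<in>J. g y = \<zero>\<^bsub>W\<^esub>)"
    and t: "t \<in> tensor_subspace K X Y I J"
  shows "tensor_map K V W f g t = \<zero>\<^bsub>tensor K V W\<^esub>"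
proof -
  interpret XY: tensor_pair K X Y by fact
  interpret VW: tensor_pair K V W by fact
  note m = tensor_map_linear[OF XY VW f g]
  show ?thesis
    using XY.T.module_axioms XY.tensor_subspace_gen_closed[OF I J] t[unfolded tensor_subspace_def]
  proof (induction t rule: submodule_span_induct)
    case (gen s)
    then obtain x y where s: "x \<in> I" "y \<in> J" "s = pure_tensor K X Y x y" by blast
    then have "x \<in> carrier X" "y \<in> carrier Y" using I J by auto
    then show ?case using s zero
      by (auto simp: m(2) VW.pure_zero linear_homD(1)[OF f] linear_homD(1)[OF g])
  qed (simp_all add: linear_hom_zero[OF XY.T.module_axioms VW.T.module_axioms m(1)] linear_homD(2,3)[OF m(1)])
qed

lemma tensor_map_algebra_hom:
  assumes "tensor_pair K X Y" and VW: "tensor_pair K V W"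
    and f: "f \<in> algebra_hom K X V" and g: "g \<in> algebra_hom K Y W"
  shows "tensor_map K V W f g \<in> algebra_hom K (tensor K X Y) (tensor K V W)"
proof -
  interpret XY: tensor_pair K X Y by fact
  interpret VW: tensor_pair K V W by fact
  note b = pure_comp_bilinear[OF VW algebra_homD(1)[OF f] algebra_homD(1)[OF g]]
  show ?thesis
    unfolding tensor_map_def
    by (rule XY.tensor_lift_algebra_hom[OF VW.unital_algebra_tensor b])
      (simp_all add: algebra_homD(3,6,7)[OF f] algebra_homD(3,6,7)[OF g] VW.pure_mult VW.pure_one)
qed

text \<open>The associator is a lift whose kernel function is itself a lift, with \<open>z\<close>
  as parameter. Being a homomorphism, it can take part in comparisons on generators.\<close>

lemma tensor_assoc_algebra_hom:
  assumes U: "unital_algebra K U" and V: "unital_algebra K V" and W: "unital_algebra K W"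
  shows "tensor_assoc K U V W \<in>
      algebra_hom K (tensor K (tensor K U V) W) (tensor K U (tensor K V W))"
    and "\<lbrakk>x \<in> carrier U; y \<in> carrier V; z \<in> carrier W\<rbrakk> \<Longrightarrow>
      tensor_assoc K U V W (pure_tensor K (tensor K U V) W (pure_tensor K U V x y) z) =
        pure_tensor K U (tensor K V W) x (pure_tensor K V W y z)"
proof -
  interpret UV: tensor_pair K U V using U V by (rule tensor_pairI)
  interpret VW: tensor_pair K V W using V W by (rule tensor_pairI)
  interpret L: tensor_pair K "tensor K U V" W using UV.unital_algebra_tensor W by (rule tensor_pairI)
  interpret R: tensor_pair K U "tensor K V W" using U VW.unital_algebra_tensor by (rule tensor_pairI)
  let ?T = "tensor K U (tensor K V W)"
  let ?\<beta> = "\<lambda>z x y. pure_tensor K U (tensor K V W) x (pure_tensor K V W y z)"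
  let ?\<gamma> = "\<lambda>t z. tensor_lift K ?T (?\<beta> z) t"
  have \<beta>: "bilinear_map K U V ?T (?\<beta> z)" if "z \<in> carrier W" for z
    using that by (intro bilinear_mapI) (simp_all add: VW.pure_simps R.pure_simps)
  note \<gamma>_lin = UV.tensor_lift_linear[OF R.T.module_axioms \<beta>]
  note \<gamma>_pure = UV.tensor_lift_pure[OF R.T.module_axioms \<beta>]
  note \<gamma>D = linear_homD[OF \<gamma>_lin]
  \<comment> \<open>Linearity in \<open>t\<close> belongs to the inner lift. Linearity in
    \<open>z\<close>, where \<open>z\<close> sits inside the lifted function, is obtained by
    induction on \<open>t\<close>.\<close>
  have \<gamma>: "bilinear_map K (tensor K U V) W ?T ?\<gamma>"
  proof (rule bilinear_mapI)
    show "?\<gamma> t (z \<oplus>\<^bsub>W\<^esub> z') = ?\<gamma> t z \<oplus>\<^bsub>?T\<^esub> ?\<gamma> t z'"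
      if t: "t \<in> carrier (tensor K U V)" and z: "z \<in> carrier W" "z' \<in> carrier W" for t z z'
      using t
      by (induction t rule: UV.tensor_induct)
        (use z in \<open>simp_all add: \<gamma>_pure VW.pure_simps R.pure_simps \<gamma>D R.T.A.a_ac\<close>)
    show "?\<gamma> t (c \<odot>\<^bsub>W\<^esub> z) = c \<odot>\<^bsub>?T\<^esub> ?\<gamma> t z"
      if c: "c \<in> carrier K" and t: "t \<in> carrier (tensor K U V)" and z: "z \<in> carrier W" for c t z
      using t
      by (induction t rule: UV.tensor_induct)
        (use c z in \<open>simp_all add: \<gamma>_pure VW.pure_simps R.pure_simps \<gamma>D R.T.smult_r_distr\<close>)
  qed (simp_all add: \<gamma>D)
  have eq: "tensor_assoc K U V W = tensor_lift K ?T ?\<gamma>"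
    by (simp add: tensor_assoc_def Let_def)
  have mult: "?\<gamma> (t \<otimes>\<^bsub>tensor K U V\<^esub> t') (z \<otimes>\<^bsub>W\<^esub> z') = ?\<gamma> t z \<otimes>\<^bsub>?T\<^esub> ?\<gamma> t' z'"
    if t: "t \<in> carrier (tensor K U V)" and t': "t' \<in> carrier (tensor K U V)"
      and z: "z \<in> carrier W" "z' \<in> carrier W" for t t' z z'
    using t
  proof (induction t rule: UV.tensor_induct)
    case vw: (pure v w)
    show ?case using t'
    proof (induction t' rule: UV.tensor_induct)
      case (pure v' w')
      then show ?case using vw z
        by (simp add: UV.pure_mult \<gamma>_pure R.pure_mult VW.pure_mult)
    next
      case (add x y)
      then show ?case using vw z by (simp add: UV.T.A.r_distr \<gamma>D R.T.A.r_distr)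
    qed
  next
    case (add x y)
    then show ?case using t' z by (simp add: UV.T.A.l_distr \<gamma>D R.T.A.l_distr)
  qed
  have one: "?\<gamma> \<one>\<^bsub>tensor K U V\<^esub> \<one>\<^bsub>W\<^esub> = \<one>\<^bsub>?T\<^esub>"
    by (simp add: UV.pure_one[symmetric] \<gamma>_pure VW.pure_one R.pure_one)
  show "tensor_assoc K U V W \<in> algebra_hom K (tensor K (tensor K U V) W) ?T"
    unfolding eq by (rule L.tensor_lift_algebra_hom[OF R.unital_algebra_tensor \<gamma> mult one])
  show "tensor_assoc K U V W (pure_tensor K (tensor K U V) W (pure_tensor K U V x y) z) =
        pure_tensor K U (tensor K V W) x (pure_tensor K V W y z)"
    if "x \<in> carrier U" "y \<in> carrier V" "z \<in> carrier W"
    unfolding eq using that by (simp add: L.tensor_lift_pure[OF R.T.module_axioms \<gamma>] \<gamma>_pure)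
qed

section \<open>The free algebra and the universal property of \<^const>\<open>axb_algebra\<close>\<close>

lemma module_extend_simps [simp]:
  "carrier (module.extend A x) = carrier A" "mult (module.extend A x) = mult A"
  "one (module.extend A x) = one A" "zero (module.extend A x) = zero A"
  "add (module.extend A x) = add A" "smult (module.extend A x) = smult A"
  by (simp_all add: module.defs)

lemma hopf_extend_simps [simp]:
  "comult (module.extend A (hopf.fields c d s)) = c"
  "counit (module.extend A (hopf.fields c d s)) = d"
  "antipode (module.extend A (hopf.fields c d s)) = s"
  by (simp_all add: module.defs hopf.defs)

lemma unital_algebra_extend:
  assumes "unital_algebra K A"
  shows "unital_algebra K (module.extend A x)"
proof -
  interpret A: unital_algebra K A by fact
  show ?thesis
    by (rule unital_algebraI)
      (simp_all add: A.K.field_axioms A.A.a_ac A.A.m_assoc A.A.l_distr A.A.r_distr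
        A.smult_l_distr A.smult_r_distr A.smult_assoc1 A.smult_mult_left A.smult_mult_right A.A.add.l_inv_ex)
qed

text \<open>Only the algebra operations enter the construction. Hence a Hopf algebra and its
  underlying algebra have literally the same tensor square, and maps into one are maps into the
  other.\<close>

lemma tensor_free_extend [simp]:
  "tensor_free K (module.extend A x) (module.extend B y) = tensor_free K A B"
  by (simp add: tensor_free_def DirProd_def)

lemma tensor_kernel_extend [simp]:
  "tensor_kernel K (module.extend A x) (module.extend B y) = tensor_kernel K A B"
  by (simp add: tensor_kernel_def tensor_relations_def)

lemma tensor_extend [simp]: "tensor K (module.extend A x) (module.extend B y) = tensor K A B"
  by (simp add: tensor_def)

lemma pure_tensor_extend [simp]:
  "pure_tensor K (module.extend A x) (module.extend B y) = pure_tensor K A B"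
  by (simp add: pure_tensor_def fun_eq_iff)

section \<open>The free algebra\<close>

lemma monoid_free_monoid: "monoid free_monoid"
  by (rule monoidI) (simp_all add: free_monoid_def)

lemma monoid_over_field_free_monoid: "field K \<Longrightarrow> monoid_over_field K free_monoid"
  by (intro monoid_over_field.intro monoid_free_monoid)

context
  fixes K :: "('k, 'n) ring_scheme" (structure)
  assumes K: "field K"
begin

interpretation M: monoid_over_field K "free_monoid :: 'x list monoid"
  by (rule monoid_over_field_free_monoid[OF K])

lemma unital_algebra_free_algebra: "unital_algebra K (free_algebra K :: ('k, 'x list \<Rightarrow> 'k) module)"
  unfolding free_algebra_def by (rule M.unital_algebra_monoid_algebra)

lemma word_closed: "basis_elem K (w :: 'x list) \<in> carrier (free_algebra K)"
  unfolding free_algebra_def by (rule M.basis_elem_closed) (simp add: free_monoid_def)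

lemma word_mult:
  "basis_elem K (v :: 'x list) \<otimes>\<^bsub>free_algebra K\<^esub> basis_elem K w = basis_elem K (v @ w)"
  unfolding free_algebra_def using M.basis_elem_mult[of v w] by (simp add: free_monoid_def)

lemma free_algebra_one: "\<one>\<^bsub>free_algebra K\<^esub> = basis_elem K ([] :: 'x list)"
  by (simp add: free_algebra_def monoid_algebra_def free_monoid_def)

text \<open>Multiplying the values along a word turns concatenation into the product of
  \<open>B\<close>, so the word function satisfies the hypotheses for a multiplicative linear
  extension.\<close>

lemma free_lift_algebra_hom:
  fixes g :: "'x \<Rightarrow> 'b" and B :: "('k, 'b, 'p) module_scheme"
  assumes B: "unital_algebra K B" and g: "\<And>l. g l \<in> carrier B"
  shows "free_lift K B g \<in> algebra_hom K (free_algebra K) B"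
    and "free_lift K B g (basis_elem K [l]) = g l"
proof -
  interpret B: unital_algebra K B by (rule B)
  let ?h = "\<lambda>w. foldr (\<lambda>x y. g x \<otimes>\<^bsub>B\<^esub> y) w \<one>\<^bsub>B\<^esub>"
  have cl: "?h w \<in> carrier B" for w by (induction w) (simp_all add: g)
  have mult: "?h (v @ w) = ?h v \<otimes>\<^bsub>B\<^esub> ?h w" for v w
    by (induction v) (simp_all add: g cl B.A.m_assoc)
  have Pi: "?h \<in> carrier (free_monoid :: 'x list monoid) \<rightarrow> carrier B" using cl by auto
  show "free_lift K B g \<in> algebra_hom K (free_algebra K) B"
    unfolding free_lift_def free_algebra_def
    by (rule M.linear_extension_algebra_hom[OF B Pi]) (use mult in \<open>simp_all add: free_monoid_def\<close>)
  have "[l] \<in> carrier (free_monoid :: 'x list monoid)" by (simp add: free_monoid_def)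
  from M.linear_extension_basis[OF B.module_axioms Pi this]
  show "free_lift K B g (basis_elem K [l]) = g l"
    by (simp add: free_lift_def g)
qed

lemma free_algebra_generated:
  "carrier (free_algebra K) \<subseteq> generated_subalgebra K (free_algebra K) (range (\<lambda>l :: 'x. basis_elem K [l]))"
  (is "_ \<subseteq> ?G")
proof
  fix f :: "'x list \<Rightarrow> 'k" assume "f \<in> carrier (free_algebra K)"
  then have "f \<in> carrier M.F" by (simp add: free_algebra_def)
  then show "f \<in> ?G"
  proof (induction f rule: M.monoid_algebra_induct)
    case (basis w)
    show ?case
    proof (induction w)
      case Nil
      show ?case using generated_subalgebra.one[of "free_algebra K"] by (simp only: free_algebra_one)
    next
      case (Cons l w)
      have "basis_elem K [l] \<otimes>\<^bsub>free_algebra K\<^esub> basis_elem K w \<in> ?G"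
        by (intro generated_subalgebra.mult generated_subalgebra.gen Cons) simp
      then show ?case by (simp add: word_mult)
    qed
  next
    case (add f g)
    then show ?case using generated_subalgebra.add[of f K "free_algebra K"] by (simp add: free_algebra_def)
  next
    case (smult c f)
    then show ?case using generated_subalgebra.smult[of c K f "free_algebra K"] by (simp add: free_algebra_def)
  qed
qed

section \<open>The algebra presented by an invertible generator and a free one\<close>

lemma axb_relations_closed: "axb_relations K \<subseteq> carrier (free_algebra K)"
proof -
  interpret A: unital_algebra K "free_algebra K :: ('k, axb_letter list \<Rightarrow> 'k) module"
    by (rule unital_algebra_free_algebra)
  show ?thesis by (simp add: axb_relations_def Let_def word_closed)
qed

lemma algebra_ideal_axb_kernel: "algebra_ideal K (free_algebra K) (axb_kernel K)"
proof -
  interpret A: unital_algebra K "free_algebra K :: ('k, axb_letter list \<Rightarrow> 'k) module"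
    by (rule unital_algebra_free_algebra)
  show ?thesis
    unfolding axb_kernel_def
    by (intro algebra_ideal.intro A.unital_algebra_axioms A.A.genideal_ideal axb_relations_closed)
qed

interpretation Q: algebra_ideal K "free_algebra K" "axb_kernel K"
  by (rule algebra_ideal_axb_kernel)

lemma unital_algebra_axb_algebra: "unital_algebra K (axb_algebra K)"
  unfolding axb_algebra_def by (rule Q.unital_algebra_quotient)

lemma axb_gen_closed: "axb_gen K l \<in> carrier (axb_algebra K)"
  by (simp add: axb_algebra_def axb_gen_def Q.quotient_algebra_carrier word_closed)

lemma axb_algebra_generated:
  "carrier (axb_algebra K) \<subseteq> generated_subalgebra K (axb_algebra K) (range (axb_gen K))"
proof
  fix x assume "x \<in> carrier (axb_algebra K)"
  then obtain f where f: "f \<in> carrier (free_algebra K)" and x: "x = Q.proj f"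
    by (auto simp: axb_algebra_def Q.quotient_algebra_carrier)
  have "Q.proj f \<in> generated_subalgebra K Q.Q (Q.proj ` range (\<lambda>l. basis_elem K [l]))"
    by (rule generated_subalgebra_image[OF unital_algebra_free_algebra _ Q.proj_algebra_hom])
      (use f free_algebra_generated in \<open>auto simp: word_closed\<close>)
  also have "Q.proj ` range (\<lambda>l. basis_elem K [l]) = range (axb_gen K)"
    by (auto simp: axb_gen_def)
  finally show "x \<in> generated_subalgebra K (axb_algebra K) (range (axb_gen K))"
    by (simp add: x axb_algebra_def)
qed

lemma axb_algebra_inverse:
  "axb_a K \<otimes>\<^bsub>axb_algebra K\<^esub> axb_a_inv K = \<one>\<^bsub>axb_algebra K\<^esub>"
  "axb_a_inv K \<otimes>\<^bsub>axb_algebra K\<^esub> axb_a K = \<one>\<^bsub>axb_algebra K\<^esub>"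
proof -
  have rel: "axb_relations K \<subseteq> axb_kernel K"
    unfolding axb_kernel_def by (rule Q.A.genideal_self[OF axb_relations_closed])
  have "Q.proj (basis_elem K [Letter_a, Letter_a_inv]) = Q.proj \<one>\<^bsub>free_algebra K\<^esub>"
    "Q.proj (basis_elem K [Letter_a_inv, Letter_a]) = Q.proj \<one>\<^bsub>free_algebra K\<^esub>"
    by (subst Q.proj_eq_iff; use rel in \<open>simp add: word_closed axb_relations_def Let_def\<close>)+
  then show "axb_a K \<otimes>\<^bsub>axb_algebra K\<^esub> axb_a_inv K = \<one>\<^bsub>axb_algebra K\<^esub>"
    "axb_a_inv K \<otimes>\<^bsub>axb_algebra K\<^esub> axb_a K = \<one>\<^bsub>axb_algebra K\<^esub>"
    by (simp_all add: axb_algebra_def axb_gen_def Q.quotient_algebra_mult Q.quotient_algebra_one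
        word_closed word_mult)
qed

text \<open>The two equations \<open>inv\<close> say precisely that the lift from the free algebra
  kills the two relators; it then kills their ideal and descends to cosets.\<close>

lemma axb_lift_algebra_hom:
  assumes B: "unital_algebra K B" and g: "\<And>l. g l \<in> carrier B"
    and inv: "g Letter_a \<otimes>\<^bsub>B\<^esub> g Letter_a_inv = \<one>\<^bsub>B\<^esub>" "g Letter_a_inv \<otimes>\<^bsub>B\<^esub> g Letter_a = \<one>\<^bsub>B\<^esub>"
  shows "axb_lift K B g \<in> algebra_hom K (axb_algebra K) B"
    and "axb_lift K B g (axb_gen K l) = g l"
proof -
  interpret B: unital_algebra K B by (rule B)
  let ?f = "free_lift K B g"
  note f = free_lift_algebra_hom(1)[OF B g] and fl = free_lift_algebra_hom(2)[OF B g]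
  have word: "?f (basis_elem K [l, l']) = g l \<otimes>\<^bsub>B\<^esub> g l'" for l l'
    using algebra_homD(6)[OF f word_closed[of "[l]"] word_closed[of "[l']"]]
    by (simp add: word_mult fl)
  have self: "\<one>\<^bsub>B\<^esub> \<ominus>\<^bsub>B\<^esub> \<one>\<^bsub>B\<^esub> = \<zero>\<^bsub>B\<^esub>" by (simp add: a_minus_def B.A.r_neg)
  have rel: "?f s = \<zero>\<^bsub>B\<^esub>" if "s \<in> axb_relations K" for s
    using that
    by (auto simp: axb_relations_def Let_def word inv self algebra_homD(7)[OF f] word_closed
        linear_hom_minus[OF Q.module_axioms B.module_axioms algebra_homD(1)[OF f]])
  have ker: "?f x = \<zero>\<^bsub>B\<^esub>" if "x \<in> axb_kernel K" for x
    by (rule algebra_hom_idl_zero[OF unital_algebra_free_algebra B f axb_relations_closed rel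
          that[unfolded axb_kernel_def]])
  have lift: "axb_lift K B g (Q.proj x) = ?f x" if "x \<in> carrier (free_algebra K)" for x
    unfolding axb_lift_def
    by (rule Q.the_elem_image_proj[OF B.module_axioms algebra_homD(1)[OF f] ker that])
  show "axb_lift K B g \<in> algebra_hom K (axb_algebra K) B"
    unfolding axb_algebra_def by (rule Q.quotient_algebra_hom[OF f lift])
  show "axb_lift K B g (axb_gen K l) = g l"
    by (simp add: axb_gen_def lift word_closed fl)
qed

end

section \<open>Hopf algebras generated by \<open>a\<close>, its inverse, and \<open>b\<close>\<close>

text \<open>Lists only what passes easily to quotients: generation, multiplicativity of the
  structure maps and their values on generators. The Hopf axioms are consequences. The inverse
  \<open>a'\<close> counts as a generator because \<open>generated_subalgebra\<close> has no clause
  for inverses, and the antipode is a homomorphism into the opposite algebra.\<close>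

locale axb_hopf = unital_algebra K H
  for K :: "('k, 'n) ring_scheme" (structure) and H :: "('k, 'a, 'h) hopf_scheme" (structure) +
  fixes a a' b
  assumes gen_closed: "a \<in> carrier H" "a' \<in> carrier H" "b \<in> carrier H"
    and gen_inverse: "a \<otimes>\<^bsub>H\<^esub> a' = \<one>\<^bsub>H\<^esub>" "a' \<otimes>\<^bsub>H\<^esub> a = \<one>\<^bsub>H\<^esub>"
    and generated: "carrier H \<subseteq> generated_subalgebra K H {a, a', b}"
    and comult_algebra_hom: "comult H \<in> algebra_hom K H (tensor K H H)"
    and counit_algebra_hom: "counit H \<in> algebra_hom K H (base_algebra K)"
    and antipode_algebra_hom: "antipode H \<in> algebra_hom K H (opposite_algebra H)"
    and comult_gen: "comult H a = pure_tensor K H H a a" "comult H a' = pure_tensor K H H a' a'"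
      "comult H b = pure_tensor K H H b a \<oplus>\<^bsub>tensor K H H\<^esub> pure_tensor K H H \<one>\<^bsub>H\<^esub> b"
    and counit_gen: "counit H a = \<one>" "counit H a' = \<one>" "counit H b = \<zero>"
    and antipode_gen: "antipode H a = a'" "antipode H a' = a"
      "antipode H b = \<ominus>\<^bsub>H\<^esub> (b \<otimes>\<^bsub>H\<^esub> a')"

sublocale axb_hopf \<subseteq> T: tensor_pair K H H
  by (intro tensor_pairI unital_algebra_axioms)

context axb_hopf
begin

abbreviation pure (infix \<open>\<otimes>\<^sub>t\<close> 75) where "pure \<equiv> pure_tensor K H H"
abbreviation T where "T \<equiv> tensor K H H"

lemmas comultD = algebra_homD[OF comult_algebra_hom]
lemmas counitD = algebra_homD[OF counit_algebra_hom, simplified]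
lemmas antipodeD = algebra_homD(3-7)[OF antipode_algebra_hom, simplified]

lemma antipode_linear_hom: "antipode H \<in> linear_hom K H H"
  by (rule linear_homI) (simp_all add: antipodeD)

lemma algebra_hom_eqI:
  assumes "f \<in> algebra_hom K H B" and "g \<in> algebra_hom K H B"
    and "f a = g a" "f a' = g a'" "f b = g b" and "x \<in> carrier H"
  shows "f x = g x"
  by (rule algebra_hom_eq_on_generators[OF unital_algebra_axioms _ generated assms(1,2) _ assms(6)])
    (use assms(3-5) gen_closed in auto)

text \<open>Both sides are homomorphisms into H \<otimes> (H \<otimes> H). On \<open>a\<close> and
  \<open>a'\<close> they give the threefold diagonal tensor, on \<open>b\<close> the sum b \<otimes>
  a \<otimes> a + 1 \<otimes> b \<otimes> a + 1 \<otimes> 1 \<otimes> b.\<close>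

lemma coassociative:
  assumes h: "h \<in> carrier H"
  shows "tensor_assoc K H H H (tensor_map K T H (comult H) (\<lambda>x. x) (comult H h)) =
      tensor_map K H T (\<lambda>x. x) (comult H) (comult H h)"
proof -
  interpret L: tensor_pair K T H by (intro tensor_pairI T.unital_algebra_tensor unital_algebra_axioms)
  interpret R: tensor_pair K H T by (intro tensor_pairI T.unital_algebra_tensor unital_algebra_axioms)
  note id = algebra_hom_id[of K H]
  note \<alpha> = tensor_assoc_algebra_hom[OF unital_algebra_axioms unital_algebra_axioms unital_algebra_axioms]
  note l = tensor_map_algebra_hom[OF T.tensor_pair_axioms L.tensor_pair_axioms comult_algebra_hom id]
  note r = tensor_map_algebra_hom[OF T.tensor_pair_axioms R.tensor_pair_axioms id comult_algebra_hom]
  note lp = tensor_map_linear(2)[OF T.tensor_pair_axioms L.tensor_pair_axioms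
      algebra_homD(1)[OF comult_algebra_hom] algebra_homD(1)[OF id]]
  note rp = tensor_map_linear(2)[OF T.tensor_pair_axioms R.tensor_pair_axioms
      algebra_homD(1)[OF id] algebra_homD(1)[OF comult_algebra_hom]]
  note simps = gen_closed comult_gen lp rp algebra_homD(4)[OF l] algebra_homD(4)[OF r]
    algebra_homD(4)[OF \<alpha>(1)] \<alpha>(2) L.pure_simps R.pure_simps comultD(7) T.pure_one[symmetric]
  show ?thesis
  proof (rule algebra_hom_eqI[OF _ _ _ _ _ h])
    show "(\<lambda>h. tensor_assoc K H H H (tensor_map K T H (comult H) (\<lambda>x. x) (comult H h)))
        \<in> algebra_hom K H (tensor K H T)"
      by (intro algebra_hom_comp[OF _ \<alpha>(1)] algebra_hom_comp[OF comult_algebra_hom l])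
    show "(\<lambda>h. tensor_map K H T (\<lambda>x. x) (comult H) (comult H h)) \<in> algebra_hom K H (tensor K H T)"
      by (rule algebra_hom_comp[OF comult_algebra_hom r])
  qed (simp_all add: simps R.T.A.a_ac)
qed

text \<open>Since the counit has scalar values, \<epsilon>(x) y and \<epsilon>(y) x are
  multiplicative in x \<otimes> y; their composites with \<Delta> are homomorphisms to be compared
  with the identity.\<close>

lemma counital:
  assumes h: "h \<in> carrier H"
  shows "tensor_lift K H (\<lambda>x y. counit H x \<odot>\<^bsub>H\<^esub> y) (comult H h) = h"
    and "tensor_lift K H (\<lambda>x y. counit H y \<odot>\<^bsub>H\<^esub> x) (comult H h) = h"
proof -
  have bl: "bilinear_map K H H H (\<lambda>x y. counit H x \<odot>\<^bsub>H\<^esub> y)"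
    by (rule bilinear_mapI)
      (simp_all add: counitD smult_l_distr smult_r_distr smult_assoc1[symmetric] K.m_comm)
  have br: "bilinear_map K H H H (\<lambda>x y. counit H y \<odot>\<^bsub>H\<^esub> x)"
    by (rule bilinear_mapI)
      (simp_all add: counitD smult_l_distr smult_r_distr smult_assoc1[symmetric] K.m_comm)
  have l: "tensor_lift K H (\<lambda>x y. counit H x \<odot>\<^bsub>H\<^esub> y) \<in> algebra_hom K T H"
    by (rule T.tensor_lift_algebra_hom[OF unital_algebra_axioms bl])
      (simp_all add: counitD smult_mult_left smult_mult_right smult_assoc1[symmetric] K.m_comm)
  have r: "tensor_lift K H (\<lambda>x y. counit H y \<odot>\<^bsub>H\<^esub> x) \<in> algebra_hom K T H"
    by (rule T.tensor_lift_algebra_hom[OF unital_algebra_axioms br])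
      (simp_all add: counitD smult_mult_left smult_mult_right smult_assoc1[symmetric] K.m_comm)
  show "tensor_lift K H (\<lambda>x y. counit H x \<odot>\<^bsub>H\<^esub> y) (comult H h) = h"
    by (rule algebra_hom_eqI[OF algebra_hom_comp[OF comult_algebra_hom l] algebra_hom_id _ _ _ h])
      (simp_all add: comult_gen gen_closed T.tensor_lift_pure[OF module_axioms bl] counit_gen
        algebra_homD(4)[OF l] counitD)
  show "tensor_lift K H (\<lambda>x y. counit H y \<odot>\<^bsub>H\<^esub> x) (comult H h) = h"
    by (rule algebra_hom_eqI[OF algebra_hom_comp[OF comult_algebra_hom r] algebra_hom_id _ _ _ h])
      (simp_all add: comult_gen gen_closed T.tensor_lift_pure[OF module_axioms br] counit_gen
        algebra_homD(4)[OF r] counitD)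
qed

text \<open>For properties that are not equalities of two homomorphisms: the antipode axioms and
  surjectivity.\<close>

lemma gen_induct [consumes 1, case_names a a' b one add mult smult]:
  assumes "h \<in> carrier H" and "P a" and "P a'" and "P b" and "P \<one>\<^bsub>H\<^esub>"
    and "\<And>x y. \<lbrakk>x \<in> carrier H; y \<in> carrier H; P x; P y\<rbrakk> \<Longrightarrow> P (x \<oplus>\<^bsub>H\<^esub> y)"
    and "\<And>x y. \<lbrakk>x \<in> carrier H; y \<in> carrier H; P x; P y\<rbrakk> \<Longrightarrow> P (x \<otimes>\<^bsub>H\<^esub> y)"
    and "\<And>c x. \<lbrakk>c \<in> carrier K; x \<in> carrier H; P x\<rbrakk> \<Longrightarrow> P (c \<odot>\<^bsub>H\<^esub> x)"
  shows "P h"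
proof -
  have sub: "{a, a', b} \<subseteq> carrier H" using gen_closed by simp
  note closed = generated_subalgebra_closed[OF unital_algebra_axioms sub]
  have "h \<in> generated_subalgebra K H {a, a', b}" using generated assms(1) by blast
  then show ?thesis
  proof (induction rule: generated_subalgebra.induct)
    case (gen s) then show ?case using assms(2-4) by blast
  next
    case one then show ?case by (rule assms(5))
  qed (blast intro: assms(6-8) closed)+
qed

lemma antipode_bilinear_left: "bilinear_map K H H H (\<lambda>x y. antipode H x \<otimes>\<^bsub>H\<^esub> y)"
  by (rule bilinear_mapI)
    (simp_all add: antipodeD A.l_distr A.r_distr smult_mult_left smult_mult_right)

text \<open>If \<phi>(s) = c 1, then \<phi>(s t) = c \<phi>(t), because the scalar leaves the middle
  of S(x) \<phi>(s) y. With s = \<Delta>(x) and t = \<Delta>(y) this shows that the axiom passes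
  from x and y to x y; sums and multiples follow from linearity.\<close>

lemma antipodal_left:
  assumes h: "h \<in> carrier H"
  shows "tensor_lift K H (\<lambda>x y. antipode H x \<otimes>\<^bsub>H\<^esub> y) (comult H h) = counit H h \<odot>\<^bsub>H\<^esub> \<one>\<^bsub>H\<^esub>"
proof -
  let ?\<phi> = "tensor_lift K H (\<lambda>x y. antipode H x \<otimes>\<^bsub>H\<^esub> y)"
  note b = antipode_bilinear_left
  note \<phi> = linear_homD[OF T.tensor_lift_linear[OF module_axioms b]]
  note \<phi>_pure = T.tensor_lift_pure[OF module_axioms b]
  \<comment> \<open>\<open>\<phi>(s (x \<otimes> y)) = S(x) \<phi>(s) y\<close>, because \<open>S\<close> reverses products\<close>
  have mult_pure: "?\<phi> (s \<otimes>\<^bsub>T\<^esub> (x \<otimes>\<^sub>t y)) = antipode H x \<otimes>\<^bsub>H\<^esub> ?\<phi> s \<otimes>\<^bsub>H\<^esub> y"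
    if s: "s \<in> carrier T" and xy: "x \<in> carrier H" "y \<in> carrier H" for s x y
    using s
    by (induction s rule: T.tensor_induct)
      (use xy in \<open>simp_all add: T.pure_mult \<phi>_pure antipodeD A.m_assoc T.T.A.l_distr \<phi> A.l_distr A.r_distr\<close>)
  have \<phi>_mult: "?\<phi> (s \<otimes>\<^bsub>T\<^esub> t) = c \<odot>\<^bsub>H\<^esub> ?\<phi> t"
    if s: "s \<in> carrier T" and c: "c \<in> carrier K" and eq: "?\<phi> s = c \<odot>\<^bsub>H\<^esub> \<one>\<^bsub>H\<^esub>"
      and t: "t \<in> carrier T" for s t c
    using t
  proof (induction t rule: T.tensor_induct)
    case (pure x y)
    then show ?case
      using c by (simp add: mult_pure[OF s] eq smult_mult_left smult_mult_right antipodeD \<phi>_pure)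
  next
    case (add x y)
    then show ?case using s c by (simp add: T.T.A.r_distr \<phi> smult_r_distr)
  qed
  show ?thesis using h
  proof (induction h rule: gen_induct)
    \<comment> \<open>S(b) a + S(1) b = -b a' a + b = 0.\<close>
    case b
    then show ?case
      by (simp add: comult_gen gen_closed \<phi> \<phi>_pure antipode_gen antipodeD counit_gen
          A.l_minus A.m_assoc gen_inverse A.l_neg)
  next
    case (add x y)
    then show ?case by (simp add: comultD \<phi> counitD smult_l_distr)
  next
    case (mult x y)
    then show ?case
      by (simp add: comultD(3,6) \<phi>_mult[of "comult H x" "counit H x"] counitD smult_assoc1)
  next
    case (smult c x)
    then show ?case by (simp add: comultD \<phi> counitD smult_assoc1)
  qed (simp_all add: comult_gen gen_closed \<phi>_pure antipode_gen counit_gen gen_inverse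
      comultD(7) T.pure_one[symmetric] antipodeD counitD)
qed

text \<open>Mirror image of the left axiom: in x \<psi>(t) S(y) the inner value now comes from the
  right-hand factor \<open>t\<close>, so in a product x y the scalar is supplied by y.\<close>

lemma antipodal_right:
  assumes h: "h \<in> carrier H"
  shows "tensor_lift K H (\<lambda>x y. x \<otimes>\<^bsub>H\<^esub> antipode H y) (comult H h) = counit H h \<odot>\<^bsub>H\<^esub> \<one>\<^bsub>H\<^esub>"
proof -
  let ?\<psi> = "tensor_lift K H (\<lambda>x y. x \<otimes>\<^bsub>H\<^esub> antipode H y)"
  have b: "bilinear_map K H H H (\<lambda>x y. x \<otimes>\<^bsub>H\<^esub> antipode H y)"
    by (rule bilinear_mapI)
      (simp_all add: antipodeD A.l_distr A.r_distr smult_mult_left smult_mult_right)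
  note \<psi> = linear_homD[OF T.tensor_lift_linear[OF module_axioms b]]
  note \<psi>_pure = T.tensor_lift_pure[OF module_axioms b]
  have mult_pure: "?\<psi> ((x \<otimes>\<^sub>t y) \<otimes>\<^bsub>T\<^esub> t) = x \<otimes>\<^bsub>H\<^esub> ?\<psi> t \<otimes>\<^bsub>H\<^esub> antipode H y"
    if t: "t \<in> carrier T" and xy: "x \<in> carrier H" "y \<in> carrier H" for t x y
    using t
    by (induction t rule: T.tensor_induct)
      (use xy in \<open>simp_all add: T.pure_mult \<psi>_pure antipodeD A.m_assoc T.T.A.r_distr \<psi> A.l_distr A.r_distr\<close>)
  have \<psi>_mult: "?\<psi> (s \<otimes>\<^bsub>T\<^esub> t) = c \<odot>\<^bsub>H\<^esub> ?\<psi> s"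
    if t: "t \<in> carrier T" and c: "c \<in> carrier K" and eq: "?\<psi> t = c \<odot>\<^bsub>H\<^esub> \<one>\<^bsub>H\<^esub>"
      and s: "s \<in> carrier T" for s t c
    using s
  proof (induction s rule: T.tensor_induct)
    case (pure x y)
    then show ?case
      using c by (simp add: mult_pure[OF t] eq smult_mult_left smult_mult_right antipodeD \<psi>_pure)
  next
    case (add x y)
    then show ?case using t c by (simp add: T.T.A.l_distr \<psi> smult_r_distr)
  qed
  show ?thesis using h
  proof (induction h rule: gen_induct)
    \<comment> \<open>b S(a) + 1 S(b) = b a' - b a' = 0.\<close>
    case b
    then show ?case
      by (simp add: comult_gen gen_closed \<psi> \<psi>_pure antipode_gen antipodeD counit_gen A.r_neg)
  next
    case (add x y)
    then show ?case by (simp add: comultD \<psi> counitD smult_l_distr)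
  next
    case (mult x y)
    then show ?case
      by (simp add: comultD(3,6) \<psi>_mult[of "comult H y" "counit H y"] counitD K.m_comm smult_assoc1[symmetric])
  next
    case (smult c x)
    then show ?case by (simp add: comultD \<psi> counitD smult_assoc1)
  qed (simp_all add: comult_gen gen_closed \<psi>_pure antipode_gen counit_gen gen_inverse
      comultD(7) T.pure_one[symmetric] antipodeD counitD)
qed

lemma hopf_algebra: "hopf_algebra K H"
  by (intro hopf_algebra.intro unital_algebra_axioms hopf_algebra_axioms.intro comult_algebra_hom
      counit_algebra_hom antipode_linear_hom coassociative counital antipodal_left antipodal_right)

end

section \<open>Morphisms and quotients\<close>

text \<open>Each compatibility compares two homomorphisms that agree on generators. Surjectivity
  comes along, as the image is closed under the algebra operations and contains the generators of
  the target.\<close>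

lemma surj_hopf_homI:
  assumes "axb_hopf K H a a' b" and "axb_hopf K H' c c' d"
    and f: "f \<in> algebra_hom K H H'" and fgen: "f a = c" "f a' = c'" "f b = d"
  shows "f \<in> surj_hopf_hom K H H'"
proof -
  interpret H: axb_hopf K H a a' b by fact
  interpret H': axb_hopf K H' c c' d by fact
  note ff = tensor_map_algebra_hom[OF H.T.tensor_pair_axioms H'.T.tensor_pair_axioms f f]
  note ff_pure = tensor_map_linear(2)[OF H.T.tensor_pair_axioms H'.T.tensor_pair_axioms
      algebra_homD(1)[OF f] algebra_homD(1)[OF f]]
  \<comment> \<open>For the antipode both composites are homomorphisms into the opposite algebra of
    the target.\<close>
  note op = algebra_hom_opposite[OF f]
  note simps = fgen H.gen_closed H'.gen_closed algebra_homD(3-7)[OF f]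
  have "comult H' (f x) = tensor_map K H' H' f f (comult H x)" if "x \<in> carrier H" for x
    by (rule H.algebra_hom_eqI[OF algebra_hom_comp[OF f H'.comult_algebra_hom]
          algebra_hom_comp[OF H.comult_algebra_hom ff] _ _ _ that])
      (simp_all add: simps H.comult_gen H'.comult_gen ff_pure algebra_homD(4)[OF ff])
  moreover have "counit H' (f x) = counit H x" if "x \<in> carrier H" for x
    by (rule H.algebra_hom_eqI[OF algebra_hom_comp[OF f H'.counit_algebra_hom]
          H.counit_algebra_hom _ _ _ that])
      (simp_all add: simps H.counit_gen H'.counit_gen)
  moreover have "antipode H' (f x) = f (antipode H x)" if "x \<in> carrier H" for x
    by (rule H.algebra_hom_eqI[OF algebra_hom_comp[OF f H'.antipode_algebra_hom]
          algebra_hom_comp[OF H.antipode_algebra_hom op] _ _ _ that])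
      (simp_all add: simps H.antipode_gen H'.antipode_gen
        linear_hom_neg[OF H.module_axioms H'.module_axioms algebra_homD(1)[OF f]])
  ultimately have hom: "f \<in> hopf_hom K H H'" by (simp add: hopf_hom_def f)
  have "y \<in> f ` carrier H" if y: "y \<in> carrier H'" for y
    using y
  proof (induction y rule: H'.gen_induct)
    case one
    show ?case using algebra_homD(7)[OF f] by (metis H.A.one_closed image_eqI)
  next
    case (add x y)
    then show ?case using algebra_homD(4)[OF f] H.A.a_closed by (smt (verit) image_iff)
  next
    case (mult x y)
    then show ?case using algebra_homD(6)[OF f] H.A.m_closed by (smt (verit) image_iff)
  next
    case (smult x y)
    then show ?case using algebra_homD(5)[OF f] H.smult_closed by (smt (verit) image_iff)
  qed (use fgen H.gen_closed in auto)
  then have "f ` carrier H = carrier H'" using algebra_homD(3)[OF f] by auto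
  then show ?thesis by (simp add: surj_hopf_hom_def hom)
qed

text \<open>The three Hopf ideal conditions give well-definedness of the three induced maps.
  Multiplicativity and the values on generators are then inherited through the projection, and that
  is all \<open>axb_hopf\<close> requires.\<close>

lemma axb_hopf_quotient:
  assumes "axb_hopf K H a a' b" and I: "hopf_ideal K H I"
  shows "axb_hopf K (quotient_hopf K H I) (I +>\<^bsub>H\<^esub> a) (I +>\<^bsub>H\<^esub> a') (I +>\<^bsub>H\<^esub> b)"
    and "(\<lambda>x. I +>\<^bsub>H\<^esub> x) \<in> algebra_hom K H (quotient_hopf K H I)"
proof -
  interpret H: axb_hopf K H a a' b by fact
  interpret I: algebra_ideal K H I
    using I by (intro algebra_ideal.intro H.unital_algebra_axioms) (simp add: hopf_ideal_def)
  interpret QQ: tensor_pair K I.Q I.Q by (intro tensor_pairI I.unital_algebra_quotient)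
  note p = I.proj_algebra_hom
  note pp = tensor_map_algebra_hom[OF H.T.tensor_pair_axioms QQ.tensor_pair_axioms p p]
  note pp_linear = tensor_map_linear[OF H.T.tensor_pair_axioms QQ.tensor_pair_axioms
      algebra_homD(1)[OF p] algebra_homD(1)[OF p]]
  define \<Delta> where "\<Delta> = (\<lambda>x. tensor_map K I.Q I.Q I.proj I.proj (comult H x))"
  define S where "S = (\<lambda>x. I.proj (antipode H x))"
  define \<Delta>' where "\<Delta>' = (\<lambda>X. the_elem (\<Delta> ` X))"
  define \<epsilon>' where "\<epsilon>' = (\<lambda>X. the_elem (counit H ` X))"
  define S' where "S' = (\<lambda>X. the_elem (S ` X))"
  have quotient: "quotient_hopf K H I = module.extend I.Q (hopf.fields \<Delta>' \<epsilon>' S')"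
    by (simp add: quotient_hopf_def Let_def \<Delta>_def S_def \<Delta>'_def \<epsilon>'_def S'_def)
  have p_zero: "I.proj x = \<zero>\<^bsub>I.Q\<^esub>" if "x \<in> I" for x
    using that by (simp only: I.quotient_algebra_zero H.A.a_rcos_zero[OF I.ideal_axioms])
  have \<Delta>: "\<Delta> \<in> algebra_hom K H (tensor K I.Q I.Q)"
    unfolding \<Delta>_def by (rule algebra_hom_comp[OF H.comult_algebra_hom pp])
  \<comment> \<open>\<Delta>(x) splits into a part with first leg in \<open>I\<close> and a part
    with second leg in \<open>I\<close>; applying the projection to both legs annihilates
    each.\<close>
  have \<Delta>_zero: "\<Delta> x = \<zero>\<^bsub>tensor K I.Q I.Q\<^esub>" if x: "x \<in> I" for x
  proof -
    have "comult H x \<in> tensor_subspace K H H I (carrier H)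
        <+>\<^bsub>tensor K H H\<^esub> tensor_subspace K H H (carrier H) I"
      using I x by (auto simp: hopf_ideal_def)
    then obtain u v where u: "u \<in> tensor_subspace K H H I (carrier H)"
      and v: "v \<in> tensor_subspace K H H (carrier H) I"
      and uv: "comult H x = u \<oplus>\<^bsub>tensor K H H\<^esub> v"
      by (auto simp: set_add_def')
    note ideals = H.T.tensor_subspace_ideal[OF I.ideal_axioms H.A.oneideal]
      H.T.tensor_subspace_ideal[OF H.A.oneideal I.ideal_axioms]
    have "u \<in> carrier (tensor K H H)" "v \<in> carrier (tensor K H H)"
      using ideal.Icarr[OF ideals(1) u] ideal.Icarr[OF ideals(2) v] .
    moreover note kill = tensor_map_tensor_subspace[OF H.T.tensor_pair_axioms QQ.tensor_pair_axioms
      algebra_homD(1)[OF p] algebra_homD(1)[OF p]]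
    have "tensor_map K I.Q I.Q I.proj I.proj u = \<zero>\<^bsub>tensor K I.Q I.Q\<^esub>"
      by (rule kill[OF I.a_subset subset_refl _ u]) (simp add: p_zero)
    moreover have "tensor_map K I.Q I.Q I.proj I.proj v = \<zero>\<^bsub>tensor K I.Q I.Q\<^esub>"
      by (rule kill[OF subset_refl I.a_subset _ v]) (simp add: p_zero)
    ultimately show ?thesis
      by (simp add: \<Delta>_def uv algebra_homD(4)[OF pp])
  qed
  have \<Delta>': "\<Delta>' (I.proj x) = \<Delta> x" if "x \<in> carrier H" for x
    unfolding \<Delta>'_def
    by (rule I.the_elem_image_proj[OF QQ.T.module_axioms algebra_homD(1)[OF \<Delta>] \<Delta>_zero that])
  have \<epsilon>': "\<epsilon>' (I.proj x) = counit H x" if "x \<in> carrier H" for x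
    unfolding \<epsilon>'_def
  proof (rule I.the_elem_image_proj[OF _ algebra_homD(1)[OF H.counit_algebra_hom] _ that])
    show "module K (base_algebra K)"
      by (rule unital_algebra_module[OF unital_algebra_base[OF H.K.field_axioms]])
  qed (use I in \<open>simp add: hopf_ideal_def\<close>)
  note p_op = algebra_hom_opposite[OF p]
  have S: "S \<in> algebra_hom K H (opposite_algebra I.Q)"
    unfolding S_def by (rule algebra_hom_comp[OF H.antipode_algebra_hom p_op])
  have S': "S' (I.proj x) = S x" if "x \<in> carrier H" for x
    unfolding S'_def
  proof (rule I.the_elem_image_proj[OF _ algebra_homD(1)[OF S] _ that])
    show "module K (opposite_algebra I.Q)"
      by (rule unital_algebra_module[OF unital_algebra_opposite[OF I.unital_algebra_quotient]])
    show "S x = \<zero>\<^bsub>opposite_algebra I.Q\<^esub>" if "x \<in> I" for x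
    proof -
      have "antipode H x \<in> I" using I that by (auto simp: hopf_ideal_def)
      then show ?thesis by (simp add: S_def p_zero)
    qed
  qed
  show p_quot: "(\<lambda>x. I +>\<^bsub>H\<^esub> x) \<in> algebra_hom K H (quotient_hopf K H I)"
    unfolding quotient by (intro algebra_homI linear_homI) (simp_all add: algebra_homD[OF p])
  note pD = algebra_homD[OF p_quot]
  note gens = H.gen_closed
  show "axb_hopf K (quotient_hopf K H I) (I.proj a) (I.proj a') (I.proj b)"
  proof (intro axb_hopf.intro axb_hopf_axioms.intro)
    show "unital_algebra K (quotient_hopf K H I)"
      unfolding quotient by (rule unital_algebra_extend[OF I.unital_algebra_quotient])
    show "I.proj a \<in> carrier (quotient_hopf K H I)" "I.proj a' \<in> carrier (quotient_hopf K H I)"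
      "I.proj b \<in> carrier (quotient_hopf K H I)" using gens by (simp_all add: pD)
    show "I.proj a \<otimes>\<^bsub>quotient_hopf K H I\<^esub> I.proj a' = \<one>\<^bsub>quotient_hopf K H I\<^esub>"
      "I.proj a' \<otimes>\<^bsub>quotient_hopf K H I\<^esub> I.proj a = \<one>\<^bsub>quotient_hopf K H I\<^esub>"
      using gens by (simp_all add: pD(6,7)[symmetric] H.gen_inverse)
    show "carrier (quotient_hopf K H I) \<subseteq>
        generated_subalgebra K (quotient_hopf K H I) {I.proj a, I.proj a', I.proj b}"
    proof
      fix X assume "X \<in> carrier (quotient_hopf K H I)"
      then obtain x where x: "x \<in> carrier H" "X = I.proj x"
        by (auto simp: quotient I.quotient_algebra_carrier)
      then have "x \<in> generated_subalgebra K H {a, a', b}" using H.generated by auto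
      from generated_subalgebra_image[OF H.unital_algebra_axioms _ p_quot this]
      show "X \<in> generated_subalgebra K (quotient_hopf K H I) {I.proj a, I.proj a', I.proj b}"
        using gens by (simp add: x)
    qed
    show "comult (quotient_hopf K H I) \<in>
        algebra_hom K (quotient_hopf K H I) (tensor K (quotient_hopf K H I) (quotient_hopf K H I))"
      \<comment> \<open>The quotient Hopf algebra and \<open>I.Q\<close> share their algebra
        operations, so the statement transfers once the notion of homomorphism is unfolded.\<close>
      using I.quotient_algebra_hom[OF \<Delta> \<Delta>']
      by (simp add: quotient algebra_hom_def ring_hom_def linear_hom_def)
    show "counit (quotient_hopf K H I) \<in> algebra_hom K (quotient_hopf K H I) (base_algebra K)"
      using I.quotient_algebra_hom[OF H.counit_algebra_hom \<epsilon>']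
      by (simp add: quotient algebra_hom_def ring_hom_def linear_hom_def)
    show "antipode (quotient_hopf K H I) \<in>
        algebra_hom K (quotient_hopf K H I) (opposite_algebra (quotient_hopf K H I))"
      using I.quotient_algebra_hom[OF S S']
      by (simp add: quotient algebra_hom_def ring_hom_def linear_hom_def)
    note simps = quotient \<Delta>' \<epsilon>' S' \<Delta>_def S_def gens H.comult_gen H.counit_gen H.antipode_gen
      pp_linear(2) algebra_homD(4)[OF pp] I.quotient_algebra_one
    show "comult (quotient_hopf K H I) (I.proj a) =
        pure_tensor K (quotient_hopf K H I) (quotient_hopf K H I) (I.proj a) (I.proj a)"
      "comult (quotient_hopf K H I) (I.proj a') =
        pure_tensor K (quotient_hopf K H I) (quotient_hopf K H I) (I.proj a') (I.proj a')"
      "comult (quotient_hopf K H I) (I.proj b) =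
        pure_tensor K (quotient_hopf K H I) (quotient_hopf K H I) (I.proj b) (I.proj a)
          \<oplus>\<^bsub>tensor K (quotient_hopf K H I) (quotient_hopf K H I)\<^esub>
        pure_tensor K (quotient_hopf K H I) (quotient_hopf K H I) \<one>\<^bsub>quotient_hopf K H I\<^esub> (I.proj b)"
      "counit (quotient_hopf K H I) (I.proj a) = \<one>\<^bsub>K\<^esub>"
      "counit (quotient_hopf K H I) (I.proj a') = \<one>\<^bsub>K\<^esub>"
      "counit (quotient_hopf K H I) (I.proj b) = \<zero>\<^bsub>K\<^esub>"
      "antipode (quotient_hopf K H I) (I.proj a) = I.proj a'"
      "antipode (quotient_hopf K H I) (I.proj a') = I.proj a"
      by (simp_all add: simps)
    have "antipode (quotient_hopf K H I) (I.proj b) = I.proj (\<ominus>\<^bsub>H\<^esub> (b \<otimes>\<^bsub>H\<^esub> a'))"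
      by (simp add: simps)
    also have "\<dots> = \<ominus>\<^bsub>quotient_hopf K H I\<^esub> I.proj (b \<otimes>\<^bsub>H\<^esub> a')"
      by (rule linear_hom_neg[OF H.module_axioms _ pD(1)])
        (use gens in \<open>simp_all add: quotient unital_algebra_module[OF
            unital_algebra_extend[OF I.unital_algebra_quotient]]\<close>)
    also have "I.proj (b \<otimes>\<^bsub>H\<^esub> a') = I.proj b \<otimes>\<^bsub>quotient_hopf K H I\<^esub> I.proj a'"
      using gens by (simp add: pD(6))
    finally show "antipode (quotient_hopf K H I) (I.proj b) =
        \<ominus>\<^bsub>quotient_hopf K H I\<^esub> (I.proj b \<otimes>\<^bsub>quotient_hopf K H I\<^esub> I.proj a')" .
  qed
qed

section \<open>Integer powers and the ideal of the relation \<open>a\<^sup>n b = q b a\<^sup>n\<close>\<close>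

lemma (in abelian_group) minus_eq_zero_iff:
  assumes "x \<in> carrier G" and "y \<in> carrier G"
  shows "x \<ominus> y = \<zero> \<longleftrightarrow> x = y"
proof
  assume "x \<ominus> y = \<zero>"
  then have "\<ominus> (\<ominus> y) = x" using assms by (intro minus_equality) (simp_all add: a_minus_def)
  then show "x = y" using assms by simp
qed (simp add: assms a_minus_def r_neg)

lemma (in monoid) nat_pow_Units:
  "u \<in> Units G \<Longrightarrow> u [^] (n :: nat) \<in> Units G"
  by (induction n) simp_all

text \<open>Powers of a unit can be taken in the group of units, through which the group laws for
  integer exponents become available in a monoid.\<close>

lemma (in monoid) units_of_int_pow:
  assumes "u \<in> Units G"
  shows "u [^]\<^bsub>units_of G\<^esub> (n :: int) = u [^] n"
  unfolding int_pow_def2 using assms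
  by (simp add: units_of_pow units_of_inv nat_pow_Units del: pow_nat)

lemma (in monoid) Units_int_pow_closed [simp, intro]:
  assumes "u \<in> Units G"
  shows "u [^] (n :: int) \<in> Units G"
  using group.int_pow_closed[OF units_group, of u n] assms
  by (simp add: units_of_int_pow units_of_carrier)

lemma (in monoid) Units_int_pow_carrier [simp, intro]:
  "u \<in> Units G \<Longrightarrow> u [^] (n :: int) \<in> carrier G"
  by (rule Units_closed) (rule Units_int_pow_closed)

lemma (in monoid) Units_int_pow_add:
  assumes "u \<in> Units G"
  shows "u [^] (m + n :: int) = u [^] m \<otimes> u [^] n"
  using group.int_pow_mult[OF units_group, of u m n] assms
  by (simp add: units_of_int_pow units_of_carrier units_of_mult)

lemma (in monoid) Units_int_pow_1:
  assumes "u \<in> Units G"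
  shows "u [^] (1 :: int) = u"
  using group.int_pow_1[OF units_group, of u] assms
  by (simp add: units_of_int_pow units_of_carrier)

lemma (in monoid) Units_int_pow_neg:
  assumes "u \<in> Units G"
  shows "u [^] (- n :: int) = inv (u [^] n)"
  using group.int_pow_neg[OF units_group, of u n] assms
  by (simp add: units_of_int_pow units_of_carrier units_of_inv)

lemma (in monoid) Units_int_pow_pow:
  assumes "u \<in> Units G"
  shows "(u [^] (n :: int)) [^] (m :: int) = u [^] (n * m)"
  using group.int_pow_pow[OF units_group, of u n m] assms
  by (simp add: units_of_int_pow units_of_carrier)

lemma Units_hom_int_pow:
  assumes "monoid G" and "monoid H"
    and f: "\<And>u. u \<in> Units G \<Longrightarrow> f u \<in> Units H"
    and mult: "\<And>u v. \<lbrakk>u \<in> Units G; v \<in> Units G\<rbrakk> \<Longrightarrow> f (u \<otimes>\<^bsub>G\<^esub> v) = f u \<otimes>\<^bsub>H\<^esub> f v"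
    and u: "u \<in> Units G"
  shows "f (u [^]\<^bsub>G\<^esub> (n :: int)) = f u [^]\<^bsub>H\<^esub> n"
proof -
  interpret G: monoid G by fact
  interpret H: monoid H by fact
  have "f \<in> hom (units_of G) (units_of H)"
    using f mult by (auto simp: hom_def units_of_carrier units_of_mult)
  from hom_int_pow[OF this _ G.units_group H.units_group, of u n] show ?thesis
    using u f by (simp add: units_of_carrier G.units_of_int_pow H.units_of_int_pow)
qed

lemma algebra_hom_Units:
  assumes "unital_algebra K A" and "unital_algebra K B" and f: "f \<in> algebra_hom K A B"
    and u: "u \<in> Units A"
  shows "f u \<in> Units B"
proof -
  interpret A: unital_algebra K A by fact
  obtain v where "u \<in> carrier A" "v \<in> carrier A" "v \<otimes>\<^bsub>A\<^esub> u = \<one>\<^bsub>A\<^esub>" "u \<otimes>\<^bsub>A\<^esub> v = \<one>\<^bsub>A\<^esub>"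
    using u by (auto simp: Units_def)
  then have "f u \<in> carrier B" "f v \<in> carrier B" "f v \<otimes>\<^bsub>B\<^esub> f u = \<one>\<^bsub>B\<^esub>" "f u \<otimes>\<^bsub>B\<^esub> f v = \<one>\<^bsub>B\<^esub>"
    using algebra_homD(3,6,7)[OF f] by metis+
  then show ?thesis by (auto simp: Units_def)
qed

lemma algebra_hom_int_pow:
  assumes A: "unital_algebra K A" and B: "unital_algebra K B" and f: "f \<in> algebra_hom K A B"
    and u: "u \<in> Units A"
  shows "f (u [^]\<^bsub>A\<^esub> (n :: int)) = f u [^]\<^bsub>B\<^esub> n"
proof -
  interpret A: unital_algebra K A by fact
  interpret B: unital_algebra K B by fact
  show ?thesis
    by (rule Units_hom_int_pow[OF A.A.is_monoid B.A.is_monoid _ _ u])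
      (use A.A.Units_closed in \<open>simp_all add: algebra_hom_Units[OF A B f] algebra_homD(6)[OF f]\<close>)
qed

section \<open>Commutation up to a scalar\<close>

context unital_algebra
begin

definition skew_commute
  where "skew_commute u v q \<longleftrightarrow> u \<otimes>\<^bsub>A\<^esub> v = q \<odot>\<^bsub>A\<^esub> (v \<otimes>\<^bsub>A\<^esub> u)"

lemma skew_commute_mult:
  assumes "u \<in> carrier A" "w \<in> carrier A" "v \<in> carrier A" "q \<in> carrier K" "p \<in> carrier K"
    and u: "skew_commute u v q" and w: "skew_commute w v p"
  shows "skew_commute (u \<otimes>\<^bsub>A\<^esub> w) v (q \<otimes>\<^bsub>K\<^esub> p)"
proof -
  have "(u \<otimes>\<^bsub>A\<^esub> w) \<otimes>\<^bsub>A\<^esub> v = p \<odot>\<^bsub>A\<^esub> (u \<otimes>\<^bsub>A\<^esub> (v \<otimes>\<^bsub>A\<^esub> w))"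
    using assms(1-5) w by (simp add: A.m_assoc skew_commute_def smult_mult_right)
  also have "\<dots> = p \<odot>\<^bsub>A\<^esub> ((u \<otimes>\<^bsub>A\<^esub> v) \<otimes>\<^bsub>A\<^esub> w)"
    using assms(1-5) by (simp add: A.m_assoc)
  also have "\<dots> = (p \<otimes>\<^bsub>K\<^esub> q) \<odot>\<^bsub>A\<^esub> (v \<otimes>\<^bsub>A\<^esub> (u \<otimes>\<^bsub>A\<^esub> w))"
    using assms by (simp add: A.m_assoc skew_commute_def smult_mult_left smult_assoc1)
  finally show ?thesis using assms by (simp add: skew_commute_def K.m_comm)
qed

text \<open>Multiplying u v = q v u by the inverse of \<open>u\<close> on both sides gives
  \<open>v (inv u) = q (inv u) v\<close>; dividing by \<open>q\<close> reverses the roles.\<close>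

lemma skew_commute_inv:
  assumes u: "u \<in> Units A" and v: "v \<in> carrier A" and q: "q \<in> Units K" and "skew_commute u v q"
  shows "skew_commute (inv\<^bsub>A\<^esub> u) v (inv\<^bsub>K\<^esub> q)"
proof -
  let ?u = "inv\<^bsub>A\<^esub> u"
  have c: "u \<in> carrier A" "?u \<in> carrier A" "q \<in> carrier K" "inv\<^bsub>K\<^esub> q \<in> carrier K"
    using u q by auto
  have "v \<otimes>\<^bsub>A\<^esub> ?u = ?u \<otimes>\<^bsub>A\<^esub> (u \<otimes>\<^bsub>A\<^esub> v) \<otimes>\<^bsub>A\<^esub> ?u"
    using u v c by (simp add: A.m_assoc[symmetric])
  also have "\<dots> = q \<odot>\<^bsub>A\<^esub> (?u \<otimes>\<^bsub>A\<^esub> v \<otimes>\<^bsub>A\<^esub> (u \<otimes>\<^bsub>A\<^esub> ?u))"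
    using assms(4) v c by (simp add: skew_commute_def smult_mult_left smult_mult_right A.m_assoc)
  also have "\<dots> = q \<odot>\<^bsub>A\<^esub> (?u \<otimes>\<^bsub>A\<^esub> v)" using u v c by simp
  finally have "inv\<^bsub>K\<^esub> q \<odot>\<^bsub>A\<^esub> (v \<otimes>\<^bsub>A\<^esub> ?u) = ?u \<otimes>\<^bsub>A\<^esub> v"
    using q v c by (simp add: smult_assoc1[symmetric])
  then show ?thesis by (simp add: skew_commute_def)
qed

text \<open>Induction away from 0 in both directions: each step multiplies by \<open>u\<close> or by
  its inverse, and the scalars multiply accordingly.\<close>

lemma skew_commute_int_pow:
  assumes u: "u \<in> Units A" and v: "v \<in> carrier A" and q: "q \<in> Units K" and uv: "skew_commute u v q"
  shows "skew_commute (u [^]\<^bsub>A\<^esub> (m :: int)) v (q [^]\<^bsub>K\<^esub> m)"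
proof (induction m rule: int_induct[where k = 0])
  case base
  then show ?case using v by (simp add: skew_commute_def)
next
  case (step1 i)
  show ?case
    unfolding A.Units_int_pow_add[OF u] K.Units_int_pow_add[OF q] A.Units_int_pow_1[OF u] K.Units_int_pow_1[OF q]
    by (rule skew_commute_mult) (use u v q uv step1 in auto)
next
  case (step2 i)
  have "i - 1 = i + (- 1)" by simp
  then show ?case
    unfolding \<open>i - 1 = _\<close> A.Units_int_pow_add[OF u] K.Units_int_pow_add[OF q]
      A.Units_int_pow_neg[OF u] K.Units_int_pow_neg[OF q] A.Units_int_pow_1[OF u] K.Units_int_pow_1[OF q]
    by (intro skew_commute_mult) (use u v q step2 skew_commute_inv[OF u v q uv] in auto)
qed

end

section \<open>Powers of the grouplike generator and the relator\<close>

context axb_hopf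
begin

lemma a_Units: "a \<in> Units H" and inv_a: "inv\<^bsub>H\<^esub> a = a'"
  using gen_closed gen_inverse by (auto simp: Units_def intro: A.inv_char)

text \<open>The diagonal map u \<mapsto> u \<otimes> u is multiplicative on units and preserves
  them, so it commutes with integer powers, as does \<Delta>; the two agree on
  \<open>a\<close>.\<close>

lemma comult_a_pow: "comult H (a [^]\<^bsub>H\<^esub> (n :: int)) = (a [^]\<^bsub>H\<^esub> n) \<otimes>\<^sub>t (a [^]\<^bsub>H\<^esub> n)"
proof -
  have "u \<otimes>\<^sub>t u \<in> Units T" if u: "u \<in> Units H" for u
  proof -
    have "(inv\<^bsub>H\<^esub> u \<otimes>\<^sub>t inv\<^bsub>H\<^esub> u) \<otimes>\<^bsub>T\<^esub> (u \<otimes>\<^sub>t u) = \<one>\<^bsub>T\<^esub>" "(u \<otimes>\<^sub>t u) \<otimes>\<^bsub>T\<^esub> (inv\<^bsub>H\<^esub> u \<otimes>\<^sub>t inv\<^bsub>H\<^esub> u) = \<one>\<^bsub>T\<^esub>"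
      using u by (simp_all add: T.pure_mult T.pure_one A.Units_closed)
    moreover have "u \<otimes>\<^sub>t u \<in> carrier T" "inv\<^bsub>H\<^esub> u \<otimes>\<^sub>t inv\<^bsub>H\<^esub> u \<in> carrier T"
      using u by (simp_all add: A.Units_closed)
    ultimately show ?thesis unfolding Units_def by blast
  qed
  then have "(a [^]\<^bsub>H\<^esub> n) \<otimes>\<^sub>t (a [^]\<^bsub>H\<^esub> n) = (a \<otimes>\<^sub>t a) [^]\<^bsub>T\<^esub> n"
    by (intro Units_hom_int_pow[of H T "\<lambda>u. u \<otimes>\<^sub>t u"])
      (simp_all add: A.is_monoid T.T.A.is_monoid a_Units T.pure_mult A.Units_closed)
  then show ?thesis
    using algebra_hom_int_pow[OF unital_algebra_axioms T.unital_algebra_tensor comult_algebra_hom a_Units]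
    by (simp add: comult_gen)
qed

lemma counit_a_pow: "counit H (a [^]\<^bsub>H\<^esub> (n :: int)) = \<one>"
proof -
  have B: "unital_algebra K (base_algebra K)" by (rule unital_algebra_base[OF K.field_axioms])
  then interpret B: unital_algebra K "base_algebra K" .
  \<comment> \<open>The power is taken in the record \<open>base_algebra K\<close>, hence the
    passage through its own group of units.\<close>
  have "\<one>\<^bsub>base_algebra K\<^esub> [^]\<^bsub>base_algebra K\<^esub> n = \<one>\<^bsub>base_algebra K\<^esub>"
    using group.int_pow_one[OF B.A.units_group, of n] B.A.units_of_int_pow[OF B.A.Units_one_closed, of n]
    by (simp add: units_of_one)
  then show ?thesis
    using algebra_hom_int_pow[OF unital_algebra_axioms B counit_algebra_hom a_Units, of n]
    by (simp add: counit_gen)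
qed

text \<open>For grouplike c with counit 1 the left antipode axiom reads S(c) c = 1, which identifies
  S(c) with the inverse. No powers in the opposite algebra have to be computed.\<close>

lemma antipode_a_pow: "antipode H (a [^]\<^bsub>H\<^esub> (n :: int)) = a [^]\<^bsub>H\<^esub> (- n)"
proof -
  let ?c = "a [^]\<^bsub>H\<^esub> n"
  have u: "?c \<in> Units H" and c: "?c \<in> carrier H" using a_Units by auto
  have Sc: "antipode H ?c \<in> carrier H" using c by (rule antipodeD)
  have "antipode H ?c \<otimes>\<^bsub>H\<^esub> ?c = \<one>\<^bsub>H\<^esub>"
    using antipodal_left[OF c] c
    by (simp add: comult_a_pow counit_a_pow T.tensor_lift_pure[OF module_axioms antipode_bilinear_left])
  then have "antipode H ?c = inv\<^bsub>H\<^esub> ?c"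
    using A.inv_unique[of "antipode H ?c" ?c "inv\<^bsub>H\<^esub> ?c"] u c Sc by simp
  then show ?thesis by (simp add: A.Units_int_pow_neg[OF a_Units])
qed

abbreviation skew_relator
  where "skew_relator q (n :: int) \<equiv>
    (a [^]\<^bsub>H\<^esub> n) \<otimes>\<^bsub>H\<^esub> b \<ominus>\<^bsub>H\<^esub> q \<odot>\<^bsub>H\<^esub> (b \<otimes>\<^bsub>H\<^esub> (a [^]\<^bsub>H\<^esub> n))"

lemma skew_relator_closed: "q \<in> carrier K \<Longrightarrow> skew_relator q n \<in> carrier H"
  using a_Units gen_closed by (auto intro!: A.minus_closed)

text \<open>Bridge between the ideal and the relation it imposes. One direction reads off the
  relation in a quotient, the other kills the relator of a power.\<close>

lemma algebra_hom_skew_relator: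
  assumes B: "unital_algebra K B" and f: "f \<in> algebra_hom K H B" and q: "q \<in> carrier K"
  shows "f (skew_relator q n) = \<zero>\<^bsub>B\<^esub> \<longleftrightarrow>
    unital_algebra.skew_commute B (f a [^]\<^bsub>B\<^esub> n) (f b) q"
proof -
  interpret B: unital_algebra K B by (rule B)
  have c: "a [^]\<^bsub>H\<^esub> n \<in> carrier H" using a_Units by simp
  have fc: "f (a [^]\<^bsub>H\<^esub> n) = f a [^]\<^bsub>B\<^esub> n"
    by (rule algebra_hom_int_pow[OF unital_algebra_axioms B f a_Units])
  have fcl: "f a [^]\<^bsub>B\<^esub> n \<in> carrier B" using algebra_homD(3)[OF f c] by (simp add: fc)
  have fb: "f b \<in> carrier B" using gen_closed by (simp add: algebra_homD(3)[OF f])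
  have "f (skew_relator q n) =
      (f a [^]\<^bsub>B\<^esub> n) \<otimes>\<^bsub>B\<^esub> f b \<ominus>\<^bsub>B\<^esub> q \<odot>\<^bsub>B\<^esub> (f b \<otimes>\<^bsub>B\<^esub> (f a [^]\<^bsub>B\<^esub> n))"
    using c q gen_closed
    by (simp add: linear_hom_minus[OF module_axioms B.module_axioms algebra_homD(1)[OF f]]
        algebra_homD(5,6)[OF f] fc)
  then show ?thesis
    using fcl fb q by (simp add: B.skew_commute_def B.A.minus_eq_zero_iff)
qed

text \<open>With c = a^n, \<Delta>(c b) = c b \<otimes> c a + c \<otimes> c b and \<Delta>(b c) = b
  c \<otimes> a c + c \<otimes> b c. As c a = a c, the first terms share their second leg, the
  second terms their first leg, and bilinearity collects the relator in each pair.\<close>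

lemma comult_skew_relator:
  assumes q: "q \<in> carrier K"
  shows "comult H (skew_relator q n) =
    skew_relator q n \<otimes>\<^sub>t (a \<otimes>\<^bsub>H\<^esub> (a [^]\<^bsub>H\<^esub> n)) \<oplus>\<^bsub>T\<^esub> (a [^]\<^bsub>H\<^esub> n) \<otimes>\<^sub>t skew_relator q n"
proof -
  let ?c = "a [^]\<^bsub>H\<^esub> n"
  have c: "?c \<in> carrier H" using a_Units by simp
  have comm: "?c \<otimes>\<^bsub>H\<^esub> a = a \<otimes>\<^bsub>H\<^esub> ?c"
    using A.Units_int_pow_add[OF a_Units, of n 1] A.Units_int_pow_add[OF a_Units, of 1 n]
    by (simp add: A.Units_int_pow_1[OF a_Units] add.commute)
  note cl = q c gen_closed
  have left: "comult H (?c \<otimes>\<^bsub>H\<^esub> b) =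
      (?c \<otimes>\<^bsub>H\<^esub> b) \<otimes>\<^sub>t (a \<otimes>\<^bsub>H\<^esub> ?c) \<oplus>\<^bsub>T\<^esub> ?c \<otimes>\<^sub>t (?c \<otimes>\<^bsub>H\<^esub> b)"
    using cl by (simp add: comultD(6) comult_a_pow comult_gen T.T.A.r_distr T.pure_mult comm)
  have right: "comult H (b \<otimes>\<^bsub>H\<^esub> ?c) =
      (b \<otimes>\<^bsub>H\<^esub> ?c) \<otimes>\<^sub>t (a \<otimes>\<^bsub>H\<^esub> ?c) \<oplus>\<^bsub>T\<^esub> ?c \<otimes>\<^sub>t (b \<otimes>\<^bsub>H\<^esub> ?c)"
    using cl by (simp add: comultD(6) comult_a_pow comult_gen T.T.A.l_distr T.pure_mult)
  note minus = linear_hom_minus[OF module_axioms T.T.module_axioms]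
  have "comult H (skew_relator q n) =
      comult H (?c \<otimes>\<^bsub>H\<^esub> b) \<ominus>\<^bsub>T\<^esub> q \<odot>\<^bsub>T\<^esub> comult H (b \<otimes>\<^bsub>H\<^esub> ?c)"
    using cl by (simp add: minus[OF comultD(1)] comultD(5))
  also have "\<dots> = ((?c \<otimes>\<^bsub>H\<^esub> b) \<otimes>\<^sub>t (a \<otimes>\<^bsub>H\<^esub> ?c) \<ominus>\<^bsub>T\<^esub> q \<odot>\<^bsub>T\<^esub> ((b \<otimes>\<^bsub>H\<^esub> ?c) \<otimes>\<^sub>t (a \<otimes>\<^bsub>H\<^esub> ?c)))
      \<oplus>\<^bsub>T\<^esub> (?c \<otimes>\<^sub>t (?c \<otimes>\<^bsub>H\<^esub> b) \<ominus>\<^bsub>T\<^esub> q \<odot>\<^bsub>T\<^esub> (?c \<otimes>\<^sub>t (b \<otimes>\<^bsub>H\<^esub> ?c)))"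
    using cl by (simp add: left right a_minus_def T.T.smult_r_distr T.T.A.minus_add T.T.A.a_ac)
  also have "(?c \<otimes>\<^bsub>H\<^esub> b) \<otimes>\<^sub>t (a \<otimes>\<^bsub>H\<^esub> ?c) \<ominus>\<^bsub>T\<^esub> q \<odot>\<^bsub>T\<^esub> ((b \<otimes>\<^bsub>H\<^esub> ?c) \<otimes>\<^sub>t (a \<otimes>\<^bsub>H\<^esub> ?c))
      = skew_relator q n \<otimes>\<^sub>t (a \<otimes>\<^bsub>H\<^esub> ?c)"
    using cl by (simp add: minus[OF bilinear_mapD(2)[OF T.pure_bilinear]] T.pure_simps)
  also have "?c \<otimes>\<^sub>t (?c \<otimes>\<^bsub>H\<^esub> b) \<ominus>\<^bsub>T\<^esub> q \<odot>\<^bsub>T\<^esub> (?c \<otimes>\<^sub>t (b \<otimes>\<^bsub>H\<^esub> ?c)) = ?c \<otimes>\<^sub>t skew_relator q n"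
    using cl by (simp add: minus[OF bilinear_mapD(1)[OF T.pure_bilinear]] T.pure_simps)
  finally show ?thesis .
qed

text \<open>S reverses products: with d = c^-1, S(c b) = -b a' d and S(b c) = -d b a'. Multiplying
  the relator by d on the left and by a' d on the right yields the same two monomials with opposite
  sign.\<close>

lemma antipode_skew_relator:
  assumes q: "q \<in> carrier K"
  shows "antipode H (skew_relator q n) =
    \<ominus>\<^bsub>H\<^esub> ((a [^]\<^bsub>H\<^esub> (- n)) \<otimes>\<^bsub>H\<^esub> skew_relator q n \<otimes>\<^bsub>H\<^esub> (a' \<otimes>\<^bsub>H\<^esub> (a [^]\<^bsub>H\<^esub> (- n))))"
proof -
  let ?c = "a [^]\<^bsub>H\<^esub> n" and ?d = "a [^]\<^bsub>H\<^esub> (- n)"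
  let ?x = "b \<otimes>\<^bsub>H\<^esub> (a' \<otimes>\<^bsub>H\<^esub> ?d)" and ?y = "q \<odot>\<^bsub>H\<^esub> (?d \<otimes>\<^bsub>H\<^esub> (b \<otimes>\<^bsub>H\<^esub> a'))"
  have c: "?c \<in> carrier H" "?d \<in> carrier H" using a_Units by simp_all
  note cl = q c gen_closed
  have dc: "?d \<otimes>\<^bsub>H\<^esub> ?c = \<one>\<^bsub>H\<^esub>"
    using A.Units_int_pow_add[OF a_Units, of "- n" n] by simp
  have a': "a [^]\<^bsub>H\<^esub> (- 1 :: int) = a'"
    using A.Units_int_pow_neg[OF a_Units, of 1] by (simp add: A.Units_int_pow_1[OF a_Units] inv_a)
  \<comment> \<open>All factors are powers of \<open>a\<close>, and the exponents n, -1 and -n add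
    up to -1.\<close>
  have ca'd: "?c \<otimes>\<^bsub>H\<^esub> (a' \<otimes>\<^bsub>H\<^esub> ?d) = a'"
    using A.Units_int_pow_add[OF a_Units, of "- 1" "- n"] A.Units_int_pow_add[OF a_Units, of n "- 1 + - n"]
    by (simp add: a')
  have dcb: "?d \<otimes>\<^bsub>H\<^esub> (?c \<otimes>\<^bsub>H\<^esub> b) = b"
    using cl by (simp add: A.m_assoc[symmetric] dc)
  have "?d \<otimes>\<^bsub>H\<^esub> skew_relator q n \<otimes>\<^bsub>H\<^esub> (a' \<otimes>\<^bsub>H\<^esub> ?d) = ?x \<ominus>\<^bsub>H\<^esub> ?y"
    using cl by (simp add: a_minus_def A.r_distr A.l_distr A.r_minus A.l_minus dcb
        smult_mult_left smult_mult_right A.m_assoc ca'd)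
  moreover have "antipode H (skew_relator q n) = \<ominus>\<^bsub>H\<^esub> ?x \<ominus>\<^bsub>H\<^esub> (\<ominus>\<^bsub>H\<^esub> ?y)"
    using cl by (simp add: linear_hom_minus[OF module_axioms module_axioms antipode_linear_hom]
        antipodeD antipode_a_pow antipode_gen A.l_minus A.r_minus A.m_assoc smult_r_minus)
  ultimately show ?thesis
    using cl by (simp add: a_minus_def A.minus_add)
qed

text \<open>Each condition is membership in an ideal, or vanishing, of the image under a structure
  map. Composing with the quotient by that ideal makes it the vanishing of a homomorphism on
  \<open>I\<close>, which \<open>kill\<close> reduces to the relator.\<close>

lemma hopf_ideal_skew_relator:
  assumes q: "q \<in> carrier K"
  shows "hopf_ideal K H (Idl\<^bsub>H\<^esub> {skew_relator q n})"
proof -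
  let ?r = "skew_relator q n"
  define I where "I = Idl\<^bsub>H\<^esub> {?r}"
  have r: "?r \<in> carrier H" by (rule skew_relator_closed[OF q])
  have c: "a [^]\<^bsub>H\<^esub> n \<in> carrier H" "a [^]\<^bsub>H\<^esub> (- n) \<in> carrier H" using a_Units by simp_all
  have I: "ideal I H" unfolding I_def by (rule A.genideal_ideal) (simp add: r)
  have rI: "?r \<in> I" unfolding I_def by (rule A.genideal_self'[OF r])
  interpret I: algebra_ideal K H I by (intro algebra_ideal.intro unital_algebra_axioms I)
  have kill: "f x = \<zero>\<^bsub>B\<^esub>"
    if "unital_algebra K B" "f \<in> algebra_hom K H B" "f ?r = \<zero>\<^bsub>B\<^esub>" "x \<in> I"
    for B :: "('k, 'c, 'd) module_scheme" and f x
    by (rule algebra_hom_idl_zero[OF unital_algebra_axioms that(1,2) _ _ that(4)[unfolded I_def]])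
      (use r that(3) in auto)

  let ?L = "tensor_subspace K H H I (carrier H)" and ?R = "tensor_subspace K H H (carrier H) I"
  \<comment> \<open>Both summands are ideals of the tensor square, hence so is their sum, and its
    quotient algebra is the target against which \<Delta> is tested.\<close>
  interpret J: algebra_ideal K T "?L <+>\<^bsub>T\<^esub> ?R"
    by (intro algebra_ideal.intro T.unital_algebra_tensor T.T.A.add_ideals
        T.tensor_subspace_ideal I A.oneideal)
  have "?r \<otimes>\<^sub>t (a \<otimes>\<^bsub>H\<^esub> (a [^]\<^bsub>H\<^esub> n)) \<in> ?L"
    unfolding tensor_subspace_def by (rule submodule_spanI) (use rI c gen_closed in blast)
  moreover have "(a [^]\<^bsub>H\<^esub> n) \<otimes>\<^sub>t ?r \<in> ?R"
    unfolding tensor_subspace_def by (rule submodule_spanI) (use rI c in blast)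
  ultimately have "comult H ?r \<in> ?L <+>\<^bsub>T\<^esub> ?R"
    unfolding comult_skew_relator[OF q] set_add_def' by blast
  then have "J.proj (comult H ?r) = \<zero>\<^bsub>J.Q\<^esub>"
    unfolding J.quotient_algebra_zero by (rule T.T.A.a_rcos_zero[OF J.ideal_axioms])
  then have J_zero: "J.proj (comult H x) = \<zero>\<^bsub>J.Q\<^esub>" if "x \<in> I" for x
    by (rule kill[OF J.unital_algebra_quotient algebra_hom_comp[OF comult_algebra_hom J.proj_algebra_hom] _ that])
  have comult: "comult H x \<in> ?L <+>\<^bsub>T\<^esub> ?R" if "x \<in> I" for x
    using J_zero[OF that] J.proj_eq_zero_iff[OF comultD(3)[OF I.Icarr[OF that]]]
    unfolding J.quotient_algebra_zero by (rule iffD1[rotated])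

  interpret B: unital_algebra K "base_algebra K" by (rule unital_algebra_base[OF K.field_axioms])
  \<comment> \<open>Both monomials of the relator contain \<open>b\<close>, where the counit
    vanishes.\<close>
  have "counit H ?r = \<zero>\<^bsub>base_algebra K\<^esub>"
    using q c gen_closed
    by (simp add: linear_hom_minus[OF module_axioms B.module_axioms counitD(1)]
        B.A.minus_eq_zero_iff[simplified] counitD counit_gen)
  then have counit: "counit H x = \<zero>" if "x \<in> I" for x
    using kill[OF unital_algebra_base[OF K.field_axioms] counit_algebra_hom _ that] by simp

  \<comment> \<open>S is an antihomomorphism, so the test for S(I) takes place in the opposite
    algebra of H/I.\<close>
  have "I.proj \<in> algebra_hom K (opposite_algebra H) (opposite_algebra I.Q)"
    by (rule algebra_hom_opposite[OF I.proj_algebra_hom])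
  note S = algebra_hom_comp[OF antipode_algebra_hom this]
  have "antipode H ?r \<in> I"
    unfolding antipode_skew_relator[OF q]
    using rI c gen_closed by (simp add: I.I_l_closed I.I_r_closed)
  then have "I.proj (antipode H ?r) = \<zero>\<^bsub>opposite_algebra I.Q\<^esub>"
    unfolding opposite_algebra_simps I.quotient_algebra_zero by (rule A.a_rcos_zero[OF I])
  then have S_zero: "I.proj (antipode H x) = \<zero>\<^bsub>opposite_algebra I.Q\<^esub>" if "x \<in> I" for x
    by (rule kill[OF unital_algebra_opposite[OF I.unital_algebra_quotient] S _ that])
  have antipode: "antipode H x \<in> I" if "x \<in> I" for x
    using S_zero[OF that] I.proj_eq_zero_iff[OF antipodeD(1)[OF I.Icarr[OF that]]]
    unfolding opposite_algebra_simps I.quotient_algebra_zero by (rule iffD1[rotated])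

  show ?thesis
    unfolding hopf_ideal_def I_def[symmetric]
    using hopf_algebra I comult counit antipode by blast
qed

end

section \<open>The universal group and its quotients\<close>

context
  fixes K :: "('k, 'n) ring_scheme" (structure)
  assumes K: "field K"
begin

interpretation A: unital_algebra K "axb_algebra K" by (rule unital_algebra_axb_algebra[OF K])
interpretation AA: tensor_pair K "axb_algebra K" "axb_algebra K"
  by (intro tensor_pairI A.unital_algebra_axioms)

text \<open>The universal property is used with three targets: the tensor square, the ground field
  and the opposite algebra. In each, the prescribed values at \<open>a\<close> and its inverse are
  mutually inverse, which is all the presentation demands.\<close>

lemma axb_hopf_axb: "axb_hopf K (axb K) (axb_a K) (axb_a_inv K) (axb_b K)"
proof -
  note gen = axb_gen_closed[OF K] and inv = axb_algebra_inverse[OF K]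
  have "axb_comult_gen K l \<in> carrier AA.T" for l
    by (cases l) (simp_all add: axb_comult_gen_def Let_def gen)
  note comult = axb_lift_algebra_hom[where g = "axb_comult_gen K", OF K AA.unital_algebra_tensor this]
  have "axb_counit_gen K l \<in> carrier (base_algebra K)" for l
    by (cases l) (simp_all add: axb_counit_gen_def)
  note counit = axb_lift_algebra_hom[where g = "axb_counit_gen K", OF K unital_algebra_base[OF K] this]
  have "axb_antipode_gen K l \<in> carrier (opposite_algebra (axb_algebra K))" for l
    by (cases l) (simp_all add: axb_antipode_gen_def Let_def gen)
  note antipode = axb_lift_algebra_hom[where g = "axb_antipode_gen K",
      OF K unital_algebra_opposite[OF A.unital_algebra_axioms] this]
  have letters: "range (axb_gen K) = {axb_a K, axb_a_inv K, axb_b K}"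
  proof -
    have "UNIV = {Letter_a, Letter_a_inv, Letter_b}" using axb_letter.exhaust by blast
    then show ?thesis by (metis image_empty image_insert)
  qed
  have alg: "unital_algebra K (axb K)"
    by (simp add: axb_def Let_def unital_algebra_extend A.unital_algebra_axioms)
  have generated: "carrier (axb K) \<subseteq> generated_subalgebra K (axb K) {axb_a K, axb_a_inv K, axb_b K}"
  proof
    fix x assume "x \<in> carrier (axb K)"
    then have x: "x \<in> generated_subalgebra K (axb_algebra K) (range (axb_gen K))"
      using axb_algebra_generated[OF K] by (auto simp: axb_def Let_def)
    \<comment> \<open>\<open>axb K\<close> is a different record with the same operations; the
      identity map transfers generation to it.\<close>
    have "(\<lambda>x. x) \<in> algebra_hom K (axb_algebra K) (axb K)"
      by (intro algebra_homI linear_homI) (simp_all add: axb_def Let_def)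
    from generated_subalgebra_image[OF A.unital_algebra_axioms _ this x]
    show "x \<in> generated_subalgebra K (axb K) {axb_a K, axb_a_inv K, axb_b K}"
      using gen by (auto simp: letters)
  qed
  have comult_hom: "comult (axb K) \<in> algebra_hom K (axb K) (tensor K (axb K) (axb K))"
    using comult(1) by (simp add: axb_def Let_def axb_comult_gen_def AA.pure_mult gen inv AA.pure_one
        algebra_hom_def ring_hom_def linear_hom_def)
  have counit_hom: "counit (axb K) \<in> algebra_hom K (axb K) (base_algebra K)"
    using counit(1) by (simp add: axb_def Let_def axb_counit_gen_def
        algebra_hom_def ring_hom_def linear_hom_def)
  have antipode_hom: "antipode (axb K) \<in> algebra_hom K (axb K) (opposite_algebra (axb K))"
    using antipode(1) by (simp add: axb_def Let_def axb_antipode_gen_def inv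
        algebra_hom_def ring_hom_def linear_hom_def)
  show ?thesis
  proof (intro axb_hopf.intro axb_hopf_axioms.intro alg generated comult_hom counit_hom antipode_hom)
    show "antipode (axb K) (axb_b K) = \<ominus>\<^bsub>axb K\<^esub> (axb_b K \<otimes>\<^bsub>axb K\<^esub> axb_a_inv K)"
      using antipode(2)
      \<comment> \<open>Negation takes the whole record as argument, so it is unfolded down to the
        fields that \<open>axb K\<close> shares with \<open>axb_algebra K\<close>.\<close>
      by (simp add: axb_def Let_def axb_antipode_gen_def inv a_inv_def m_inv_def)
  qed (use comult(2) counit(2) antipode(2) in \<open>simp_all add: axb_def Let_def gen inv
      axb_comult_gen_def axb_counit_gen_def axb_antipode_gen_def AA.pure_mult AA.pure_one\<close>)
qed

interpretation H: axb_hopf K "axb K" "axb_a K" "axb_a_inv K" "axb_b K" by (rule axb_hopf_axb)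

lemma axb_ideal_eq: "axb_ideal K q n = Idl\<^bsub>axb K\<^esub> {H.skew_relator q n}"
  by (simp add: axb_ideal_def Let_def)

lemma hopf_ideal_axb_ideal: "q \<in> carrier K \<Longrightarrow> hopf_ideal K (axb K) (axb_ideal K q n)"
  unfolding axb_ideal_eq by (rule H.hopf_ideal_skew_relator)

lemma axb_hopf_axb_quot:
  assumes "q \<in> carrier K"
  shows "axb_hopf K (axb_quot K q n)
      (axb_class K q n (axb_a K)) (axb_class K q n (axb_a_inv K)) (axb_class K q n (axb_b K))"
    and "axb_class K q n \<in> algebra_hom K (axb K) (axb_quot K q n)"
  using axb_hopf_quotient[OF axb_hopf_axb hopf_ideal_axb_ideal[OF assms]]
  unfolding axb_quot_def axb_class_def[abs_def] .

lemma axb_class_surj_hopf_hom: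
  assumes "q \<in> carrier K"
  shows "axb_class K q n \<in> surj_hopf_hom K (axb K) (axb_quot K q n)"
  by (rule surj_hopf_homI[OF axb_hopf_axb axb_hopf_axb_quot[OF assms]]) simp_all

text \<open>The projection onto the quotient for q and n is a homomorphism on the universal algebra,
  so only the single generator of the other ideal has to be tested.\<close>

lemma axb_class_zero:
  assumes q: "q \<in> Units K" and x: "x \<in> axb_ideal K (q [^] (m :: int)) (m * n)"
  shows "axb_class K q n x = \<zero>\<^bsub>axb_quot K q n\<^esub>"
proof -
  have qc: "q \<in> carrier K" and qm: "q [^] m \<in> carrier K" using q by auto
  interpret Q: axb_hopf K "axb_quot K q n" "axb_class K q n (axb_a K)"
    "axb_class K q n (axb_a_inv K)" "axb_class K q n (axb_b K)"
    by (rule axb_hopf_axb_quot(1)[OF qc])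
  note p = axb_hopf_axb_quot(2)[OF qc, of n]
  interpret I: algebra_ideal K "axb K" "axb_ideal K q n"
    using hopf_ideal_axb_ideal[OF qc] by (intro algebra_ideal.intro H.unital_algebra_axioms) (simp add: hopf_ideal_def)
  have "H.skew_relator q n \<in> axb_ideal K q n"
    unfolding axb_ideal_eq by (rule H.A.genideal_self'[OF H.skew_relator_closed[OF qc]])
  then have "axb_class K q n (H.skew_relator q n) = \<zero>\<^bsub>axb_quot K q n\<^esub>"
    by (simp add: axb_class_def axb_quot_def quotient_hopf_def Let_def I.quotient_algebra_zero
        H.A.a_rcos_zero[OF I.ideal_axioms])
  then have "Q.skew_commute (axb_class K q n (axb_a K) [^]\<^bsub>axb_quot K q n\<^esub> n) (axb_class K q n (axb_b K)) q"
    by (simp add: H.algebra_hom_skew_relator[OF Q.unital_algebra_axioms p qc])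
  \<comment> \<open>The unit whose m-th power is taken is the class of a^n; the result is the class
    of a^(n m), as the relator for q^m requires.\<close>
  from Q.skew_commute_int_pow[OF _ _ q this, of m]
  have "axb_class K q n (H.skew_relator (q [^] m) (m * n)) = \<zero>\<^bsub>axb_quot K q n\<^esub>"
    using Q.a_Units Q.gen_closed
    by (simp add: H.algebra_hom_skew_relator[OF Q.unital_algebra_axioms p qm]
        Q.A.Units_int_pow_pow mult.commute)
  then show ?thesis
    by (intro algebra_hom_idl_zero[OF H.unital_algebra_axioms Q.unital_algebra_axioms p _ _
          x[unfolded axb_ideal_eq]])
      (use H.skew_relator_closed[OF qm] in auto)
qed

text \<open>The map is the projection onto the quotient for q and n, factored through the quotient
  for q^m and m n: it takes a single value on each coset because it kills the ideal of the
  latter.\<close>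

lemma axb_quot_surj_hopf_hom:
  fixes m n :: int
  assumes q: "q \<in> Units K"
  defines "\<pi> \<equiv> \<lambda>X. the_elem (axb_class K q n ` X)"
  shows "\<pi> \<in> surj_hopf_hom K (axb_quot K (q [^] m) (m * n)) (axb_quot K q n)"
    and "x \<in> carrier (axb K) \<Longrightarrow> \<pi> (axb_class K (q [^] m) (m * n) x) = axb_class K q n x"
proof -
  have qc: "q \<in> carrier K" and qm: "q [^] m \<in> carrier K" using q by auto
  interpret Q: axb_hopf K "axb_quot K q n" "axb_class K q n (axb_a K)"
    "axb_class K q n (axb_a_inv K)" "axb_class K q n (axb_b K)"
    by (rule axb_hopf_axb_quot(1)[OF qc])
  interpret I: algebra_ideal K "axb K" "axb_ideal K (q [^] m) (m * n)"
    using hopf_ideal_axb_ideal[OF qm] by (intro algebra_ideal.intro H.unital_algebra_axioms) (simp add: hopf_ideal_def)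
  note p = axb_hopf_axb_quot(2)[OF qc, of n]
  have \<pi>: "\<pi> (I.proj x) = axb_class K q n x" if "x \<in> carrier (axb K)" for x
    unfolding \<pi>_def
    by (rule I.the_elem_image_proj[OF Q.module_axioms algebra_homD(1)[OF p] axb_class_zero[OF q] that])
  then show on_class: "\<pi> (axb_class K (q [^] m) (m * n) x) = axb_class K q n x"
    if "x \<in> carrier (axb K)" for x
    using that by (simp add: axb_class_def)
  have "\<pi> \<in> algebra_hom K (axb_quot K (q [^] m) (m * n)) (axb_quot K q n)"
    using I.quotient_algebra_hom[OF p \<pi>]
    by (simp add: axb_quot_def[of K "q [^] m"] quotient_hopf_def Let_def
        algebra_hom_def ring_hom_def linear_hom_def)
  then show "\<pi> \<in> surj_hopf_hom K (axb_quot K (q [^] m) (m * n)) (axb_quot K q n)"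
    by (rule surj_hopf_homI[OF axb_hopf_axb_quot(1)[OF qm] axb_hopf_axb_quot(1)[OF qc]])
      (simp_all add: on_class H.gen_closed)
qed

end

theorem mainTheorem3:
  fixes K :: "('k, 'n) ring_scheme" and q :: 'k and n :: int
  assumes "field K" and "q \<in> carrier K - {\<zero>\<^bsub>K\<^esub>}"
  shows "hopf_ideal K (axb K) (axb_ideal K q n)
    \<and> quantum_subgroup K (axb_quot K q n) (axb K)
    \<and> (\<forall>m::int. m \<noteq> 0 \<longrightarrow>
        quantum_subgroup K (axb_quot K q n) (axb_quot K (q [^]\<^bsub>K\<^esub> m) (m * n))
        \<and> (\<exists>\<pi> \<in> surj_hopf_hom K (axb_quot K (q [^]\<^bsub>K\<^esub> m) (m * n)) (axb_quot K q n).
            \<pi> (axb_class K (q [^]\<^bsub>K\<^esub> m) (m * n) (axb_a K)) = axb_class K q n (axb_a K)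
            \<and> \<pi> (axb_class K (q [^]\<^bsub>K\<^esub> m) (m * n) (axb_b K)) = axb_class K q n (axb_b K)))
    \<and> (\<forall>m::int. m \<noteq> 0 \<longrightarrow>
        quantum_subgroup K (axb_quot K q 1) (axb_quot K (q [^]\<^bsub>K\<^esub> m) m))"
proof -
  note K = assms(1)
  interpret K: field K by (rule K)
  \<comment> \<open>Nonzero scalars are units, so negative powers of \<open>q\<close> obey the group
    laws.\<close>
  have q: "q \<in> Units K" using assms(2) by (simp add: K.field_Units)
  have qm: "q [^]\<^bsub>K\<^esub> (m :: int) \<in> carrier K" for m using q by simp
  have qc: "q \<in> carrier K" using assms(2) by simp
  interpret H: axb_hopf K "axb K" "axb_a K" "axb_a_inv K" "axb_b K" by (rule axb_hopf_axb[OF K])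
  have hopf: "hopf_algebra K (axb_quot K p n)" if "p \<in> carrier K" for p n
    by (rule axb_hopf.hopf_algebra[OF axb_hopf_axb_quot(1)[OF K that]])
  have sub: "quantum_subgroup K (axb_quot K q n) (axb_quot K (q [^]\<^bsub>K\<^esub> m) (m * n))" for m n :: int
    unfolding quantum_subgroup_def using hopf[OF qc] hopf[OF qm] axb_quot_surj_hopf_hom(1)[OF K q] by blast
  have quot: "quantum_subgroup K (axb_quot K q n) (axb K)"
    unfolding quantum_subgroup_def
    using hopf[OF qc] H.hopf_algebra axb_class_surj_hopf_hom[OF K qc] by blast
  have proj: "\<exists>\<pi> \<in> surj_hopf_hom K (axb_quot K (q [^]\<^bsub>K\<^esub> m) (m * n)) (axb_quot K q n).
      \<pi> (axb_class K (q [^]\<^bsub>K\<^esub> m) (m * n) (axb_a K)) = axb_class K q n (axb_a K)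
      \<and> \<pi> (axb_class K (q [^]\<^bsub>K\<^esub> m) (m * n) (axb_b K)) = axb_class K q n (axb_b K)" for m :: int
    by (rule bexI[OF _ axb_quot_surj_hopf_hom(1)[OF K q]])
      (simp add: axb_quot_surj_hopf_hom(2)[OF K q] H.gen_closed)
  have one: "quantum_subgroup K (axb_quot K q 1) (axb_quot K (q [^]\<^bsub>K\<^esub> m) m)" for m :: int
    \<comment> \<open>The case n = 1, where m * n is m.\<close>
    using sub[of 1 m] by simp
  show ?thesis
    by (intro conjI allI impI hopf_ideal_axb_ideal[OF K qc] quot sub proj one)
qed

end
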